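(* Suppose $C$ is a $\mathbb{Q}$-algebra and $\mu:\Lambda\to C$ is an abstract $C$-valued $\Lambda$-distribution. (1) The associated abstract classical joint distribution of the power sum symmetric functions $\{p_i\}_{i\in\mathbb{Z}_{\ge1}}$ is independent if and only if there are power series $\gamma_i\in1+tC[[t]]$ ($i\ge1$) such that $$\mathrm{SMG}_\mu=\prod_{i=1}^\infty\gamma_i\left(\frac{p_i}{i}\right).$$ Moreover, in this case $\gamma_i$ is the moment generating function of the abstract classical distribution associated to $p_i$, for every $i$. (2) The associated abstract classical joint distribution of the cycle counting symmetric functions $\{p_i'\}_{i\in\mathbb{Z}_{\ge1}}$ is independent if and only if there are power series $\gamma_i\in1+tC[[t]]$ ($i\ge1$) such that $$\mathrm{FSMG}_\mu=\prod_{i=1}^\infty\gamma_i(p_i).$$ Moreover, in this case $\gamma_i$ is the falling moment generating function of the abstract classical distribution associated to $p_i'$, for every $i$.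
   Context: Rings are commutative with unit. $\Lambda=\varprojlim_n\mathbb{Z}[t_1,\ldots,t_n]^{\Sigma_n}$ (graded) is the ring of symmetric functions; $h_i,p_i$ are the complete and power sum symmetric functions; for a partition $\tau$, $h_\tau=h_{\tau_1}h_{\tau_2}\cdots$ and $m_\tau$ is the monomial symmetric function. $\Lambda_{\mathbb{Q}}=\Lambda\otimes\mathbb{Q}$. For a ring $C$, $\Lambda_C^\wedge$ is the ring of symmetric power series over $C$ in $t_1,t_2,\ldots$, i.e. formal, possibly infinite, sums $\sum_\tau a_\tau m_\tau$, $a_\tau\in C$. The $i$th cycle counting symmetric function is $p_i'=\frac1i\sum_{d\mid i}\mu_{\text{Möb}}(i/d)\,p_d\in\Lambda_{\mathbb{Q}}$, where $\mu_{\text{Möb}}$ is the Möbius function. Consider two sets of variables $s_\bullet=(s_1,s_2,\ldots)$ and $t_\bullet=(t_1,t_2,\ldots)$, and $\Lambda_\Lambda^\wedge$, the symmetric power series in $t_\bullet$ with coefficients in the ring $\Lambda$ of symmetric functions in $s_\bullet$. Its plethystic action is determined by: for $F\in\Lambda_\Lambda^\wedge$, $f\mapsto f\circ F$ is a ring homomorphism from $\Lambda$, and $p_i\circ F$ is obtained from $F$ by replacing every $s_j$ by $s_j^i$ and every $t_j$ by $t_j^i$. For $F$ with zero constant term (in $t_\bullet$), $\mathrm{Exp}_\sigma(F)=\sum_{k\ge0}h_k\circ F$; this is a bijection from series with constant term $0$ to series with constant term $1$, with inverse $\mathrm{Log}_\sigma$. For $F$ with constant term $1$ and any $N$, the (pre-$\lambda$)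 power is $F^N:=\mathrm{Exp}_\sigma(N\cdot\mathrm{Log}_\sigma(F))$. An abstract $C$-valued $\Lambda$-distribution is a homomorphism of abelian groups $\mu:\Lambda\to C$ with $\mu(1)=1$. Its abstract $\sigma$-moment generating function and abstract falling $\sigma$-moment generating function are $$\mathrm{SMG}_\mu:=\mu\bigl(\mathrm{Exp}_\sigma(h_1(s_\bullet)h_1(t_\bullet))\bigr)=\sum_\tau\mu(h_\tau)m_\tau\in\Lambda_C^\wedge,\qquad \mathrm{FSMG}_\mu:=\mu\bigl((1+h_1(t_\bullet))^{h_1(s_\bullet)}\bigr)\in\Lambda_C^\wedge,$$ where $\mu$ is applied to the coefficients, which lie in the copy of $\Lambda$ in the variables $s_\bullet$, and the power is the pre-$\lambda$ power. If $C$ is a $\mathbb{Q}$-algebra, $\mu$ is extended uniquely to a $\mathbb{Q}$-linear map $\mu:\Lambda_{\mathbb{Q}}\to C$. For $f\in\Lambda_{\mathbb{Q}}$, the moment generating function of the abstract classical distribution associated to $f$ is $\sum_{k\ge0}\frac{\mu(f^k)}{k!}t^k\in1+tC[[t]]$, and the falling moment generating function is $\sum_{k\ge0}\mu\left(\binom fk\right)t^k\in1+tC[[t]]$, where $\binom fk=\frac{f(f-1)\cdots(f-k+1)}{k!}$. For a family $\{f_i\}_{i\in I}$ in $\Lambda_{\mathbb{Q}}$, the associated abstract classical joint distribution is independent if for every finite set $\{i_1,\ldots,i_k\}\subseteq I$ (distinct indices) and all polynomials $g_{i_1},\ldots,g_{i_k}\in\mathbb{Q}[x]$, $\mu(g_{i_1}(f_{i_1})\cdots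 g_{i_k}(f_{i_k}))=\prod_{j=1}^k\mu(g_{i_j}(f_{i_j}))$. *)

theory Defs
  imports
    "HOL-Library.Poly_Mapping"
    "HOL-Computational_Algebra.Computational_Algebra"
begin

section \<open>Algebras over the rationals\<close>

text \<open>
  Commutative unital \<open>\<rat>\<close>-algebras, in the style of \<^class>\<open>real_algebra_1\<close>.  The class does not
  build on \<^class>\<open>comm_ring_1\<close>, whose axiom \<open>0 \<noteq> 1\<close> would exclude the zero ring.
\<close>

class rat_algebra = comm_ring + comm_monoid_mult +
  fixes scaleQ :: "rat \<Rightarrow> 'a \<Rightarrow> 'a" (infixr \<open>*\<^sub>Q\<close> 75)
  assumes scaleQ_add_right: "a *\<^sub>Q (x + y) = a *\<^sub>Q x + a *\<^sub>Q y"
    and scaleQ_add_left: "(a + b) *\<^sub>Q x = a *\<^sub>Q x + b *\<^sub>Q x"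
    and scaleQ_scaleQ: "a *\<^sub>Q b *\<^sub>Q x = (a * b) *\<^sub>Q x"
    and scaleQ_one: "1 *\<^sub>Q x = x"
    and mult_scaleQ_left: "(a *\<^sub>Q x) * y = a *\<^sub>Q (x * y)"

lemma vector_space_scaleQ: "vector_space (scaleQ :: rat \<Rightarrow> 'a \<Rightarrow> 'a::rat_algebra)"
  by standard (simp_all add: scaleQ_add_right scaleQ_add_left scaleQ_scaleQ scaleQ_one)

instantiation rat :: rat_algebra
begin

definition scaleQ_rat :: "rat \<Rightarrow> rat \<Rightarrow> rat" where
  "scaleQ_rat a x = a * x"

instance
  by standard (simp_all add: scaleQ_rat_def algebra_simps)

end


section \<open>Monomials in countably many variables\<close>

text \<open>
  A monomial is given by its exponents; \<open>j :: nat\<close> is the index of the variable \<open>t\<^bsub>j+1\<^esub>\<close>.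
\<close>

type_synonym monom = "nat \<Rightarrow>\<^sub>0 nat"

definition mdeg :: "monom \<Rightarrow> nat" where
  "mdeg m = (\<Sum>j\<in>Poly_Mapping.keys m. Poly_Mapping.lookup m j)"

lemma mdeg_superset:
  assumes "finite A" "Poly_Mapping.keys m \<subseteq> A"
  shows "mdeg m = (\<Sum>j\<in>A. Poly_Mapping.lookup m j)"
  unfolding mdeg_def using assms
  by (intro sum.mono_neutral_left) (auto simp: in_keys_iff)

lemma mdeg_add: "mdeg (a + b) = mdeg a + mdeg b"
proof -
  let ?A = "Poly_Mapping.keys a \<union> Poly_Mapping.keys b"
  have "Poly_Mapping.keys (a + b) \<subseteq> ?A"
    by (rule Poly_Mapping.keys_add)
  then have "mdeg (a + b) = (\<Sum>j\<in>?A. Poly_Mapping.lookup (a + b) j)"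
    by (intro mdeg_superset) auto
  also have "\<dots> = mdeg a + mdeg b"
    by (simp add: lookup_add sum.distrib mdeg_superset[of ?A])
  finally show ?thesis .
qed

lemma mdeg_zero [simp]: "mdeg 0 = 0"
  by (simp add: mdeg_def)

lemma lookup_map_key:
  "inj f \<Longrightarrow> Poly_Mapping.lookup (Poly_Mapping.map_key f m) j = Poly_Mapping.lookup m (f j)"
  by (simp add: map_key.rep_eq)

lemma map_key_inverse:
  assumes "bij f"
  shows "Poly_Mapping.map_key f (Poly_Mapping.map_key (inv f) m) = m"
    and "Poly_Mapping.map_key (inv f) (Poly_Mapping.map_key f m) = m"
  using assms
  by (auto intro!: poly_mapping_eqI
      simp: lookup_map_key bij_is_inj bij_imp_bij_inv surj_f_inv_f[OF bij_is_surj])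

lemma mdeg_map_key:
  assumes "bij f"
  shows "mdeg (Poly_Mapping.map_key f m) = mdeg m"
proof -
  have "mdeg (Poly_Mapping.map_key f m) =
      (\<Sum>j\<in>f -` Poly_Mapping.keys m. Poly_Mapping.lookup m (f j))"
    using assms by (simp add: mdeg_def keys_map_key lookup_map_key bij_is_inj)
  also have "\<dots> = (\<Sum>j\<in>f ` (f -` Poly_Mapping.keys m). Poly_Mapping.lookup m j)"
    using assms by (subst sum.reindex) (auto simp: bij_def inj_on_def)
  also have "f ` (f -` Poly_Mapping.keys m) = Poly_Mapping.keys m"
    using assms by (simp add: bij_is_surj surj_image_vimage_eq)
  finally show ?thesis
    by (simp add: mdeg_def)
qed

definition decomp :: "monom \<Rightarrow> (monom \<times> monom) set" where
  "decomp m = {(a, b). a + b = m}"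

lemma finite_decomp: "finite (decomp m)"
proof -
  let ?K = "Poly_Mapping.keys m"
  let ?N = "mdeg m"
  let ?S = "{a. Poly_Mapping.keys a \<subseteq> ?K \<and> (\<forall>j. Poly_Mapping.lookup a j \<le> ?N)}"
  have "Poly_Mapping.lookup ` ?S \<subseteq>
      {g. \<forall>j. (j \<in> ?K \<longrightarrow> g j \<in> {..?N}) \<and> (j \<notin> ?K \<longrightarrow> g j = 0)}"
    by (auto simp: in_keys_iff)
  moreover have "finite {g. \<forall>j. (j \<in> ?K \<longrightarrow> g j \<in> {..?N}) \<and> (j \<notin> ?K \<longrightarrow> g j = 0)}"
    by (intro finite_set_of_finite_funs) auto
  ultimately have "finite (Poly_Mapping.lookup ` ?S)"
    by (rule finite_subset)
  moreover have "inj_on Poly_Mapping.lookup ?S"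
    by (auto intro: inj_onI poly_mapping_eqI)
  ultimately have S: "finite ?S"
    by (simp add: finite_image_iff)
  have in_S: "a \<in> ?S" if "a + b = m" for a b
  proof -
    have le: "Poly_Mapping.lookup a j \<le> Poly_Mapping.lookup m j" for j
      using that by (auto simp: lookup_add)
    have "Poly_Mapping.lookup m j \<le> ?N" for j
      by (cases "j \<in> ?K") (auto simp: mdeg_def in_keys_iff intro: member_le_sum)
    with le have "Poly_Mapping.lookup a j \<le> ?N" for j
      using order_trans by blast
    moreover have "Poly_Mapping.keys a \<subseteq> ?K"
    proof
      fix j assume "j \<in> Poly_Mapping.keys a"
      with le[of j] show "j \<in> ?K"
        by (simp add: in_keys_iff)
    qed
    ultimately show ?thesis by blast
  qed
  have "decomp m \<subseteq> ?S \<times> ?S"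
  proof (rule subsetI)
    fix x assume "x \<in> decomp m"
    then obtain a b where "x = (a, b)" "a + b = m" "b + a = m"
      by (auto simp: decomp_def add.commute)
    with in_S show "x \<in> ?S \<times> ?S"
      by blast
  qed
  with S show ?thesis
    by (meson finite_SigmaI finite_subset)
qed


section \<open>Power series in countably many variables\<close>

typedef 'a mps = "UNIV :: (monom \<Rightarrow> 'a) set"
  morphisms mcoeff Abs_mps
  by simp

lemma mps_eqI: "(\<And>m. mcoeff F m = mcoeff G m) \<Longrightarrow> F = G"
  by (metis mcoeff_inverse ext)

lemma mcoeff_Abs_mps [simp]: "mcoeff (Abs_mps f) m = f m"
  by (simp add: Abs_mps_inverse)

instantiation mps :: (zero) zero
begin
definition zero_mps :: "'a mps" where "zero_mps = Abs_mps (\<lambda>_. 0)"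
instance ..
end

instantiation mps :: ("{zero, one}") one
begin
definition one_mps :: "'a mps" where "one_mps = Abs_mps (\<lambda>m. if m = 0 then 1 else 0)"
instance ..
end

instantiation mps :: (plus) plus
begin
definition plus_mps :: "'a mps \<Rightarrow> 'a mps \<Rightarrow> 'a mps" where
  "plus_mps F G = Abs_mps (\<lambda>m. mcoeff F m + mcoeff G m)"
instance ..
end

instantiation mps :: (minus) minus
begin
definition minus_mps :: "'a mps \<Rightarrow> 'a mps \<Rightarrow> 'a mps" where
  "minus_mps F G = Abs_mps (\<lambda>m. mcoeff F m - mcoeff G m)"
instance ..
end

instantiation mps :: (uminus) uminus
begin
definition uminus_mps :: "'a mps \<Rightarrow> 'a mps" where
  "uminus_mps F = Abs_mps (\<lambda>m. - mcoeff F m)"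
instance ..
end

instantiation mps :: ("{comm_monoid_add, times}") times
begin
definition times_mps :: "'a mps \<Rightarrow> 'a mps \<Rightarrow> 'a mps" where
  "times_mps F G = Abs_mps (\<lambda>m. \<Sum>(a, b)\<in>decomp m. mcoeff F a * mcoeff G b)"
instance ..
end

lemma mcoeff_simps [simp]:
  "mcoeff 0 m = 0"
  "mcoeff (F + G) m = mcoeff F m + mcoeff G m"
  "mcoeff (H - K) m = mcoeff H m - mcoeff K m"
  "mcoeff (- L) m = - mcoeff L m"
  by (simp_all add: zero_mps_def plus_mps_def minus_mps_def uminus_mps_def)

lemma mcoeff_one: "mcoeff 1 m = (if m = 0 then 1 else 0)"
  by (simp add: one_mps_def)

lemma mcoeff_mult: "mcoeff (F * G) m = (\<Sum>(a, b)\<in>decomp m. mcoeff F a * mcoeff G b)"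
  by (simp add: times_mps_def)

lemma mps_mult_assoc:
  fixes F G H :: "'a::comm_ring mps"
  shows "(F * G) * H = F * (G * H)"
proof (rule mps_eqI)
  fix m
  have "mcoeff ((F * G) * H) m =
      (\<Sum>x\<in>decomp m. \<Sum>y\<in>decomp (fst x).
        mcoeff F (fst y) * mcoeff G (snd y) * mcoeff H (snd x))"
    by (simp add: mcoeff_mult case_prod_beta sum_distrib_right)
  also have "\<dots> = (\<Sum>(x, y)\<in>(SIGMA x:decomp m. decomp (fst x)).
        mcoeff F (fst y) * mcoeff G (snd y) * mcoeff H (snd x))"
    by (subst sum.Sigma) (auto simp: finite_decomp)
  also have "\<dots> = (\<Sum>(x, y)\<in>(SIGMA x:decomp m. decomp (snd x)).
        mcoeff F (fst x) * (mcoeff G (fst y) * mcoeff H (snd y)))"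
    by (rule sum.reindex_bij_witness
        [where i = "\<lambda>(x, y). ((fst x + fst y, snd y), (fst x, fst y))"
           and j = "\<lambda>(x, y). ((fst y, snd y + snd x), (snd y, snd x))"])
      (auto simp: decomp_def algebra_simps)
  also have "\<dots> = (\<Sum>x\<in>decomp m. \<Sum>y\<in>decomp (snd x).
        mcoeff F (fst x) * (mcoeff G (fst y) * mcoeff H (snd y)))"
    by (subst sum.Sigma) (auto simp: finite_decomp)
  also have "\<dots> = mcoeff (F * (G * H)) m"
    by (simp add: mcoeff_mult case_prod_beta sum_distrib_left)
  finally show "mcoeff ((F * G) * H) m = mcoeff (F * (G * H)) m" .
qed

lemma mps_mult_commute:
  fixes F G :: "'a::comm_ring mps"
  shows "F * G = G * F"
proof (rule mps_eqI)
  fix m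
  show "mcoeff (F * G) m = mcoeff (G * F) m"
    unfolding mcoeff_mult
    by (rule sum.reindex_bij_witness[where i = prod.swap and j = prod.swap])
      (auto simp: decomp_def algebra_simps)
qed

instance mps :: (comm_ring) comm_ring
proof
  fix F G H :: "'a mps"
  show "F * G * H = F * (G * H)"
    by (rule mps_mult_assoc)
  show "F * G = G * F"
    by (rule mps_mult_commute)
  show "(F + G) * H = F * H + G * H"
    by (rule mps_eqI)
      (simp add: mcoeff_mult case_prod_beta distrib_right sum.distrib)
qed (auto intro!: mps_eqI simp: algebra_simps)

lemma mps_one_mult:
  fixes F :: "'a::{comm_ring, comm_monoid_mult} mps"
  shows "1 * F = F"
proof (rule mps_eqI)
  fix m
  have "mcoeff (1 * F) m = (\<Sum>x\<in>{(0, m)}. mcoeff 1 (fst x) * mcoeff F (snd x))"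
    unfolding mcoeff_mult case_prod_beta
    by (intro sum.mono_neutral_right finite_decomp) (auto simp: decomp_def mcoeff_one)
  then show "mcoeff (1 * F) m = mcoeff F m"
    by (simp add: mcoeff_one)
qed

instance mps :: ("{comm_ring, comm_monoid_mult}") comm_monoid_mult
  by standard (rule mps_one_mult)

instance mps :: (comm_ring_1) comm_ring_1
proof
  show "(0 :: 'a mps) \<noteq> 1"
    by (metis mcoeff_one mcoeff_simps(1) zero_neq_one)
qed

instantiation mps :: (rat_algebra) rat_algebra
begin

definition scaleQ_mps :: "rat \<Rightarrow> 'a mps \<Rightarrow> 'a mps" where
  "scaleQ_mps c F = Abs_mps (\<lambda>m. c *\<^sub>Q mcoeff F m)"

instance
proof
  interpret vector_space "scaleQ :: rat \<Rightarrow> 'a \<Rightarrow> 'a"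
    by (rule vector_space_scaleQ)
  fix c d :: rat and F G :: "'a mps"
  show "(c *\<^sub>Q F) * G = c *\<^sub>Q (F * G)"
    by (rule mps_eqI)
      (simp add: scaleQ_mps_def mcoeff_mult case_prod_beta mult_scaleQ_left scale_sum_right)
qed (auto intro!: mps_eqI
    simp: scaleQ_mps_def scaleQ_add_right scaleQ_add_left scaleQ_scaleQ scaleQ_one)

end

lemma mcoeff_scaleQ [simp]: "mcoeff (c *\<^sub>Q F) m = c *\<^sub>Q mcoeff F m"
  by (simp add: scaleQ_mps_def)

definition mps_const :: "'a::zero \<Rightarrow> 'a mps" where
  "mps_const c = Abs_mps (\<lambda>m. if m = 0 then c else 0)"

definition mps_map :: "('a \<Rightarrow> 'b) \<Rightarrow> 'a mps \<Rightarrow> 'b mps" where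
  "mps_map g F = Abs_mps (\<lambda>m. g (mcoeff F m))"

text \<open>The series obtained by replacing every variable \<open>t\<^sub>j\<close> by its \<open>i\<close>-th power (\<open>i \<ge> 1\<close>).\<close>

definition mps_vars_pow :: "nat \<Rightarrow> 'a::zero mps \<Rightarrow> 'a mps" where
  "mps_vars_pow i F = Abs_mps (\<lambda>m.
     if \<forall>j. i dvd Poly_Mapping.lookup m j then mcoeff F (Poly_Mapping.map (\<lambda>e. e div i) m) else 0)"

text \<open>
  Infinite sums and products are limits of the partial ones for the topology of coefficientwise
  eventual constancy; \<^term>\<open>mps_lim X\<close> is meaningful only if every coefficient of \<open>X\<close> stabilises.
  Infinite sums start at index 0, infinite products at index 1.
\<close>

definition mps_lim :: "(nat \<Rightarrow> 'a mps) \<Rightarrow> 'a mps" where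
  "mps_lim X = Abs_mps (\<lambda>m. THE c. \<forall>\<^sub>F n in sequentially. mcoeff (X n) m = c)"

definition mps_suminf :: "(nat \<Rightarrow> 'a::comm_ring mps) \<Rightarrow> 'a mps" where
  "mps_suminf G = mps_lim (\<lambda>n. \<Sum>k<n. G k)"

definition mps_prodinf :: "(nat \<Rightarrow> 'a::{comm_ring, comm_monoid_mult} mps) \<Rightarrow> 'a mps" where
  "mps_prodinf G = mps_lim (\<lambda>n. \<Prod>i=1..n. G i)"

text \<open>The substitution \<open>\<gamma>(G)\<close>, for \<open>G\<close> with constant term 0.\<close>

definition fps_subst_mps :: "'a::{comm_ring, comm_monoid_mult} fps \<Rightarrow> 'a mps \<Rightarrow> 'a mps" where
  "fps_subst_mps \<gamma> G = mps_suminf (\<lambda>k. mps_const (fps_nth \<gamma> k) * G ^ k)"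


section \<open>Symmetric power series and symmetric functions\<close>

text \<open>\<open>sym_series :: 'a mps set\<close> is the ring of symmetric power series over \<open>'a\<close>.\<close>

definition sym_series :: "'a mps set" where
  "sym_series = {F. \<forall>\<pi>. bij \<pi> \<longrightarrow> (\<forall>m. mcoeff F (Poly_Mapping.map_key \<pi> m) = mcoeff F m)}"

definition bounded_degree :: "'a::zero mps \<Rightarrow> bool" where
  "bounded_degree F \<longleftrightarrow> (\<exists>d. \<forall>m. d < mdeg m \<longrightarrow> mcoeff F m = 0)"

text \<open>
  The graded inverse limit of the rings of symmetric polynomials, realised as the symmetric power
  series of bounded degree: \<open>int symfun\<close> is \<open>\<Lambda>\<close> and \<open>rat symfun\<close> is \<open>\<Lambda> \<otimes> \<rat>\<close>.
\<close>

typedef (overloaded) 'a symfun = "{F :: 'a::zero mps. F \<in> sym_series \<and> bounded_degree F}"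
  morphisms mps_of_symfun Abs_symfun
  by (rule exI[of _ 0]) (simp add: sym_series_def bounded_degree_def)

setup_lifting type_definition_symfun

lemma sym_series_map2:
  assumes "F \<in> sym_series" "G \<in> sym_series" "\<And>m. mcoeff H m = g (mcoeff F m) (mcoeff G m)"
  shows "H \<in> sym_series"
  using assms by (simp add: sym_series_def)

lemma bounded_degree_map2:
  assumes "bounded_degree F" "bounded_degree G"
    and "\<And>m. mcoeff H m = g (mcoeff F m) (mcoeff G m)" "g 0 0 = 0"
  shows "bounded_degree H"
proof -
  from assms obtain d e where
    "\<And>m. d < mdeg m \<Longrightarrow> mcoeff F m = 0" "\<And>m. e < mdeg m \<Longrightarrow> mcoeff G m = 0"
    by (auto simp: bounded_degree_def)
  with assms(3,4) show ?thesis
    unfolding bounded_degree_def by (intro exI[of _ "max d e"]) auto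
qed

lemma sym_series_one: "(1 :: 'a::{zero, one} mps) \<in> sym_series"
proof -
  have "Poly_Mapping.map_key \<pi> m = 0 \<longleftrightarrow> m = 0" if "bij \<pi>" for \<pi> :: "nat \<Rightarrow> nat" and m :: monom
    using map_key_inverse(2)[OF that, of m] map_key_zero[of "inv \<pi>"] map_key_zero[of \<pi>] that
    by (metis bij_imp_bij_inv bij_is_inj)
  then show ?thesis
    by (simp add: sym_series_def mcoeff_one)
qed

lemma bounded_degree_one: "bounded_degree (1 :: 'a::{zero, one} mps)"
  unfolding bounded_degree_def by (intro exI[of _ 0]) (auto simp: mcoeff_one)

lemma sym_series_mult:
  fixes F G :: "'a::comm_ring mps"
  assumes "F \<in> sym_series" "G \<in> sym_series"
  shows "F * G \<in> sym_series"
  unfolding sym_series_def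
proof (intro CollectI allI impI)
  fix \<pi> :: "nat \<Rightarrow> nat" and m
  assume \<pi>: "bij \<pi>"
  note inj = bij_is_inj[OF \<pi>] bij_is_inj[OF bij_imp_bij_inv[OF \<pi>]]
  let ?f = "Poly_Mapping.map_key \<pi> :: monom \<Rightarrow> monom"
  let ?g = "Poly_Mapping.map_key (inv \<pi>) :: monom \<Rightarrow> monom"
  have F: "mcoeff F (?f a) = mcoeff F a" and G: "mcoeff G (?f a) = mcoeff G a" for a
    using assms \<pi> by (auto simp: sym_series_def)
  show "mcoeff (F * G) (?f m) = mcoeff (F * G) m"
    unfolding mcoeff_mult
    by (rule sum.reindex_bij_witness[where i = "\<lambda>(a, b). (?f a, ?f b)" and j = "\<lambda>(a, b). (?g a, ?g b)"])
      (auto simp: decomp_def map_key_inverse[OF \<pi>] F G inj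
        simp flip: map_key_plus F[of "?g _"] G[of "?g _"])
qed

lemma bounded_degree_mult:
  fixes F G :: "'a::comm_ring mps"
  assumes "bounded_degree F" "bounded_degree G"
  shows "bounded_degree (F * G)"
proof -
  from assms obtain d e where
    d: "\<And>m. d < mdeg m \<Longrightarrow> mcoeff F m = 0" and e: "\<And>m. e < mdeg m \<Longrightarrow> mcoeff G m = 0"
    by (auto simp: bounded_degree_def)
  have "mcoeff (F * G) m = 0" if "d + e < mdeg m" for m
    unfolding mcoeff_mult
  proof (rule sum.neutral, clarify)
    fix a b assume "(a, b) \<in> decomp m"
    then have "mdeg a + mdeg b = mdeg m"
      by (auto simp: decomp_def mdeg_add)
    with that have "d < mdeg a \<or> e < mdeg b"
      by linarith
    then show "mcoeff F a * mcoeff G b = 0"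
      using d e by auto
  qed
  then show ?thesis
    unfolding bounded_degree_def by blast
qed

instantiation symfun :: (zero) zero
begin
lift_definition zero_symfun :: "'a symfun" is 0
  by (simp add: sym_series_def bounded_degree_def)
instance ..
end

instantiation symfun :: ("{zero, one}") one
begin
lift_definition one_symfun :: "'a symfun" is 1
  by (simp add: sym_series_one bounded_degree_one)
instance ..
end

instantiation symfun :: (comm_ring) comm_ring
begin

lift_definition plus_symfun :: "'a symfun \<Rightarrow> 'a symfun \<Rightarrow> 'a symfun" is "(+)"
  by (auto intro: sym_series_map2[where g = "(+)"] bounded_degree_map2[where g = "(+)"])

lift_definition minus_symfun :: "'a symfun \<Rightarrow> 'a symfun \<Rightarrow> 'a symfun" is "(-)"
  by (auto intro: sym_series_map2[where g = "(-)"] bounded_degree_map2[where g = "(-)"])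

lift_definition uminus_symfun :: "'a symfun \<Rightarrow> 'a symfun" is uminus
  by (auto intro: sym_series_map2[where g = "\<lambda>x _. - x"] bounded_degree_map2[where g = "\<lambda>x _. - x"])

lift_definition times_symfun :: "'a symfun \<Rightarrow> 'a symfun \<Rightarrow> 'a symfun" is "(*)"
  by (simp add: sym_series_mult bounded_degree_mult)

instance
  by standard (transfer; simp add: algebra_simps)+

end

instance symfun :: ("{comm_ring, comm_monoid_mult}") comm_monoid_mult
  by standard (transfer; simp)

instance symfun :: (comm_ring_1) comm_ring_1
  by standard (transfer; simp)+

instantiation symfun :: (rat_algebra) rat_algebra
begin

lift_definition scaleQ_symfun :: "rat \<Rightarrow> 'a symfun \<Rightarrow> 'a symfun" is scaleQ
proof -
  fix c and F :: "'a mps"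
  interpret vector_space "scaleQ :: rat \<Rightarrow> 'a \<Rightarrow> 'a"
    by (rule vector_space_scaleQ)
  show "F \<in> sym_series \<and> bounded_degree F \<Longrightarrow> c *\<^sub>Q F \<in> sym_series \<and> bounded_degree (c *\<^sub>Q F)"
    by (auto intro: sym_series_map2[where g = "\<lambda>x _. c *\<^sub>Q x"]
        bounded_degree_map2[where g = "\<lambda>x _. c *\<^sub>Q x"])
qed

instance
  by standard
    (transfer; simp add: scaleQ_add_right scaleQ_add_left scaleQ_scaleQ scaleQ_one mult_scaleQ_left)+

end

lift_definition symfun_of_int :: "int symfun \<Rightarrow> rat symfun" is "mps_map of_int"
  by (auto simp: mps_map_def intro: sym_series_map2[where g = "\<lambda>x _. of_int x"]
      bounded_degree_map2[where g = "\<lambda>x _. of_int x"])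

lift_definition symfun_vars_pow :: "nat \<Rightarrow> 'a::zero symfun \<Rightarrow> 'a symfun" is mps_vars_pow
proof
  fix i and F :: "'a mps"
  assume "F \<in> sym_series \<and> bounded_degree F"
  then have F: "F \<in> sym_series" "bounded_degree F"
    by auto
  show "mps_vars_pow i F \<in> sym_series"
    unfolding sym_series_def
  proof (intro CollectI allI impI)
    fix \<pi> :: "nat \<Rightarrow> nat" and m
    assume \<pi>: "bij \<pi>"
    have "(\<forall>j. i dvd Poly_Mapping.lookup (Poly_Mapping.map_key \<pi> m) j) \<longleftrightarrow>
        (\<forall>j. i dvd Poly_Mapping.lookup m j)"
      using \<pi> by (metis bij_is_inj bij_pointE lookup_map_key)
    then show "mcoeff (mps_vars_pow i F) (Poly_Mapping.map_key \<pi> m) = mcoeff (mps_vars_pow i F) m"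
      using F(1) \<pi> by (simp add: mps_vars_pow_def sym_series_def bij_is_inj flip: map_key_map)
  qed
  from F(2) obtain d where d: "\<And>m. d < mdeg m \<Longrightarrow> mcoeff F m = 0"
    by (auto simp: bounded_degree_def)
  have "mcoeff (mps_vars_pow i F) m = 0" if m: "i * d < mdeg m" for m
  proof (cases "\<forall>j. i dvd Poly_Mapping.lookup m j")
    case True
    let ?m = "Poly_Mapping.map (\<lambda>e. e div i) m"
    have lookup: "Poly_Mapping.lookup m j = i * Poly_Mapping.lookup ?m j" for j
      using True by (auto simp: Poly_Mapping.map.rep_eq when_def)
    have "Poly_Mapping.keys ?m \<subseteq> Poly_Mapping.keys m"
      by (auto simp: in_keys_iff Poly_Mapping.map.rep_eq when_def split: if_splits)
    then have "mdeg m = i * mdeg ?m"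
      by (simp add: mdeg_superset[of "Poly_Mapping.keys m"] sum_distrib_left flip: lookup)
    with m have "d < mdeg ?m"
      by simp
    with d show ?thesis
      by (simp add: mps_vars_pow_def)
  qed (auto simp: mps_vars_pow_def)
  then show "bounded_degree (mps_vars_pow i F)"
    unfolding bounded_degree_def by blast
qed


subsection \<open>Complete and power sum symmetric functions\<close>

definition hcomp_mps :: "nat \<Rightarrow> 'a::{zero, one} mps" where
  "hcomp_mps n = Abs_mps (\<lambda>m. if mdeg m = n then 1 else 0)"

definition psum_mps :: "nat \<Rightarrow> 'a::{zero, one} mps" where
  "psum_mps n = Abs_mps (\<lambda>m. if \<exists>j. m = Poly_Mapping.single j n then 1 else 0)"

lift_definition hcomp :: "nat \<Rightarrow> 'a::{zero, one} symfun" is hcomp_mps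
  by (auto simp: sym_series_def bounded_degree_def hcomp_mps_def mdeg_map_key)

lift_definition psum :: "nat \<Rightarrow> 'a::{zero, one} symfun" is psum_mps
proof
  fix n
  show "(psum_mps n :: 'a mps) \<in> sym_series"
    unfolding sym_series_def
  proof (intro CollectI allI impI)
    fix \<pi> :: "nat \<Rightarrow> nat" and m
    assume \<pi>: "bij \<pi>"
    have single: "Poly_Mapping.map_key \<rho> (Poly_Mapping.single (\<rho> j) n) = Poly_Mapping.single j n"
      if "bij \<rho>" for \<rho> :: "nat \<Rightarrow> nat" and j
      using that by (simp add: bij_is_inj)
    have "(\<exists>j. Poly_Mapping.map_key \<pi> m = Poly_Mapping.single j n) \<longleftrightarrow>
        (\<exists>j. m = Poly_Mapping.single j n)"
      using single[OF \<pi>] map_key_inverse[OF \<pi>] \<pi> by (metis bij_pointE)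
    then show "mcoeff (psum_mps n :: 'a mps) (Poly_Mapping.map_key \<pi> m) = mcoeff (psum_mps n) m"
      by (simp add: psum_mps_def)
  qed
  have "mdeg (Poly_Mapping.single j n) = n" for j
    by (simp add: mdeg_def)
  then show "bounded_degree (psum_mps n :: 'a mps)"
    unfolding bounded_degree_def by (intro exI[of _ n]) (auto simp: psum_mps_def)
qed

definition moebius_mu :: "nat \<Rightarrow> int" where
  "moebius_mu n = (if squarefree n then (- 1) ^ card (prime_factors n) else 0)"

definition cyc_count :: "nat \<Rightarrow> rat symfun" where
  "cyc_count i = (1 / of_nat i) *\<^sub>Q (\<Sum>d | d dvd i. of_int (moebius_mu (i div d)) * psum d)"


section \<open>Plethysm, plethystic exponential and powers\<close>

text \<open>
  The symmetric power series in \<open>t\<close> with coefficients in the ring of symmetric functions in \<open>s\<close>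
  are the elements of \<open>sym_series :: int symfun mps set\<close>: the inner monomials are those in \<open>s\<close>, the
  outer ones those in \<open>t\<close>.
\<close>

definition adams :: "nat \<Rightarrow> int symfun mps \<Rightarrow> int symfun mps" where
  "adams i F = mps_vars_pow i (mps_map (symfun_vars_pow i) F)"

text \<open>
  The ring homomorphism is unique because the target is torsion-free and the power sums generate
  \<open>\<Lambda> \<otimes> \<rat>\<close>.
\<close>

definition plethysm :: "int symfun \<Rightarrow> int symfun mps \<Rightarrow> int symfun mps" where
  "plethysm f F = (THE \<phi>.
      (\<forall>g. \<phi> g \<in> sym_series) \<and>
      \<phi> 1 = 1 \<and> (\<forall>g h. \<phi> (g + h) = \<phi> g + \<phi> h) \<and> (\<forall>g h. \<phi> (g * h) = \<phi> g * \<phi> h) \<and>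
      (\<forall>i\<ge>1. \<phi> (psum i) = adams i F)) f"

definition Exp_sigma :: "int symfun mps \<Rightarrow> int symfun mps" where
  "Exp_sigma F = mps_suminf (\<lambda>k. plethysm (hcomp k) F)"

definition Log_sigma :: "int symfun mps \<Rightarrow> int symfun mps" where
  "Log_sigma = the_inv_into {F \<in> sym_series. mcoeff F 0 = 0} Exp_sigma"

definition pre_lambda_power :: "int symfun mps \<Rightarrow> int symfun mps \<Rightarrow> int symfun mps" where
  "pre_lambda_power F N = Exp_sigma (N * Log_sigma F)"


section \<open>Abstract distributions\<close>

definition Lambda_distribution :: "(int symfun \<Rightarrow> 'c::{comm_ring, comm_monoid_mult}) \<Rightarrow> bool" where
  "Lambda_distribution \<mu> \<longleftrightarrow> additive \<mu> \<and> \<mu> 1 = 1"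

text \<open>
  In both generating functions \<open>h\<^sub>1(s)\<close> is the constant series \<^term>\<open>mps_const (hcomp 1)\<close> and
  \<open>h\<^sub>1(t)\<close> is \<^term>\<open>hcomp_mps 1\<close>.
\<close>

definition SMG :: "(int symfun \<Rightarrow> 'c) \<Rightarrow> 'c mps" where
  "SMG \<mu> = mps_map \<mu> (Exp_sigma (mps_const (hcomp 1) * hcomp_mps 1))"

definition FSMG :: "(int symfun \<Rightarrow> 'c) \<Rightarrow> 'c mps" where
  "FSMG \<mu> = mps_map \<mu> (pre_lambda_power (1 + hcomp_mps 1) (mps_const (hcomp 1)))"

definition rat_extension :: "(int symfun \<Rightarrow> 'c) \<Rightarrow> rat symfun \<Rightarrow> 'c::rat_algebra" where
  "rat_extension \<mu> = (THE \<nu>. Vector_Spaces.linear scaleQ scaleQ \<nu> \<and> (\<forall>f. \<nu> (symfun_of_int f) = \<mu> f))"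

definition moment_gf :: "(int symfun \<Rightarrow> 'c) \<Rightarrow> rat symfun \<Rightarrow> 'c::rat_algebra fps" where
  "moment_gf \<mu> f = Abs_fps (\<lambda>k. (1 / fact k) *\<^sub>Q rat_extension \<mu> (f ^ k))"

definition symfun_binomial :: "rat symfun \<Rightarrow> nat \<Rightarrow> rat symfun" where
  "symfun_binomial f k = (1 / fact k) *\<^sub>Q (\<Prod>i<k. f - of_nat i)"

definition falling_moment_gf :: "(int symfun \<Rightarrow> 'c) \<Rightarrow> rat symfun \<Rightarrow> 'c::rat_algebra fps" where
  "falling_moment_gf \<mu> f = Abs_fps (\<lambda>k. rat_extension \<mu> (symfun_binomial f k))"

definition qpoly_eval :: "rat poly \<Rightarrow> 'a::rat_algebra \<Rightarrow> 'a" where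
  "qpoly_eval g x = (\<Sum>k\<le>degree g. coeff g k *\<^sub>Q x ^ k)"

definition independent_family ::
  "(int symfun \<Rightarrow> 'c::rat_algebra) \<Rightarrow> 'i set \<Rightarrow> ('i \<Rightarrow> rat symfun) \<Rightarrow> bool" where
  "independent_family \<mu> I f \<longleftrightarrow>
     (\<forall>J g. finite J \<and> J \<subseteq> I \<longrightarrow>
        rat_extension \<mu> (\<Prod>j\<in>J. qpoly_eval (g j) (f j)) =
        (\<Prod>j\<in>J. rat_extension \<mu> (qpoly_eval (g j) (f j))))"

end

theory Submission
  imports Defs
begin

text \<open>
  Let \<open>\<theta>\<close> be the Euler derivation of power series in \<open>t\<close> by total degree.  The logarithmic derivative of
  \<open>Exp\<^sub>\<sigma>(F)\<close> is \<open>\<Sum>\<^sub>i p\<^sub>i \<circ> \<theta>F\<close>, by Newton's identities, and a series with constant term 1 over a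
  torsion-free ring is determined by its logarithmic derivative.  Comparing these identifies
  \<open>Exp\<^sub>\<sigma>(h\<^sub>1(s) h\<^sub>1(t))\<close> with \<open>\<Prod>\<^sub>i exp(p\<^sub>i(s) p\<^sub>i(t) / i)\<close> and, since \<open>\<Sum>\<^bsub>d | n\<^esub> d p'\<^sub>d = p\<^sub>n\<close>,
  \<open>(1 + h\<^sub>1(t))\<^bsup>h\<^sub>1(s)\<^esup>\<close> with \<open>\<Prod>\<^sub>i (1 + p\<^sub>i(t))\<^bsup>p'\<^sub>i(s)\<^esup>\<close>.  Both generating functions are thus series in
  the monomials \<open>\<Prod>\<^sub>i p\<^sub>i(t)\<^bsup>e\<^sub>i\<^esup>\<close> whose coefficients are the joint (falling) moments; the monomials are
  linearly independent over a \<open>\<rat>\<close>-algebra, so the series is a product over \<open>i\<close> exactly if the joint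
  moments are multiplicative.

  Plethysm has to be shown to exist over \<open>\<int>\<close>.  The power sums generate \<open>\<Lambda>\<close> up to denominators, so
  \<open>f \<circ> F\<close> is determined up to an integer factor \<open>D\<close>, and it remains to see that this factor can be divided
  out.  Modulo \<open>D\<close> the coefficients of \<open>F\<close> may be replaced by nonnegative ones; then \<open>F\<close> is
  a sum of monomials, and \<open>f \<circ> F\<close> is the value of \<open>f\<close> at these.
\<close>

text \<open>The obstacle is that \<Lambda> has no denominators, while exponential and logarithm need
  them. A derivation avoids both: on \<open>p_i\<close> composed with \<open>F\<close> it produces a
  factor \<open>i\<close>, which cancels the \<open>1/i\<close> of the exponential formula, so
  logarithmic derivatives stay integral. Rational coefficients enter only when the result is
  compared with a product over \<open>i\<close>. Divisibility by \<open>D\<close> is tested one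
  coefficient at a time, at the divisors of a fixed pair of monomials. They are finitely many, so
  finitely many monomials replace \<open>F\<close>; and they are closed under taking factors, so the
  congruences are compatible with products. One integral triangularity, between products of power
  sums and monomials, serves twice. Its diagonal entries, products of factorials, are the
  denominators with which the power sums generate \<Lambda>, and their invertibility over a rational
  algebra gives linear independence. Both parts of the theorem are instances of one statement,
  because \<open>x^k / k!\<close> and \<open>binomial x k\<close> obey one recurrence with a
  parameter \<open>c\<close>, equal to 0 or 1. The algebra may be the zero ring, hence the sort
  \<open>comm_ring\<close> with \<open>comm_monoid_mult\<close>.\<close>

locale unital_hom =
  fixes g :: "'a::{comm_ring, comm_monoid_mult} \<Rightarrow> 'b::{comm_ring, comm_monoid_mult}"
  assumes hom_add: "g (x + y) = g x + g y"
    and hom_mult: "g (x * y) = g x * g y"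
    and hom_one: "g 1 = 1"
begin

lemma hom_zero: "g 0 = 0"
  using hom_add[of 0 0] by simp

lemma hom_minus: "g (- x) = - g x"
  using hom_add[of x "- x"] by (simp add: hom_zero eq_neg_iff_add_eq_0 add.commute)

lemma hom_diff: "g (x - y) = g x - g y"
  using hom_add[of x "- y"] by (simp add: hom_minus)

lemma hom_sum: "g (sum f A) = (\<Sum>x\<in>A. g (f x))"
  by (induction A rule: infinite_finite_induct) (simp_all add: hom_zero hom_add)

lemma hom_prod: "g (prod f A) = (\<Prod>x\<in>A. g (f x))"
  by (induction A rule: infinite_finite_induct) (simp_all add: hom_one hom_mult)

lemma hom_power: "g (x ^ n) = g x ^ n"
  by (induction n) (simp_all add: hom_one hom_mult)

end

lemma unital_hom_of_nat:
  fixes g :: "'a::comm_ring_1 \<Rightarrow> 'b::comm_ring_1"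
  assumes "unital_hom g"
  shows "g (of_nat n) = of_nat n"
proof -
  interpret unital_hom g by fact
  show ?thesis
    by (induction n) (simp_all add: hom_zero hom_one hom_add)
qed

lemma unital_hom_compose: "unital_hom f \<Longrightarrow> unital_hom g \<Longrightarrow> unital_hom (\<lambda>x. g (f x))"
  by (simp add: unital_hom_def)

subsection \<open>Coefficients of power series\<close>

lemma mcoeff_sum: "mcoeff (sum F A) m = (\<Sum>x\<in>A. mcoeff (F x) m)"
  for F :: "_ \<Rightarrow> 'a::comm_ring mps"
  by (induction A rule: infinite_finite_induct) simp_all

lemma mcoeff_of_nat_mult: "mcoeff (of_nat n * F) m = of_nat n * mcoeff F m"
  for F :: "'a::comm_ring_1 mps"
  by (induction n) (simp_all add: algebra_simps)

lemma mcoeff_const_mult: "mcoeff (mps_const c * F) m = c * mcoeff F m"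
  for F :: "'a::comm_ring mps"
proof -
  have "mcoeff (mps_const c * F) m = (\<Sum>x\<in>{(0, m)}. mcoeff (mps_const c) (fst x) * mcoeff F (snd x))"
    unfolding mcoeff_mult case_prod_beta
    by (intro sum.mono_neutral_right finite_decomp) (auto simp: decomp_def mps_const_def)
  then show ?thesis
    by (simp add: mps_const_def)
qed

lemma mcoeff_mps_const: "mcoeff (mps_const c) m = (if m = 0 then c else 0)"
  by (simp add: mps_const_def)

lemma mcoeff_map [simp]: "mcoeff (mps_map g F) m = g (mcoeff F m)"
  by (simp add: mps_map_def)

lemma unital_hom_mps_const:
  "unital_hom (mps_const :: 'a::{comm_ring, comm_monoid_mult} \<Rightarrow> 'a mps)"
proof
  fix x y :: 'a
  show "mps_const (x * y) = mps_const x * mps_const y"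
    by (rule mps_eqI) (simp add: mcoeff_const_mult mcoeff_mps_const)
qed (auto intro!: mps_eqI simp: mcoeff_mps_const mcoeff_one)

lemma unital_hom_mps_map:
  assumes "unital_hom g"
  shows "unital_hom (mps_map g)"
proof -
  interpret unital_hom g by fact
  show ?thesis
  proof
    fix F G
    show "mps_map g (F * G) = mps_map g F * mps_map g G"
      by (rule mps_eqI) (simp add: mcoeff_mult hom_sum hom_mult case_prod_beta)
  qed (auto intro!: mps_eqI simp: hom_add hom_zero hom_one mcoeff_one)
qed

section \<open>Substituting powers of the variables, and Adams operations\<close>

text \<open>The exponents of the \<open>i\<close>-th power of a monomial.
  \<open>mps_vars_pow i\<close> is supported on the range of \<open>mscale i\<close>; describing it
  there avoids the integer division in its definition.\<close>

definition mscale :: "nat \<Rightarrow> monom \<Rightarrow> monom" where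
  "mscale i m = Poly_Mapping.map ((*) i) m"

lemma lookup_mscale [simp]: "Poly_Mapping.lookup (mscale i m) j = i * Poly_Mapping.lookup m j"
  by (simp add: mscale_def Poly_Mapping.map.rep_eq when_def)

lemma mscale_add: "mscale i (a + b) = mscale i a + mscale i b"
  by (rule poly_mapping_eqI) (simp add: lookup_add distrib_left)

lemma mscale_inject [simp]: "i \<ge> 1 \<Longrightarrow> mscale i a = mscale i b \<longleftrightarrow> a = b"
  by (auto simp: poly_mapping_eq_iff fun_eq_iff)

lemma mscale_zero [simp]: "mscale i 0 = 0"
  by (rule poly_mapping_eqI) simp

lemma mscale_eq_0_iff [simp]: "i \<ge> 1 \<Longrightarrow> mscale i a = 0 \<longleftrightarrow> a = 0"
  using mscale_inject[of i a 0] by simp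

lemma mscale_mscale: "mscale i (mscale k m) = mscale (i * k) m"
  by (rule poly_mapping_eqI) simp

lemma mscale_1 [simp]: "mscale (Suc 0) m = m"
  by (rule poly_mapping_eqI) simp

lemma mscale_single: "mscale i (Poly_Mapping.single j k) = Poly_Mapping.single j (i * k)"
  by (rule poly_mapping_eqI) (simp add: lookup_single when_def)

lemma mdeg_mscale: "mdeg (mscale i m) = i * mdeg m"
proof -
  have "Poly_Mapping.keys (mscale i m) \<subseteq> Poly_Mapping.keys m"
    by (auto simp: in_keys_iff)
  then have "mdeg (mscale i m) = (\<Sum>j\<in>Poly_Mapping.keys m. i * Poly_Mapping.lookup m j)"
    by (subst mdeg_superset[of "Poly_Mapping.keys m"]) auto
  then show ?thesis
    by (simp add: mdeg_def sum_distrib_left)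
qed

lemma dvd_eq_mscale:
  assumes "\<forall>j. i dvd Poly_Mapping.lookup m j"
  shows "m = mscale i (Poly_Mapping.map (\<lambda>e. e div i) m)"
  by (rule poly_mapping_eqI) (use assms in \<open>auto simp: Poly_Mapping.map.rep_eq when_def\<close>)

lemma in_range_mscale: "m \<in> range (mscale i) \<longleftrightarrow> (\<forall>j. i dvd Poly_Mapping.lookup m j)"
  using dvd_eq_mscale by auto

lemma mcoeff_vars_pow_mscale [simp]:
  "i \<ge> 1 \<Longrightarrow> mcoeff (mps_vars_pow i F) (mscale i m) = mcoeff F m"
proof -
  assume i: "i \<ge> 1"
  have "Poly_Mapping.map (\<lambda>e. e div i) (mscale i m) = m"
    by (rule poly_mapping_eqI) (use i in \<open>auto simp: Poly_Mapping.map.rep_eq when_def\<close>)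
  then show ?thesis
    by (simp add: mps_vars_pow_def)
qed

lemma mcoeff_vars_pow_outside:
  "m \<notin> range (mscale i) \<Longrightarrow> mcoeff (mps_vars_pow i F) m = 0"
  unfolding in_range_mscale by (auto simp: mps_vars_pow_def)

lemma mps_vars_pow_eqI:
  assumes "i \<ge> 1" "\<And>m. mcoeff G (mscale i m) = mcoeff F m"
    and "\<And>m. m \<notin> range (mscale i) \<Longrightarrow> mcoeff G m = 0"
  shows "mps_vars_pow i F = G"
proof (rule mps_eqI)
  fix m
  show "mcoeff (mps_vars_pow i F) m = mcoeff G m"
    by (cases "m \<in> range (mscale i)") (use assms in \<open>auto simp: mcoeff_vars_pow_outside\<close>)
qed

text \<open>For products: the factorisations of \<open>mscale i m\<close> into two
  \<open>i\<close>-th powers are the images of the factorisations of \<open>m\<close>, and every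
  other factorisation has a factor at which the coefficient is zero.\<close>

lemma unital_hom_vars_pow:
  assumes i: "i \<ge> 1"
  shows "unital_hom (mps_vars_pow i :: 'a::{comm_ring, comm_monoid_mult} mps \<Rightarrow> 'a mps)"
proof
  fix F G :: "'a mps"
  show "mps_vars_pow i (F + G) = mps_vars_pow i F + mps_vars_pow i G"
    by (rule mps_vars_pow_eqI) (use i in \<open>auto simp: mcoeff_vars_pow_outside\<close>)
  show "mps_vars_pow i (1 :: 'a mps) = 1"
  proof (rule mps_vars_pow_eqI[OF i])
    fix m assume "m \<notin> range (mscale i)"
    then have "m \<noteq> 0"
      by (metis mscale_zero rangeI)
    then show "mcoeff (1 :: 'a mps) m = 0"
      by (simp add: mcoeff_one)
  qed (use i in \<open>simp add: mcoeff_one\<close>)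
  let ?F = "mps_vars_pow i F" and ?G = "mps_vars_pow i G"
  show "mps_vars_pow i (F * G) = ?F * ?G"
  proof (rule mps_vars_pow_eqI[OF i])
    fix m
    have "mcoeff (?F * ?G) (mscale i m) =
        (\<Sum>(a, b)\<in>(\<lambda>(a, b). (mscale i a, mscale i b)) ` decomp m. mcoeff ?F a * mcoeff ?G b)"
      unfolding mcoeff_mult
    proof (rule sum.mono_neutral_right[OF finite_decomp])
      show "(\<lambda>(a, b). (mscale i a, mscale i b)) ` decomp m \<subseteq> decomp (mscale i m)"
        by (auto simp: decomp_def simp flip: mscale_add)
      show "\<forall>x\<in>decomp (mscale i m) - (\<lambda>(a, b). (mscale i a, mscale i b)) ` decomp m.
          (case x of (a, b) \<Rightarrow> mcoeff ?F a * mcoeff ?G b) = 0"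
      proof clarify
        fix a b assume ab: "(a, b) \<in> decomp (mscale i m)"
          "(a, b) \<notin> (\<lambda>(a, b). (mscale i a, mscale i b)) ` decomp m"
        have False if "a = mscale i a'" "b = mscale i b'" for a' b'
        proof -
          have "mscale i (a' + b') = mscale i m"
            using ab(1) that by (simp add: decomp_def mscale_add)
          then have "(a', b') \<in> decomp m"
            using i by (simp add: decomp_def)
          then show False
            using ab(2) that by force
        qed
        then have "a \<notin> range (mscale i) \<or> b \<notin> range (mscale i)"
          by blast
        then show "mcoeff ?F a * mcoeff ?G b = 0"
          by (auto simp: mcoeff_vars_pow_outside)
      qed
    qed
    also have "\<dots> = mcoeff (F * G) m"
      unfolding mcoeff_mult using i
      by (subst sum.reindex) (auto simp: inj_on_def case_prod_beta prod_eq_iff)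
    finally show "mcoeff (?F * ?G) (mscale i m) = mcoeff (F * G) m" .
  next
    fix m assume m: "m \<notin> range (mscale i)"
    show "mcoeff (?F * ?G) m = 0"
      unfolding mcoeff_mult
    proof (rule sum.neutral, clarify)
      fix a b assume "(a, b) \<in> decomp m"
      with m have "a \<notin> range (mscale i) \<or> b \<notin> range (mscale i)"
        by (auto simp: decomp_def simp flip: mscale_add)
      then show "mcoeff ?F a * mcoeff ?G b = 0"
        by (auto simp: mcoeff_vars_pow_outside)
    qed
  qed
qed

lemma unital_hom_mps_of_symfun:
  "unital_hom (mps_of_symfun :: 'a::{comm_ring, comm_monoid_mult} symfun \<Rightarrow> 'a mps)"
  by standard (transfer; simp)+

lemma mps_of_symfun_simps:
  fixes f g :: "'a::{comm_ring, comm_monoid_mult} symfun"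
  shows "mps_of_symfun (f + g) = mps_of_symfun f + mps_of_symfun g"
    "mps_of_symfun (f * g) = mps_of_symfun f * mps_of_symfun g"
    "mps_of_symfun (1 :: 'a symfun) = 1"
    "mps_of_symfun (0 :: 'a symfun) = 0"
  by (transfer; simp)+

lemma unital_hom_symfun_vars_pow:
  assumes i: "i \<ge> 1"
  shows "unital_hom (symfun_vars_pow i :: 'a::{comm_ring, comm_monoid_mult} symfun \<Rightarrow> 'a symfun)"
proof -
  interpret unital_hom "mps_vars_pow i :: 'a mps \<Rightarrow> 'a mps"
    by (rule unital_hom_vars_pow[OF i])
  show ?thesis
    by standard (simp_all add: symfun_vars_pow.rep_eq mps_of_symfun_simps hom_add hom_mult hom_one
        flip: mps_of_symfun_inject)
qed

lemma unital_hom_adams: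
  assumes i: "i \<ge> 1"
  shows "unital_hom (adams i)"
  unfolding adams_def
  by (intro unital_hom_compose[OF unital_hom_mps_map unital_hom_vars_pow]
      unital_hom_symfun_vars_pow i)

lemma unital_hom_of_int: "unital_hom (of_int :: int \<Rightarrow> 'a::comm_ring_1)"
  by standard simp_all

lemma unital_hom_symfun_of_int: "unital_hom symfun_of_int"
proof -
  interpret unital_hom "mps_map (of_int :: int \<Rightarrow> rat)"
    by (intro unital_hom_mps_map unital_hom_of_int)
  show ?thesis
    by standard (simp_all add: symfun_of_int.rep_eq mps_of_symfun_simps hom_add hom_mult hom_one
        flip: mps_of_symfun_inject)
qed

lemma mps_vars_pow_mps_vars_pow:
  assumes "i \<ge> 1" "k \<ge> 1"
  shows "mps_vars_pow i (mps_vars_pow k F) = mps_vars_pow (i * k) F"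
proof (rule mps_vars_pow_eqI)
  fix m
  show "mcoeff (mps_vars_pow (i * k) F) (mscale i m) = mcoeff (mps_vars_pow k F) m"
  proof (cases "m \<in> range (mscale k)")
    case True
    with assms show ?thesis by (auto simp: mscale_mscale)
  next
    case False
    have "mscale i m \<notin> range (mscale (i * k))"
      using False assms by (auto simp flip: mscale_mscale)
    with False show ?thesis by (simp add: mcoeff_vars_pow_outside)
  qed
next
  fix m assume "m \<notin> range (mscale i)"
  then have "m \<notin> range (mscale (i * k))"
    by (auto simp flip: mscale_mscale)
  then show "mcoeff (mps_vars_pow (i * k) F) m = 0"
    by (simp add: mcoeff_vars_pow_outside)
qed (use assms in auto)

lemma mps_map_vars_pow:
  "g 0 = 0 \<Longrightarrow> mps_map g (mps_vars_pow i F) = mps_vars_pow i (mps_map g F)"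
  by (rule mps_eqI) (simp add: mps_vars_pow_def)

lemma mps_map_map: "mps_map g (mps_map h F) = mps_map (\<lambda>x. g (h x)) F"
  by (rule mps_eqI) simp

lemma symfun_vars_pow_0 [simp]: "symfun_vars_pow i 0 = 0"
  by transfer (rule mps_eqI, simp add: mps_vars_pow_def)

lemma adams_adams:
  assumes "i \<ge> 1" "k \<ge> 1"
  shows "adams i (adams k F) = adams (i * k) F"
proof -
  have "symfun_vars_pow i (symfun_vars_pow k f) = symfun_vars_pow (i * k) f" for f :: "int symfun"
    by (simp add: symfun_vars_pow.rep_eq mps_vars_pow_mps_vars_pow[OF assms] flip: mps_of_symfun_inject)
  then show ?thesis
    using assms by (simp add: adams_def mps_map_vars_pow mps_map_map mps_vars_pow_mps_vars_pow)
qed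

lemma adams_1 [simp]: "adams (Suc 0) F = F"
proof -
  have 1: "mps_vars_pow (Suc 0) G = G" for G :: "'a::zero mps"
    by (rule mps_vars_pow_eqI) (auto simp: image_iff)
  then have "symfun_vars_pow (Suc 0) f = f" for f :: "int symfun"
    by (simp add: symfun_vars_pow.rep_eq flip: mps_of_symfun_inject)
  then show ?thesis
    by (simp add: adams_def 1 mps_map_def mcoeff_inverse)
qed

lemma mps_vars_pow_psum_mps:
  assumes "i \<ge> 1"
  shows "mps_vars_pow i (psum_mps n :: 'a::zero_neq_one mps) = psum_mps (i * n)"
proof (rule mps_vars_pow_eqI[OF assms])
  fix m
  have "mscale i m = Poly_Mapping.single j (i * n) \<longleftrightarrow> m = Poly_Mapping.single j n" for j
    using assms by (simp flip: mscale_single)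
  then show "mcoeff (psum_mps (i * n) :: 'a mps) (mscale i m) = mcoeff (psum_mps n) m"
    by (simp add: psum_mps_def)
next
  fix m assume "m \<notin> range (mscale i)"
  then have "m \<noteq> Poly_Mapping.single j (i * n)" for j
    by (auto simp flip: mscale_single)
  then show "mcoeff (psum_mps (i * n) :: 'a mps) m = 0"
    by (simp add: psum_mps_def)
qed

lemma symfun_vars_pow_psum: "i \<ge> 1 \<Longrightarrow> symfun_vars_pow i (psum n :: int symfun) = psum (i * n)"
  by (transfer fixing: i n) (simp add: mps_vars_pow_psum_mps)

subsection \<open>Multiplication by a power sum\<close>

lemma mono_minus_single_add:
  "i \<le> Poly_Mapping.lookup m j \<Longrightarrow> (m - Poly_Mapping.single j i) + Poly_Mapping.single j i = (m :: monom)"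
  by (rule poly_mapping_eqI) (auto simp: lookup_add lookup_minus lookup_single when_def)

lemma mono_add_single_minus: "(m + Poly_Mapping.single j i) - Poly_Mapping.single j i = (m :: monom)"
  by (rule poly_mapping_eqI) (auto simp: lookup_add lookup_minus lookup_single when_def)

lemma mdeg_single [simp]: "mdeg (Poly_Mapping.single j i) = i"
  by (simp add: mdeg_def)

lemma mdeg_minus_single:
  "i \<le> Poly_Mapping.lookup m j \<Longrightarrow> mdeg (m - Poly_Mapping.single j i) + i = mdeg m"
  using arg_cong[OF mono_minus_single_add[of i m j], of mdeg] by (simp add: mdeg_add)

lemma lookup_le_mdeg: "Poly_Mapping.lookup m j \<le> mdeg m"
  by (cases "j \<in> Poly_Mapping.keys m") (auto simp: mdeg_def in_keys_iff intro: member_le_sum)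

text \<open>The pure powers that make up \<open>psum_mps i\<close> are distinct for distinct
  variables since \<open>i\<close> is positive; each one that divides \<open>m\<close> contributes
  the coefficient of \<open>G\<close> at the quotient.\<close>

lemma mcoeff_psum_mult:
  fixes G :: "'a::{comm_ring, comm_monoid_mult} mps"
  assumes i: "i \<ge> 1"
  shows "mcoeff (psum_mps i * G) m =
    (\<Sum>j | j \<in> Poly_Mapping.keys m \<and> i \<le> Poly_Mapping.lookup m j. mcoeff G (m - Poly_Mapping.single j i))"
    (is "_ = sum _ ?J")
proof -
  let ?h = "\<lambda>j. (Poly_Mapping.single j i, m - Poly_Mapping.single j i)"
  have "mcoeff (psum_mps i * G) m =
      (\<Sum>x\<in>?h ` ?J. mcoeff (psum_mps i) (fst x) * mcoeff G (snd x))"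
    unfolding mcoeff_mult case_prod_beta
  proof (rule sum.mono_neutral_right[OF finite_decomp])
    show "?h ` ?J \<subseteq> decomp m"
      by (auto simp: decomp_def mono_minus_single_add add.commute[of "Poly_Mapping.single _ _"])
    show "\<forall>x\<in>decomp m - ?h ` ?J. mcoeff (psum_mps i) (fst x) * mcoeff G (snd x) = 0"
    proof
      fix x assume x: "x \<in> decomp m - ?h ` ?J"
      have "fst x \<noteq> Poly_Mapping.single j i" for j
      proof
        assume j: "fst x = Poly_Mapping.single j i"
        then have m: "m = snd x + Poly_Mapping.single j i"
          using x by (auto simp: decomp_def add.commute)
        then have "i \<le> Poly_Mapping.lookup m j" "snd x = m - Poly_Mapping.single j i"
          by (simp_all add: lookup_add mono_add_single_minus)
        with i have "j \<in> ?J" "x = ?h j"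
          by (auto simp: in_keys_iff j prod_eq_iff)
        with x show False by blast
      qed
      then show "mcoeff (psum_mps i) (fst x) * mcoeff G (snd x) = 0"
        by (simp add: psum_mps_def)
    qed
  qed
  also have "inj_on ?h ?J"
    using i by (auto simp: inj_on_def poly_mapping_eq_iff fun_eq_iff lookup_single when_def split: if_splits)
  then have "(\<Sum>x\<in>?h ` ?J. mcoeff (psum_mps i) (fst x) * mcoeff G (snd x)) =
      (\<Sum>j\<in>?J. mcoeff G (m - Poly_Mapping.single j i))"
    by (subst sum.reindex) (auto simp: psum_mps_def intro!: sum.cong)
  finally show ?thesis .
qed

text \<open>A double count: at a monomial \<open>m\<close> of degree \<open>n\<close> the right side
  counts the pairs of a variable \<open>j\<close> and an \<open>i\<close> between 1 and its exponent
  in \<open>m\<close>, and there are \<open>mdeg m\<close> of them.\<close>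

lemma newton_mps:
  "of_nat n * (hcomp_mps n :: int mps) = (\<Sum>i=1..n. psum_mps i * hcomp_mps (n - i))"
proof (rule mps_eqI)
  fix m :: monom
  let ?K = "Poly_Mapping.keys m"
  have "mcoeff (psum_mps i * hcomp_mps (n - i) :: int mps) m =
      (if mdeg m = n then \<Sum>j\<in>?K. if i \<le> Poly_Mapping.lookup m j then 1 else 0 else 0)"
    if i: "i \<in> {1..n}" for i
  proof -
    have "mdeg (m - Poly_Mapping.single j i) = n - i \<longleftrightarrow> mdeg m = n"
      if "i \<le> Poly_Mapping.lookup m j" for j
      using mdeg_minus_single[OF that] i by auto
    then have "mcoeff (psum_mps i * hcomp_mps (n - i) :: int mps) m =
      (\<Sum>j | j \<in> ?K \<and> i \<le> Poly_Mapping.lookup m j. if mdeg m = n then 1 else 0)"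
      using i by (subst mcoeff_psum_mult) (auto intro!: sum.cong simp: hcomp_mps_def)
    then show ?thesis
      by (simp add: sum.inter_filter flip: sum.inter_filter)
  qed
  then have c: "mcoeff (\<Sum>i=1..n. psum_mps i * hcomp_mps (n - i) :: int mps) m =
      (if mdeg m = n then \<Sum>i=1..n. \<Sum>j\<in>?K. if i \<le> Poly_Mapping.lookup m j then 1 else 0 else 0)"
    by (simp add: mcoeff_sum)
  have "(\<Sum>i=1..n. \<Sum>j\<in>?K. if i \<le> Poly_Mapping.lookup m j then 1 else 0) = int n" if "mdeg m = n"
  proof -
    have "(\<Sum>i=1..n. if i \<le> Poly_Mapping.lookup m j then 1 else 0) = int (Poly_Mapping.lookup m j)" for j
    proof -
      have "{i \<in> {1..n}. i \<le> Poly_Mapping.lookup m j} = {1..Poly_Mapping.lookup m j}"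
        using lookup_le_mdeg[of m j] that by auto
      then show ?thesis
        by (simp flip: sum.inter_filter)
    qed
    then show ?thesis
      using that by (subst sum.swap) (simp add: mdeg_def flip: of_nat_sum)
  qed
  with c show "mcoeff (of_nat n * hcomp_mps n :: int mps) m =
      mcoeff (\<Sum>i=1..n. psum_mps i * hcomp_mps (n - i)) m"
    unfolding mcoeff_of_nat_mult c by (simp add: hcomp_mps_def)
qed

lemma newton:
  "of_nat n * (hcomp n :: int symfun) = (\<Sum>i=1..n. psum i * hcomp (n - i))"
proof -
  interpret unital_hom "mps_of_symfun :: int symfun \<Rightarrow> int mps"
    by (rule unital_hom_mps_of_symfun)
  show ?thesis
    unfolding mps_of_symfun_inject[symmetric]
    by (simp add: hom_mult hom_sum unital_hom_of_nat[OF unital_hom_mps_of_symfun]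
        hcomp.rep_eq psum.rep_eq newton_mps)
qed

subsection \<open>Products of power sums\<close>

text \<open>When \<open>e\<close> records a partition by its part multiplicities,
  \<open>wdeg e\<close> is the size of the partition and \<open>mdeg e\<close> its number of
  parts.\<close>

definition wdeg :: "monom \<Rightarrow> nat" where
  "wdeg e = (\<Sum>i\<in>Poly_Mapping.keys e. i * Poly_Mapping.lookup e i)"

lemma wdeg_superset:
  "finite A \<Longrightarrow> Poly_Mapping.keys e \<subseteq> A \<Longrightarrow> wdeg e = (\<Sum>i\<in>A. i * Poly_Mapping.lookup e i)"
  unfolding wdeg_def by (intro sum.mono_neutral_left) (auto simp: in_keys_iff)

lemma wdeg_add: "wdeg (a + b) = wdeg a + wdeg b"
  using Poly_Mapping.keys_add[of a b]
    wdeg_superset[of "Poly_Mapping.keys a \<union> Poly_Mapping.keys b" a]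
    wdeg_superset[of "Poly_Mapping.keys a \<union> Poly_Mapping.keys b" b]
    wdeg_superset[of "Poly_Mapping.keys a \<union> Poly_Mapping.keys b" "a + b"]
  by (simp add: lookup_add distrib_left sum.distrib)

lemma wdeg_single [simp]: "wdeg (Poly_Mapping.single i k) = i * k"
  by (simp add: wdeg_def)

lemma wdeg_zero [simp]: "wdeg 0 = 0"
  by (simp add: wdeg_def)

text \<open>The factor is an arbitrary function of index and exponent, not a power, so that the same
  product covers factorials, divided powers, binomials and their moments.\<close>

definition mprod :: "(nat \<Rightarrow> nat \<Rightarrow> 'a::comm_monoid_mult) \<Rightarrow> monom \<Rightarrow> 'a" where
  "mprod x e = (\<Prod>i\<in>Poly_Mapping.keys e. x i (Poly_Mapping.lookup e i))"

lemma mprod_superset: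
  assumes "finite A" "Poly_Mapping.keys e \<subseteq> A" "\<And>i. i \<in> A \<Longrightarrow> x i 0 = 1"
  shows "mprod x e = (\<Prod>i\<in>A. x i (Poly_Mapping.lookup e i))"
  unfolding mprod_def using assms
  by (intro prod.mono_neutral_left) (auto simp: in_keys_iff)

lemma mprod_zero [simp]: "mprod x 0 = 1"
  by (simp add: mprod_def)

lemma mprod_single: "x i 0 = 1 \<Longrightarrow> mprod x (Poly_Mapping.single i k) = x i k"
  by (simp add: mprod_def)

lemma mprod_cong:
  "(\<And>i. i \<in> Poly_Mapping.keys e \<Longrightarrow> x i (Poly_Mapping.lookup e i) = y i (Poly_Mapping.lookup e i))
    \<Longrightarrow> mprod x e = mprod y e"
  unfolding mprod_def by (rule prod.cong) auto

definition pmon :: "monom \<Rightarrow> 'a::{comm_ring, comm_monoid_mult} mps" where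
  "pmon = mprod (\<lambda>i k. psum_mps i ^ k)"

text \<open>The coefficient of the monomial symmetric function of a partition in the power sum
  product of the same partition: the number of permutations among equal parts.\<close>

definition fmon :: "monom \<Rightarrow> nat" where
  "fmon = mprod (\<lambda>i k. fact k)"

lemma mprod_add_single:
  assumes "\<And>i. x i 0 = 1" "x i (Suc (Poly_Mapping.lookup e i)) = y * x i (Poly_Mapping.lookup e i)"
  shows "mprod x (e + Poly_Mapping.single i 1) = y * mprod x e"
proof -
  let ?A = "insert i (Poly_Mapping.keys e)"
  have "mprod x (e + Poly_Mapping.single i 1) =
      (\<Prod>j\<in>?A. x j (Poly_Mapping.lookup (e + Poly_Mapping.single i 1) j))"
    by (rule mprod_superset)
      (use Poly_Mapping.keys_add[of e "Poly_Mapping.single i 1"] assms in auto)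
  also have "\<dots> = (y * x i (Poly_Mapping.lookup e i)) *
      (\<Prod>j\<in>?A - {i}. x j (Poly_Mapping.lookup e j))"
    by (subst prod.remove[of _ i])
      (auto simp: lookup_add lookup_single when_def assms(2) intro!: arg_cong2[of _ _ _ _ "(*)"] prod.cong)
  also have "\<dots> = y * (\<Prod>j\<in>?A. x j (Poly_Mapping.lookup e j))"
    by (subst (2) prod.remove[of _ i]) (auto simp: mult.assoc)
  also have "(\<Prod>j\<in>?A. x j (Poly_Mapping.lookup e j)) = mprod x e"
    by (rule mprod_superset[symmetric]) (use assms in auto)
  finally show ?thesis .
qed

lemma pmon_add_single: "pmon (e + Poly_Mapping.single i 1) = psum_mps i * pmon e"
  unfolding pmon_def by (rule mprod_add_single) auto

lemma fmon_add_single: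
  "fmon (e + Poly_Mapping.single i 1) = Suc (Poly_Mapping.lookup e i) * fmon e"
  unfolding fmon_def by (rule mprod_add_single) auto

lemma fmon_pos: "fmon e > 0"
  by (auto simp: fmon_def mprod_def intro!: prod_pos)

lemma monom_induct [case_names zero add]:
  assumes "P 0"
    and "\<And>i e. P e \<Longrightarrow> P (e + Poly_Mapping.single i 1)"
  shows "P (e :: monom)"
proof (induction "mdeg e" arbitrary: e)
  case 0
  then have "Poly_Mapping.lookup e j = 0" for j
    using lookup_le_mdeg[of e j] by simp
  then have "e = 0"
    by (intro poly_mapping_eqI) simp
  with assms show ?case by simp
next
  case (Suc n)
  then have "e \<noteq> 0" by auto
  then obtain i where "Poly_Mapping.lookup e i \<noteq> 0"
    by (metis lookup_zero poly_mapping_eqI)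
  then have i: "1 \<le> Poly_Mapping.lookup e i" by simp
  from mdeg_minus_single[OF i] Suc(2) have "P (e - Poly_Mapping.single i 1)"
    by (intro Suc(1)) simp
  from assms(2)[OF this, of i] show ?case
    by (simp only: mono_minus_single_add[OF i])
qed

text \<open>\<open>mtype m\<close> is the partition of which \<open>m\<close> is a rearrangement, recorded by its part multiplicities.\<close>

lift_definition mtype :: "monom \<Rightarrow> monom" is
  "\<lambda>m i. if i = 0 then 0 else card {j. m j = i}"
proof -
  fix m :: "nat \<Rightarrow> nat"
  assume m: "finite {j. m j \<noteq> 0}"
  have "{i. (if i = 0 then 0 else card {j. m j = i}) \<noteq> 0} \<subseteq> m ` {j. m j \<noteq> 0}"
  proof
    fix i assume "i \<in> {i. (if i = 0 then 0 else card {j. m j = i}) \<noteq> 0}"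
    then have "i \<noteq> 0" "card {j. m j = i} \<noteq> 0"
      by (auto split: if_splits)
    then have "i \<noteq> 0" "{j. m j = i} \<noteq> {}"
      by (metis card.empty)+
    then show "i \<in> m ` {j. m j \<noteq> 0}"
      by auto
  qed
  with m show "finite {i. (if i = 0 then 0 else card {j. m j = i}) \<noteq> 0}"
    by (meson finite_imageI finite_subset)
qed

lemma lookup_mtype:
  "Poly_Mapping.lookup (mtype m) i = (if i = 0 then 0 else card {j. Poly_Mapping.lookup m j = i})"
  by (simp add: mtype.rep_eq)

lemma mtype_add_single:
  assumes "Poly_Mapping.lookup m j = 0" "i \<ge> 1"
  shows "mtype (m + Poly_Mapping.single j i) = mtype m + Poly_Mapping.single i 1"
proof (rule poly_mapping_eqI)
  fix k
  have fin: "finite {l. Poly_Mapping.lookup m l = k}" if "k \<noteq> 0"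
    by (rule finite_subset[OF _ finite_keys[of m]]) (use that in \<open>auto simp: in_keys_iff\<close>)
  have lk: "Poly_Mapping.lookup (m + Poly_Mapping.single j i) l =
      (if l = j then i else Poly_Mapping.lookup m l)" for l
    using assms by (auto simp: lookup_add lookup_single when_def)
  consider "k = 0" | "k \<noteq> 0" "k = i" | "k \<noteq> 0" "k \<noteq> i"
    by blast
  then show "Poly_Mapping.lookup (mtype (m + Poly_Mapping.single j i)) k =
      Poly_Mapping.lookup (mtype m + Poly_Mapping.single i 1) k"
  proof cases
    case 1
    then show ?thesis
      using assms by (simp add: lookup_mtype lookup_add lookup_single when_def)
  next
    case 2
    have "{l. (if l = j then i else Poly_Mapping.lookup m l) = k} =
        insert j {l. Poly_Mapping.lookup m l = k}"
      using 2 by auto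
    then show ?thesis
      using 2 assms fin by (simp add: lookup_mtype lookup_add[of "mtype m"] lk lookup_single)
  next
    case 3
    have "{l. (if l = j then i else Poly_Mapping.lookup m l) = k} = {l. Poly_Mapping.lookup m l = k}"
      using 3 assms by auto
    then show ?thesis
      using 3 by (simp add: lookup_mtype lookup_add[of "mtype m"] lk lookup_single when_def)
  qed
qed

lemma mtype_zero [simp]: "mtype 0 = 0"
  by (rule poly_mapping_eqI) (simp add: lookup_mtype)

text \<open>Each part is placed in a fresh variable, which exists because a monomial involves only
  finitely many of them.\<close>

lemma ex_mtype:
  assumes "Poly_Mapping.lookup e 0 = 0"
  shows "\<exists>m. mtype m = e"
  using assms
proof (induction e rule: monom_induct)
  case zero
  show ?case by (intro exI[of _ 0]) simp
next
  case (add i e)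
  then obtain m where m: "mtype m = e" and i: "i \<ge> 1"
    by (auto simp: lookup_add lookup_single when_def split: if_splits)
  obtain j where "j \<notin> Poly_Mapping.keys m"
    using ex_new_if_finite[OF infinite_UNIV_nat finite_keys] by blast
  then have "mtype (m + Poly_Mapping.single j i) = e + Poly_Mapping.single i 1"
    using i m by (subst mtype_add_single) (auto simp: in_keys_iff)
  then show ?case by blast
qed

text \<open>The variables are matched exponent by exponent. For a nonzero exponent both fibres are
  finite of the same cardinality; for exponent 0 both are infinite subsets of \<open>nat\<close>,
  hence in bijection by enumeration.\<close>

lemma mtype_eq_imp_map_key:
  assumes "mtype m = mtype m'"
  shows "\<exists>\<pi>. bij \<pi> \<and> m' = Poly_Mapping.map_key \<pi> m"
proof -
  let ?A = "\<lambda>i. {j. Poly_Mapping.lookup m' j = i}" and ?B = "\<lambda>i. {j. Poly_Mapping.lookup m j = i}"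
  have inf: "infinite {j. Poly_Mapping.lookup n j = 0}" for n :: monom
  proof
    assume "finite {j. Poly_Mapping.lookup n j = 0}"
    then have "finite ({j. Poly_Mapping.lookup n j = 0} \<union> Poly_Mapping.keys n)"
      by simp
    moreover have "{j. Poly_Mapping.lookup n j = 0} \<union> Poly_Mapping.keys n = UNIV"
      by (auto simp: in_keys_iff)
    ultimately show False by simp
  qed
  have fin: "finite {j. Poly_Mapping.lookup n j = i}" if "i \<noteq> 0" for n :: monom and i
    by (rule finite_subset[OF _ finite_keys[of n]]) (use that in \<open>auto simp: in_keys_iff\<close>)
  have "\<exists>g. bij_betw g (?A i) (?B i)" for i
  proof (cases "i = 0")
    case True
    have "bij_betw (enumerate (?A 0)) UNIV (?A 0)" "bij_betw (enumerate (?B 0)) UNIV (?B 0)"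
      by (intro bij_enumerate inf)+
    then show ?thesis
      unfolding True by (meson bij_betw_inv_into bij_betw_trans)
  next
    case False
    have "card (?A i) = card (?B i)"
      using arg_cong[OF assms, of "\<lambda>e. Poly_Mapping.lookup e i"] False by (simp add: lookup_mtype)
    then show ?thesis
      using False by (intro finite_same_card_bij fin)
  qed
  then obtain g where g: "\<And>i. bij_betw (g i) (?A i) (?B i)"
    by metis
  define \<pi> where "\<pi> j = g (Poly_Mapping.lookup m' j) j" for j
  have \<pi>: "Poly_Mapping.lookup m (\<pi> j) = Poly_Mapping.lookup m' j" for j
    using bij_betwE[OF g[of "Poly_Mapping.lookup m' j"]] by (auto simp: \<pi>_def)
  have "bij \<pi>"
  proof (rule bijI)
    show "inj \<pi>"
    proof (rule injI)
      fix x y assume xy: "\<pi> x = \<pi> y"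
      then have "Poly_Mapping.lookup m' x = Poly_Mapping.lookup m' y"
        by (metis \<pi>)
      then show "x = y"
        using xy bij_betw_imp_inj_on[OF g[of "Poly_Mapping.lookup m' y"]]
        by (auto simp: \<pi>_def inj_on_def)
    qed
    show "surj \<pi>"
      unfolding surj_def
    proof
      fix y
      let ?i = "Poly_Mapping.lookup m y"
      have "y \<in> g ?i ` ?A ?i"
        using bij_betw_imp_surj_on[OF g[of ?i]] by auto
      then obtain x where x: "Poly_Mapping.lookup m' x = ?i" "y = g ?i x"
        by auto
      have "y = \<pi> x"
        unfolding \<pi>_def x(1) by (rule x(2))
      then show "\<exists>x. y = \<pi> x" ..
    qed
  qed
  moreover from this have "m' = Poly_Mapping.map_key \<pi> m"
    by (intro poly_mapping_eqI) (simp add: lookup_map_key bij_is_inj \<pi>)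
  ultimately show ?thesis by blast
qed

lemma sym_series_mtype:
  assumes "F \<in> sym_series" "mtype m = mtype m'"
  shows "mcoeff F m = mcoeff F m'"
  using mtype_eq_imp_map_key[OF assms(2)] assms(1) by (auto simp: sym_series_def)

lemma keys_minus_single:
  assumes "i \<ge> 1" "i \<le> Poly_Mapping.lookup m j"
  shows "Poly_Mapping.keys (m - Poly_Mapping.single j i :: monom) =
    (if Poly_Mapping.lookup m j = i then Poly_Mapping.keys m - {j} else Poly_Mapping.keys m)"
  using assms by (auto simp: in_keys_iff lookup_minus lookup_single when_def split: if_splits)

text \<open>
  Triangularity: a product of \<open>k\<close> power sums only involves monomials in at most \<open>k\<close> variables, and
  those in exactly \<open>k\<close> variables are the rearrangements of the indexing partition.
\<close>

lemma mcoeff_pmon: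
  assumes "Poly_Mapping.lookup e 0 = 0"
  shows mcoeff_pmon_wdeg: "mcoeff (pmon e :: int mps) m \<noteq> 0 \<longrightarrow> mdeg m = wdeg e"
    and mcoeff_pmon_card: "mdeg e < card (Poly_Mapping.keys m) \<longrightarrow> mcoeff (pmon e :: int mps) m = 0"
    and mcoeff_pmon_top: "card (Poly_Mapping.keys m) = mdeg e \<longrightarrow>
      mcoeff (pmon e :: int mps) m = (if mtype m = e then int (fmon e) else 0)"
proof -
  \<comment> \<open>The three claims share one induction, because the case of exactly
    \<open>mdeg e\<close> variables relies on the vanishing for more variables.\<close>
  have "(mcoeff (pmon e :: int mps) m \<noteq> 0 \<longrightarrow> mdeg m = wdeg e) \<and>
    (mdeg e < card (Poly_Mapping.keys m) \<longrightarrow> mcoeff (pmon e :: int mps) m = 0) \<and>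
    (card (Poly_Mapping.keys m) = mdeg e \<longrightarrow>
      mcoeff (pmon e :: int mps) m = (if mtype m = e then int (fmon e) else 0))"
    using assms
  proof (induction e arbitrary: m rule: monom_induct)
    case zero
    show ?case
      by (auto simp: pmon_def mcoeff_one fmon_def)
  next
    case (add i e)
    let ?J = "{j \<in> Poly_Mapping.keys m. i \<le> Poly_Mapping.lookup m j}"
    let ?r = "\<lambda>j. m - Poly_Mapping.single j i"
    from add.prems have e0: "Poly_Mapping.lookup e 0 = 0" and i: "i \<ge> 1"
      by (auto simp: lookup_add lookup_single when_def split: if_splits)
    note IH = add.IH[OF e0]
    have c: "mcoeff (pmon (e + Poly_Mapping.single i 1) :: int mps) m =
        (\<Sum>j\<in>?J. mcoeff (pmon e :: int mps) (?r j))"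
      unfolding pmon_add_single by (rule mcoeff_psum_mult[OF i])
    have 1: "mdeg m = wdeg (e + Poly_Mapping.single i 1)"
      if nz: "mcoeff (pmon (e + Poly_Mapping.single i 1) :: int mps) m \<noteq> 0"
    proof -
      obtain j where "j \<in> ?J" "mcoeff (pmon e :: int mps) (?r j) \<noteq> 0"
        using nz unfolding c by (meson sum.not_neutral_contains_not_neutral)
      then show ?thesis
        using IH[of "?r j"] mdeg_minus_single[of i m j] by (simp add: wdeg_add)
    qed
    have cardr: "card (Poly_Mapping.keys (?r j)) =
        (if Poly_Mapping.lookup m j = i then card (Poly_Mapping.keys m) - 1 else card (Poly_Mapping.keys m))"
      if "j \<in> ?J" for j
      using that i by (subst keys_minus_single) auto
    have 2: "mcoeff (pmon (e + Poly_Mapping.single i 1) :: int mps) m = 0"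
      if "mdeg (e + Poly_Mapping.single i 1) < card (Poly_Mapping.keys m)"
      unfolding c
    proof (rule sum.neutral, rule ballI)
      fix j assume "j \<in> ?J"
      with that cardr have "mdeg e < card (Poly_Mapping.keys (?r j))"
        by (auto simp: mdeg_add)
      then show "mcoeff (pmon e :: int mps) (?r j) = 0"
        using IH[of "?r j"] by blast
    qed
    have 3: "mcoeff (pmon (e + Poly_Mapping.single i 1) :: int mps) m =
        (if mtype m = e + Poly_Mapping.single i 1 then int (fmon (e + Poly_Mapping.single i 1)) else 0)"
      if card: "card (Poly_Mapping.keys m) = mdeg (e + Poly_Mapping.single i 1)"
    proof -
      \<comment> \<open>If the exponent of \<open>j\<close> exceeds \<open>i\<close>, the quotient
        still involves all variables of \<open>m\<close>, too many for \<open>pmon e\<close>. Only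
        variables of exponent exactly \<open>i\<close> survive, and removing one removes a part
        \<open>i\<close> from the type.\<close>
      have "mcoeff (pmon e :: int mps) (?r j) =
          (if Poly_Mapping.lookup m j = i \<and> mtype m = e + Poly_Mapping.single i 1 then int (fmon e) else 0)"
        if j: "j \<in> ?J" for j
      proof (cases "Poly_Mapping.lookup m j = i")
        case False
        then have "mdeg e < card (Poly_Mapping.keys (?r j))"
          using cardr[OF j] card by (simp add: mdeg_add)
        then show ?thesis
          using IH[of "?r j"] False by simp
      next
        case True
        then have "card (Poly_Mapping.keys (?r j)) = mdeg e"
          using cardr[OF j] card by (simp add: mdeg_add)
        moreover have "mtype m = mtype (?r j) + Poly_Mapping.single i 1"
          using mtype_add_single[of "?r j" j i] i True j
          by (simp add: mono_minus_single_add lookup_minus)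
        then have "mtype (?r j) = e \<longleftrightarrow> mtype m = e + Poly_Mapping.single i 1"
          by auto
        ultimately show ?thesis
          using IH[of "?r j"] True by simp
      qed
      then have "mcoeff (pmon (e + Poly_Mapping.single i 1) :: int mps) m =
          (\<Sum>j\<in>?J. if Poly_Mapping.lookup m j = i \<and> mtype m = e + Poly_Mapping.single i 1
            then int (fmon e) else 0)"
        unfolding c by (rule sum.cong[OF refl])
      also have "\<dots> = (if mtype m = e + Poly_Mapping.single i 1
          then \<Sum>j\<in>{j \<in> ?J. Poly_Mapping.lookup m j = i}. int (fmon e) else 0)"
        by (subst sum.inter_filter) auto
      also have "{j \<in> ?J. Poly_Mapping.lookup m j = i} = {j. Poly_Mapping.lookup m j = i}"
        using i by (auto simp: in_keys_iff)
      finally have c': "mcoeff (pmon (e + Poly_Mapping.single i 1) :: int mps) m =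
          (if mtype m = e + Poly_Mapping.single i 1
           then \<Sum>j\<in>{j. Poly_Mapping.lookup m j = i}. int (fmon e) else 0)" .
      \<comment> \<open>The number of summands is the multiplicity of the part \<open>i\<close> in
        the type of \<open>m\<close>, one more than in \<open>e\<close>: exactly the factor by which
        \<open>fmon\<close> grows.\<close>
      have "(\<Sum>j\<in>{j. Poly_Mapping.lookup m j = i}. int (fmon e)) = int (fmon (e + Poly_Mapping.single i 1))"
        if "mtype m = e + Poly_Mapping.single i 1"
        using arg_cong[OF that, of "\<lambda>x. Poly_Mapping.lookup x i"] i
        unfolding fmon_add_single by (simp add: lookup_mtype lookup_add algebra_simps)
      then show ?thesis
        unfolding c' by simp
    qed
    show ?case
      using 1 2 3 by blast
  qed
  then show "mcoeff (pmon e :: int mps) m \<noteq> 0 \<longrightarrow> mdeg m = wdeg e"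
    "mdeg e < card (Poly_Mapping.keys m) \<longrightarrow> mcoeff (pmon e :: int mps) m = 0"
    "card (Poly_Mapping.keys m) = mdeg e \<longrightarrow>
      mcoeff (pmon e :: int mps) m = (if mtype m = e then int (fmon e) else 0)"
    by blast+
qed

lemma mdeg_mtype: "mdeg (mtype m) = card (Poly_Mapping.keys m)"
proof -
  let ?K = "Poly_Mapping.keys m" and ?l = "Poly_Mapping.lookup m"
  have "card ?K = (\<Sum>i\<in>?l ` ?K. card {j \<in> ?K. ?l j = i})"
    using sum.image_gen[of ?K "\<lambda>_. 1 :: nat" ?l] by simp
  also have "\<dots> = (\<Sum>i\<in>?l ` ?K. Poly_Mapping.lookup (mtype m) i)"
  proof (rule sum.cong[OF refl])
    fix i assume "i \<in> ?l ` ?K"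
    then have "i \<noteq> 0" "{j \<in> ?K. ?l j = i} = {j. ?l j = i}"
      by (auto simp: in_keys_iff)
    then show "card {j \<in> ?K. ?l j = i} = Poly_Mapping.lookup (mtype m) i"
      by (simp add: lookup_mtype)
  qed
  also have "\<dots> = mdeg (mtype m)"
  proof (rule mdeg_superset[symmetric])
    show "Poly_Mapping.keys (mtype m) \<subseteq> ?l ` ?K"
    proof
      fix i assume "i \<in> Poly_Mapping.keys (mtype m)"
      then have "i \<noteq> 0" "card {j. ?l j = i} \<noteq> 0"
        by (auto simp: in_keys_iff lookup_mtype split: if_splits)
      then have "i \<noteq> 0" "{j. ?l j = i} \<noteq> {}"
        by (metis card.empty)+
      then show "i \<in> ?l ` ?K" by (auto simp: in_keys_iff)
    qed
  qed simp
  finally show ?thesis ..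
qed

lemma lookup_mtype_0 [simp]: "Poly_Mapping.lookup (mtype m) 0 = 0"
  by (simp add: lookup_mtype)

text \<open>No counting is required: \<open>m\<close> occurs in \<open>pmon (mtype m)\<close> with a
  positive coefficient, and that product is homogeneous of degree
  \<open>wdeg (mtype m)\<close>.\<close>

lemma wdeg_mtype: "wdeg (mtype m) = mdeg m"
proof -
  have "mcoeff (pmon (mtype m) :: int mps) m \<noteq> 0"
    using mcoeff_pmon_top[of "mtype m" m] fmon_pos[of "mtype m"] by (simp add: mdeg_mtype)
  then show ?thesis
    using mcoeff_pmon_wdeg[of "mtype m" m] by simp
qed

section \<open>Finite sets of exponent vectors\<close>

text \<open>The box of exponent vectors that indexes the expansion of a finite product of sums over
  \<open>{..n}\<close>; it also shows that partitions of a number are finitely many.\<close>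

definition bounded_monoms :: "nat set \<Rightarrow> nat \<Rightarrow> monom set" where
  "bounded_monoms I n = {e. Poly_Mapping.keys e \<subseteq> I \<and> (\<forall>i. Poly_Mapping.lookup e i \<le> n)}"

lemma finite_bounded_monoms:
  assumes "finite I"
  shows "finite (bounded_monoms I n)"
proof -
  have "Poly_Mapping.lookup ` bounded_monoms I n \<subseteq>
      {g. \<forall>j. (j \<in> I \<longrightarrow> g j \<in> {..n}) \<and> (j \<notin> I \<longrightarrow> g j = 0)}"
    by (auto simp: bounded_monoms_def in_keys_iff)
  moreover have "finite {g. \<forall>j. (j \<in> I \<longrightarrow> g j \<in> {..n}) \<and> (j \<notin> I \<longrightarrow> g j = (0::nat))}"
    by (intro finite_set_of_finite_funs assms) auto
  ultimately have "finite (Poly_Mapping.lookup ` bounded_monoms I n)"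
    by (rule finite_subset)
  moreover have "inj_on Poly_Mapping.lookup (bounded_monoms I n)"
    by (auto intro: inj_onI poly_mapping_eqI)
  ultimately show ?thesis
    by (simp add: finite_image_iff)
qed

text \<open>The partitions of \<open>n\<close>, recorded by their part multiplicities.\<close>

definition partitions_of :: "nat \<Rightarrow> monom set" where
  "partitions_of n = {e. Poly_Mapping.lookup e 0 = 0 \<and> wdeg e = n}"

lemma partitions_of_bounded:
  assumes "e \<in> partitions_of n"
  shows "e \<in> bounded_monoms {1..n} n"
proof -
  have le: "i * Poly_Mapping.lookup e i \<le> n" for i
  proof (cases "i \<in> Poly_Mapping.keys e")
    case True
    then have "i * Poly_Mapping.lookup e i \<le> wdeg e"
      unfolding wdeg_def by (rule member_le_sum) auto
    with assms show ?thesis by (simp add: partitions_of_def)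
  qed (simp add: in_keys_iff)
  have "1 \<le> i \<and> i \<le> n \<and> Poly_Mapping.lookup e i \<le> n"
    if "Poly_Mapping.lookup e i \<noteq> 0" for i
  proof -
    have i: "i \<noteq> 0"
      using that assms by (metis (mono_tags, lifting) partitions_of_def mem_Collect_eq)
    then have "i * 1 \<le> i * Poly_Mapping.lookup e i" "1 * Poly_Mapping.lookup e i \<le> i * Poly_Mapping.lookup e i"
      using that by (intro mult_le_mono; simp)+
    with le[of i] i show ?thesis by linarith
  qed
  then show ?thesis
    unfolding bounded_monoms_def mem_Collect_eq in_keys_iff subset_iff atLeastAtMost_iff
    by (metis le0)
qed

lemma finite_partitions_of: "finite (partitions_of n)"
  by (rule finite_subset[OF _ finite_bounded_monoms[of "{1..n}" n]])
    (auto dest: partitions_of_bounded)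

lemma mtype_in_partitions_of: "mtype m \<in> partitions_of (mdeg m)"
  by (simp add: partitions_of_def wdeg_mtype)

subsection \<open>The power sums generate rationally\<close>

text \<open>
  \<open>psum_rel F\<close> is the subring of \<open>\<Lambda> \<times> \<Lambda>\<^sub>\<Lambda>\<^sup>\<and>\<close> generated by the pairs
  \<open>(p\<^sub>i, p\<^sub>i \<circ> F)\<close>.  It is the graph of \<open>f \<mapsto> f \<circ> F\<close> up to division by integers.
\<close>

inductive_set psum_rel :: "int symfun mps \<Rightarrow> (int symfun \<times> int symfun mps) set" for F where
  one: "(1, 1) \<in> psum_rel F"
| psum: "i \<ge> 1 \<Longrightarrow> (psum i, adams i F) \<in> psum_rel F"
| diff: "(f, G) \<in> psum_rel F \<Longrightarrow> (g, H) \<in> psum_rel F \<Longrightarrow> (f - g, G - H) \<in> psum_rel F"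
| mult: "(f, G) \<in> psum_rel F \<Longrightarrow> (g, H) \<in> psum_rel F \<Longrightarrow> (f * g, G * H) \<in> psum_rel F"

lemma psum_rel_zero: "(0, 0) \<in> psum_rel F"
  using psum_rel.diff[OF psum_rel.one psum_rel.one, of F] by simp

lemma psum_rel_add:
  assumes "(f, G) \<in> psum_rel F" "(g, H) \<in> psum_rel F"
  shows "(f + g, G + H) \<in> psum_rel F"
  using psum_rel.diff[OF assms(1) psum_rel.diff[OF psum_rel_zero assms(2)]] by simp

lemma psum_rel_of_nat: "(of_nat n, of_nat n) \<in> psum_rel F"
  by (induction n) (auto intro: psum_rel_zero psum_rel_add psum_rel.one)

lemma psum_rel_of_nat_mult:
  "(f, G) \<in> psum_rel F \<Longrightarrow> (of_nat n * f, of_nat n * G) \<in> psum_rel F"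
  by (intro psum_rel.mult psum_rel_of_nat)

lemma Domain_psum_rel:
  shows Domain_psum_rel_zero: "0 \<in> Domain (psum_rel F)"
    and Domain_psum_rel_one: "1 \<in> Domain (psum_rel F)"
    and Domain_psum_rel_psum: "i \<ge> 1 \<Longrightarrow> psum i \<in> Domain (psum_rel F)"
    and Domain_psum_rel_add: "f \<in> Domain (psum_rel F) \<Longrightarrow> g \<in> Domain (psum_rel F) \<Longrightarrow> f + g \<in> Domain (psum_rel F)"
    and Domain_psum_rel_mult: "f \<in> Domain (psum_rel F) \<Longrightarrow> g \<in> Domain (psum_rel F) \<Longrightarrow> f * g \<in> Domain (psum_rel F)"
    and Domain_psum_rel_of_int: "of_int k \<in> Domain (psum_rel F)"
proof -
  have diff: "f - g \<in> Domain (psum_rel F)" if "f \<in> Domain (psum_rel F)" "g \<in> Domain (psum_rel F)" for f g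
    using that by (auto intro: psum_rel.diff)
  show zero: "0 \<in> Domain (psum_rel F)"
    using psum_rel_zero by blast
  show "of_int k \<in> Domain (psum_rel F)"
  proof (cases k)
    case (nonneg n)
    then show ?thesis using psum_rel_of_nat by auto
  next
    case (neg n)
    then show ?thesis
      using diff[OF zero, of "of_nat (Suc n)"] psum_rel_of_nat[of "Suc n" F]
      by (auto simp del: of_nat_Suc)
  qed
qed (use psum_rel.one psum_rel.psum psum_rel.mult psum_rel_add in blast)+

lemma Domain_psum_rel_sum:
  "(\<And>x. x \<in> A \<Longrightarrow> f x \<in> Domain (psum_rel F)) \<Longrightarrow> sum f A \<in> Domain (psum_rel F)"
  by (induction A rule: infinite_finite_induct)
    (auto intro!: Domain_psum_rel_zero Domain_psum_rel_add)

lemma Domain_psum_rel_power: "f \<in> Domain (psum_rel F) \<Longrightarrow> f ^ n \<in> Domain (psum_rel F)"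
  by (induction n) (auto intro!: Domain_psum_rel_one Domain_psum_rel_mult)

lemma Domain_psum_rel_prod:
  "(\<And>x. x \<in> A \<Longrightarrow> f x \<in> Domain (psum_rel F)) \<Longrightarrow> prod f A \<in> Domain (psum_rel F)"
  by (induction A rule: infinite_finite_induct)
    (auto intro!: Domain_psum_rel_one Domain_psum_rel_mult)

definition pmon_symfun :: "monom \<Rightarrow> 'a::{comm_ring, comm_monoid_mult} symfun" where
  "pmon_symfun = mprod (\<lambda>i k. psum i ^ k)"

lemma mps_of_pmon_symfun:
  "mps_of_symfun (pmon_symfun e :: 'a::{comm_ring, comm_monoid_mult} symfun) = pmon e"
proof -
  interpret unital_hom "mps_of_symfun :: 'a symfun \<Rightarrow> 'a mps"
    by (rule unital_hom_mps_of_symfun)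
  show ?thesis
    by (simp add: pmon_symfun_def pmon_def mprod_def hom_prod hom_power psum.rep_eq)
qed

lemma pmon_symfun_in_Domain:
  assumes "Poly_Mapping.lookup e 0 = 0"
  shows "pmon_symfun e \<in> Domain (psum_rel F)"
  unfolding pmon_symfun_def mprod_def
proof (intro Domain_psum_rel_prod Domain_psum_rel_power Domain_psum_rel_psum)
  fix i assume "i \<in> Poly_Mapping.keys e"
  with assms have "i \<noteq> 0" by (metis in_keys_iff)
  then show "i \<ge> 1" by simp
qed

lemma symfun_mtype: "mtype m = mtype m' \<Longrightarrow> mcoeff (mps_of_symfun f) m = mcoeff (mps_of_symfun f) m'"
  using sym_series_mtype[of "mps_of_symfun f" m m'] mps_of_symfun[of f] by simp

lemma symfun_bounded_degree: "\<exists>d. \<forall>m. d < mdeg m \<longrightarrow> mcoeff (mps_of_symfun f) m = 0"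
  using mps_of_symfun[of f] by (simp add: bounded_degree_def)

lemma finite_mtype_support: "finite (mtype ` {m. mcoeff (mps_of_symfun f) m \<noteq> 0})"
proof -
  obtain d where d: "\<And>m. d < mdeg m \<Longrightarrow> mcoeff (mps_of_symfun f) m = 0"
    using symfun_bounded_degree by blast
  have "mtype ` {m. mcoeff (mps_of_symfun f) m \<noteq> 0} \<subseteq> (\<Union>n\<in>{..d}. partitions_of n)"
    using d mtype_in_partitions_of by (fastforce simp: not_less[symmetric])
  then show ?thesis
    by (rule finite_subset) (simp add: finite_partitions_of)
qed

lemma mcoeff_symfun_of_nat_mult:
  "mcoeff (mps_of_symfun (of_nat n * f)) m = of_nat n * mcoeff (mps_of_symfun f) m"
  for f :: "'a::comm_ring_1 symfun"
  by (simp add: mps_of_symfun_simps unital_hom_of_nat[OF unital_hom_mps_of_symfun] mcoeff_of_nat_mult)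

lemma mcoeff_symfun_of_int_mult:
  "mcoeff (mps_of_symfun (of_int k * f)) m = of_int k * mcoeff (mps_of_symfun f) m"
  for f :: "'a::comm_ring_1 symfun"
proof (cases k)
  case (nonneg n)
  then show ?thesis by (simp add: mcoeff_symfun_of_nat_mult)
next
  case (neg n)
  interpret unital_hom "mps_of_symfun :: 'a symfun \<Rightarrow> 'a mps"
    by (rule unital_hom_mps_of_symfun)
  show ?thesis
    using mcoeff_symfun_of_nat_mult[of "Suc n" f m] by (simp add: neg hom_minus del: of_nat_Suc)
qed

text \<open>Induction on a strict bound \<open>k\<close> for the number of variables in the
  monomials of \<open>f\<close>. By triangularity a combination of power sum products with
  \<open>k\<close> parts cancels the part of a multiple of \<open>f\<close> in exactly
  \<open>k\<close> variables, and it adds nothing in more variables.\<close>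

lemma psum_generate:
  "\<exists>D>0. of_nat D * f \<in> Domain (psum_rel F)"
proof -
  have "\<exists>D>0. of_nat D * f \<in> Domain (psum_rel F)"
    if "\<And>m. mcoeff (mps_of_symfun f) m \<noteq> 0 \<Longrightarrow> card (Poly_Mapping.keys m) < k" for k and f :: "int symfun"
    using that
  proof (induction k arbitrary: f)
    case 0
    then have "mcoeff (mps_of_symfun f) m = 0" for m
      by blast
    then have "f = 0"
      by (simp add: mps_of_symfun_simps mps_eqI flip: mps_of_symfun_inject)
    then show ?case
      by (intro exI[of _ 1]) (simp add: Domain_psum_rel_zero)
  next
    case (Suc k)
    let ?c = "mcoeff (mps_of_symfun f)"
    define S where "S = mtype ` {m. ?c m \<noteq> 0 \<and> card (Poly_Mapping.keys m) = k}"
    have S: "finite S"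
      unfolding S_def by (rule finite_subset[OF _ finite_mtype_support[of f]]) auto
    \<comment> \<open>A symmetric function is constant on the monomials of a given type, so its
      coefficient there may be read at any representative.\<close>
    define rep where "rep e = (SOME m. mtype m = e)" for e
    have rep: "mtype (rep (mtype m)) = mtype m" for m
      unfolding rep_def by (rule someI_ex) blast
    have c_rep: "?c (rep (mtype m)) = ?c m" for m
      by (rule symfun_mtype) (rule rep)
    \<comment> \<open>A common multiple of the diagonal entries of all types in \<open>S\<close>;
      the cofactor \<open>q e\<close> brings each entry to the same value \<open>D\<close>.\<close>
    define D where "D = prod fmon S"
    have D: "D > 0"
      by (simp add: D_def fmon_pos prod_pos)
    define q where "q e = int (D div fmon e)" for e
    have q: "q e * int (fmon e) = int D" if "e \<in> S" for e
    proof -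
      have "fmon e dvd D"
        unfolding D_def using S that by (rule dvd_prodI)
      then show ?thesis
        by (simp add: q_def flip: of_nat_mult)
    qed
    define P where "P = (\<Sum>e\<in>S. of_int (q e * ?c (rep e)) * pmon_symfun e :: int symfun)"
    have S0: "Poly_Mapping.lookup e 0 = 0" "mdeg e = k" if "e \<in> S" for e
      using that by (auto simp: S_def mdeg_mtype)
    have P: "P \<in> Domain (psum_rel F)"
      unfolding P_def using S0
      by (intro Domain_psum_rel_sum Domain_psum_rel_mult Domain_psum_rel_of_int pmon_symfun_in_Domain) auto
    interpret unital_hom "mps_of_symfun :: int symfun \<Rightarrow> int mps"
      by (rule unital_hom_mps_of_symfun)
    have cP: "mcoeff (mps_of_symfun P) m =
        (\<Sum>e\<in>S. q e * ?c (rep e) * mcoeff (pmon e) m)" for m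
      by (simp add: P_def hom_sum mcoeff_sum mcoeff_symfun_of_int_mult mps_of_pmon_symfun
          del: of_int_mult)
    define f' where "f' = of_nat D * f - P"
    have "mcoeff (mps_of_symfun f') m = 0" if m: "k \<le> card (Poly_Mapping.keys m)" for m
    proof (cases "k = card (Poly_Mapping.keys m)")
      case False
      with m have "?c m = 0" "\<And>e. e \<in> S \<Longrightarrow> mcoeff (pmon e :: int mps) m = 0"
        using Suc.prems[of m] mcoeff_pmon_card[OF S0(1), of _ m] S0(2) by fastforce+
      then show ?thesis
        by (simp add: f'_def hom_diff mcoeff_symfun_of_nat_mult cP)
    next
      case True
      have "mcoeff (pmon e :: int mps) m = (if e = mtype m then int (fmon e) else 0)" if "e \<in> S" for e
        using mcoeff_pmon_top[OF S0(1)[OF that], of m] S0(2)[OF that] True by auto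
      then have "mcoeff (mps_of_symfun P) m =
          (\<Sum>e\<in>S. if e = mtype m then q e * ?c (rep e) * int (fmon e) else 0)"
        unfolding cP by (intro sum.cong) auto
      also have "\<dots> = (if mtype m \<in> S then int D * ?c m else 0)"
        using S q[of "mtype m"] by (simp add: c_rep sum.delta mult.commute mult.left_commute)
      also have "\<dots> = int D * ?c m"
        using True by (auto simp: S_def)
      finally show ?thesis
        by (simp add: f'_def hom_diff mcoeff_symfun_of_nat_mult)
    qed
    then obtain D' where D': "D' > 0" "of_nat D' * f' \<in> Domain (psum_rel F)"
      using Suc.IH[of f'] not_le by blast
    have "of_nat (D' * D) * f = of_nat D' * f' + of_nat D' * P"
      by (simp add: f'_def algebra_simps)
    also have "\<dots> \<in> Domain (psum_rel F)"
      using Domain_psum_rel_of_int[of "int D'" F] P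
      by (intro Domain_psum_rel_add D' Domain_psum_rel_mult) simp_all
    finally show ?case
      using D D' by (intro exI[of _ "D' * D"]) simp
  qed
  moreover obtain d where d: "\<And>m. d < mdeg m \<Longrightarrow> mcoeff (mps_of_symfun f) m = 0"
    using symfun_bounded_degree by blast
  \<comment> \<open>Every variable that occurs contributes at least 1 to the degree, so the degree
    bound \<open>d\<close> also bounds the number of variables and starts the induction.\<close>
  have "card (Poly_Mapping.keys m) < Suc d" if "mcoeff (mps_of_symfun f) m \<noteq> 0" for m
  proof -
    have "card (Poly_Mapping.keys m) = (\<Sum>j\<in>Poly_Mapping.keys m. 1)"
      by simp
    also have "\<dots> \<le> mdeg m"
      unfolding mdeg_def by (intro sum_mono) (simp add: in_keys_iff)
    finally show ?thesis
      using d[of m] that by force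
  qed
  ultimately show ?thesis by blast
qed

subsection \<open>Evaluation of symmetric functions at finitely many elements\<close>

definition symfun_support :: "nat \<Rightarrow> int symfun \<Rightarrow> monom set" where
  "symfun_support N f = {m. Poly_Mapping.keys m \<subseteq> {..<N} \<and> mcoeff (mps_of_symfun f) m \<noteq> 0}"

text \<open>The value at \<open>x 0, ..., x (N - 1)\<close> with all further variables set to 0; the
  bounded degree of \<open>f\<close> then makes the sum finite.\<close>

definition symfun_eval :: "nat \<Rightarrow> (nat \<Rightarrow> 'a::comm_ring_1) \<Rightarrow> int symfun \<Rightarrow> 'a" where
  "symfun_eval N x f = (\<Sum>m\<in>symfun_support N f.
     of_int (mcoeff (mps_of_symfun f) m) * (\<Prod>k<N. x k ^ Poly_Mapping.lookup m k))"

definition monoms_upto :: "nat \<Rightarrow> nat \<Rightarrow> monom set" where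
  "monoms_upto N d = {m. Poly_Mapping.keys m \<subseteq> {..<N} \<and> mdeg m \<le> d}"

lemma finite_monoms_upto: "finite (monoms_upto N d)"
  by (rule finite_subset[OF _ finite_bounded_monoms[of "{..<N}" d]])
    (auto simp: monoms_upto_def bounded_monoms_def intro: order_trans[OF lookup_le_mdeg])

lemma symfun_eval_superset:
  assumes "finite T" "symfun_support N f \<subseteq> T" "T \<subseteq> {m. Poly_Mapping.keys m \<subseteq> {..<N}}"
  shows "symfun_eval N x f = (\<Sum>m\<in>T.
     of_int (mcoeff (mps_of_symfun f) m) * (\<Prod>k<N. x k ^ Poly_Mapping.lookup m k))"
  unfolding symfun_eval_def
  by (rule sum.mono_neutral_left) (use assms in \<open>auto simp: symfun_support_def\<close>)

lemma symfun_eval_degree: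
  assumes "\<And>m. d < mdeg m \<Longrightarrow> mcoeff (mps_of_symfun f) m = 0"
  shows "symfun_eval N x f = (\<Sum>m\<in>monoms_upto N d.
     of_int (mcoeff (mps_of_symfun f) m) * (\<Prod>k<N. x k ^ Poly_Mapping.lookup m k))"
proof (rule symfun_eval_superset[OF finite_monoms_upto])
  show "symfun_support N f \<subseteq> monoms_upto N d"
    using assms by (auto simp: symfun_support_def monoms_upto_def not_less[symmetric])
qed (auto simp: monoms_upto_def)

text \<open>Exponents are natural numbers and cannot cancel: \<open>a + b\<close> avoids the
  variables from \<open>N\<close> on exactly if \<open>a\<close> and \<open>b\<close> do. So
  discarding those variables is compatible with products.\<close>

lemma unital_hom_symfun_eval:
  fixes x :: "nat \<Rightarrow> 'a::comm_ring_1"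
  shows "unital_hom (symfun_eval N x)"
proof
  interpret S: unital_hom "mps_of_symfun :: int symfun \<Rightarrow> int mps"
    by (rule unital_hom_mps_of_symfun)
  let ?X = "\<lambda>m. \<Prod>k<N. x k ^ Poly_Mapping.lookup m k"
  let ?c = "\<lambda>f. mcoeff (mps_of_symfun f)"
  have "symfun_support N 1 = {0}"
    by (auto simp: symfun_support_def mps_of_symfun_simps mcoeff_one)
  then show "symfun_eval N x 1 = 1"
    by (simp add: symfun_eval_def mps_of_symfun_simps mcoeff_one)
  fix f g :: "int symfun"
  obtain d where d: "\<And>m. d < mdeg m \<Longrightarrow> ?c f m = 0"
    using symfun_bounded_degree by blast
  obtain d' where d': "\<And>m. d' < mdeg m \<Longrightarrow> ?c g m = 0"
    using symfun_bounded_degree by blast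
  show "symfun_eval N x (f + g) = symfun_eval N x f + symfun_eval N x g"
    using d d'
    by (simp add: symfun_eval_degree[of "max d d'"] S.hom_add distrib_right sum.distrib)
  have dd: "?c (f * g) m = 0" if m: "d + d' < mdeg m" for m
    unfolding S.hom_mult mcoeff_mult
  proof (rule sum.neutral, clarify)
    fix a b assume "(a, b) \<in> decomp m"
    then have "mdeg a + mdeg b = mdeg m"
      by (auto simp: decomp_def mdeg_add)
    with m have "d < mdeg a \<or> d' < mdeg b"
      by linarith
    then show "?c f a * ?c g b = 0"
      using d d' by auto
  qed
  have X: "?X (a + b) = ?X a * ?X b" for a b
    by (simp add: lookup_add power_add prod.distrib)
  let ?S = "SIGMA m:monoms_upto N (d + d'). decomp m"
  let ?T = "monoms_upto N d \<times> monoms_upto N d'"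
  have "symfun_eval N x (f * g) =
      (\<Sum>(m, ab)\<in>?S. of_int (?c f (fst ab) * ?c g (snd ab)) * ?X m)"
    unfolding symfun_eval_degree[of "d + d'", OF dd, simplified]
    by (subst sum.Sigma[symmetric])
      (simp_all add: S.hom_mult mcoeff_mult sum_distrib_right case_prod_beta finite_monoms_upto
        finite_decomp)
  \<comment> \<open>Factorisations with a factor beyond its degree bound form the exceptional set
    and contribute zero; the others correspond to the pairs in \<open>?T\<close>.\<close>
  also have "\<dots> = (\<Sum>(a, b)\<in>?T. (of_int (?c f a) * ?X a) * (of_int (?c g b) * ?X b))"
  proof (rule sum.reindex_bij_witness_not_neutral[where T' = "{}" and
        S' = "{(m, ab) \<in> ?S. d < mdeg (fst ab) \<or> d' < mdeg (snd ab)}" and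
        i = "\<lambda>(a, b). (a + b, (a, b))" and j = snd])
    show "finite {(m, ab) \<in> ?S. d < mdeg (fst ab) \<or> d' < mdeg (snd ab)}"
      by (rule finite_subset[of _ ?S]) (auto intro!: finite_SigmaI finite_monoms_upto finite_decomp)
  next
    fix z assume z: "z \<in> ?S - {(m, ab) \<in> ?S. d < mdeg (fst ab) \<or> d' < mdeg (snd ab)}"
    then obtain a b where ab: "z = (a + b, (a, b))" "Poly_Mapping.keys (a + b) \<subseteq> {..<N}"
      by (auto simp: decomp_def monoms_upto_def)
    with z have deg: "\<not> (d < mdeg a \<or> d' < mdeg b)"
      by fastforce
    have "Poly_Mapping.keys (a + b) = Poly_Mapping.keys a \<union> Poly_Mapping.keys b"
      by (auto simp: in_keys_iff lookup_add)
    with ab deg show "snd z \<in> ?T - {}"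
      by (auto simp: monoms_upto_def not_less)
    show "(case snd z of (a, b) \<Rightarrow> (a + b, a, b)) = z"
      by (simp add: ab)
  next
    fix z assume "z \<in> ?T - {}"
    then obtain a b where ab: "z = (a, b)" "a \<in> monoms_upto N d" "b \<in> monoms_upto N d'"
      by auto
    have "Poly_Mapping.keys (a + b) = Poly_Mapping.keys a \<union> Poly_Mapping.keys b"
      by (auto simp: in_keys_iff lookup_add)
    with ab show "(case z of (a, b) \<Rightarrow> (a + b, a, b)) \<in>
        ?S - {(m, ab) \<in> ?S. d < mdeg (fst ab) \<or> d' < mdeg (snd ab)}"
      by (auto simp: monoms_upto_def decomp_def mdeg_add)
  next
    fix z assume "z \<in> {(m, ab) \<in> ?S. d < mdeg (fst ab) \<or> d' < mdeg (snd ab)}"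
    then show "(case z of (m, ab) \<Rightarrow> of_int (?c f (fst ab) * ?c g (snd ab)) * ?X m) = 0"
      using d d' by auto
  next
    fix z assume "z \<in> ?S"
    then show "(case snd z of (a, b) \<Rightarrow> (of_int (?c f a) * ?X a) * (of_int (?c g b) * ?X b)) =
        (case z of (m, ab) \<Rightarrow> of_int (?c f (fst ab) * ?c g (snd ab)) * ?X m)"
      by (auto simp: decomp_def X mult_ac)
  qed (auto)
  also have "\<dots> = symfun_eval N x f * symfun_eval N x g"
    using d d' by (simp add: symfun_eval_degree[of d f] symfun_eval_degree[of d' g]
        sum_product sum.cartesian_product)
  finally show "symfun_eval N x (f * g) = symfun_eval N x f * symfun_eval N x g" .
qed

lemma symfun_eval_psum:
  assumes i: "i \<ge> 1"
  shows "symfun_eval N x (psum i) = (\<Sum>k<N. x k ^ i)"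
proof -
  let ?s = "\<lambda>k. Poly_Mapping.single k i"
  have "symfun_eval N x (psum i) = (\<Sum>m\<in>?s ` {..<N}.
     of_int (mcoeff (mps_of_symfun (psum i)) m) * (\<Prod>k<N. x k ^ Poly_Mapping.lookup m k))"
  proof (rule symfun_eval_superset)
    show "symfun_support N (psum i) \<subseteq> ?s ` {..<N}"
      using i by (auto simp: symfun_support_def psum.rep_eq psum_mps_def split: if_splits)
  qed (auto simp: split: if_splits)
  also have "inj_on ?s {..<N}"
    using i by (auto simp: inj_on_def poly_mapping_eq_iff fun_eq_iff lookup_single when_def split: if_splits)
  then have "(\<Sum>m\<in>?s ` {..<N}.
     of_int (mcoeff (mps_of_symfun (psum i)) m) * (\<Prod>k<N. x k ^ Poly_Mapping.lookup m k)) =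
     (\<Sum>k<N. \<Prod>l<N. x l ^ Poly_Mapping.lookup (?s k) l)"
    by (subst sum.reindex) (auto simp: psum.rep_eq psum_mps_def intro!: sum.cong)
  also have "\<dots> = (\<Sum>k<N. x k ^ i)"
  proof (rule sum.cong[OF refl])
    fix k assume "k \<in> {..<N}"
    moreover have "(\<Prod>l<N. x l ^ Poly_Mapping.lookup (?s k) l) = (\<Prod>l<N. if l = k then x k ^ i else 1)"
      by (rule prod.cong) (auto simp: lookup_single when_def)
    ultimately show "(\<Prod>l<N. x l ^ Poly_Mapping.lookup (?s k) l) = x k ^ i"
      by (simp add: prod.delta)
  qed
  finally show ?thesis .
qed

subsection \<open>Integrality of plethysm\<close>

definition mps_single :: "monom \<Rightarrow> 'a::zero \<Rightarrow> 'a mps" where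
  "mps_single b c = Abs_mps (\<lambda>m. if m = b then c else 0)"

lemma mcoeff_mps_single: "mcoeff (mps_single b c) m = (if m = b then c else 0)"
  by (simp add: mps_single_def)

lemma mps_single_mult:
  fixes c d :: "'a::comm_ring"
  shows "mps_single a c * mps_single b d = mps_single (a + b) (c * d)"
proof (rule mps_eqI)
  fix m
  have "mcoeff (mps_single a c * mps_single b d) m =
      (\<Sum>x\<in>decomp m \<inter> {(a, b)}. mcoeff (mps_single a c) (fst x) * mcoeff (mps_single b d) (snd x))"
    unfolding mcoeff_mult case_prod_beta
    by (intro sum.mono_neutral_right) (auto simp: finite_decomp mcoeff_mps_single)
  also have "\<dots> = mcoeff (mps_single (a + b) (c * d)) m"
    by (cases "(a, b) \<in> decomp m") (auto simp: decomp_def mcoeff_mps_single)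
  finally show "mcoeff (mps_single a c * mps_single b d) m = mcoeff (mps_single (a + b) (c * d)) m" .
qed

lemma mps_single_0_one: "mps_single 0 1 = (1 :: 'a::{zero, one} mps)"
  by (rule mps_eqI) (simp add: mcoeff_mps_single mcoeff_one)

lemma mps_single_power:
  fixes c :: "'a::{comm_ring, comm_monoid_mult}"
  shows "mps_single b c ^ i = mps_single (mscale i b) (c ^ i)"
proof (induction i)
  case 0
  have "mscale 0 b = 0" by (rule poly_mapping_eqI) simp
  then show ?case by (simp add: mps_single_0_one)
next
  case (Suc i)
  have "mscale (Suc i) b = b + mscale i b"
    by (rule poly_mapping_eqI) (simp add: lookup_add)
  with Suc show ?case by (simp add: mps_single_mult)
qed

lemma mps_vars_pow_single:
  assumes "i \<ge> 1"
  shows "mps_vars_pow i (mps_single b c) = mps_single (mscale i b) c"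
  by (rule mps_vars_pow_eqI) (use assms in \<open>auto simp: mcoeff_mps_single\<close>)

text \<open>
  Integrality is checked in the larger ring of power series in \<open>s\<close> and \<open>t\<close> that are not
  necessarily symmetric, where every series with nonnegative coefficients is a sum of monomials.
\<close>

definition adams2 :: "nat \<Rightarrow> int mps mps \<Rightarrow> int mps mps" where
  "adams2 i G = mps_vars_pow i (mps_map (mps_vars_pow i) G)"

abbreviation forget :: "int symfun mps \<Rightarrow> int mps mps" where
  "forget \<equiv> mps_map mps_of_symfun"

lemma unital_hom_adams2: "i \<ge> 1 \<Longrightarrow> unital_hom (adams2 i)"
  unfolding adams2_def
  by (intro unital_hom_compose[OF unital_hom_mps_map unital_hom_vars_pow] unital_hom_vars_pow)

lemma unital_hom_forget: "unital_hom forget"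
  by (intro unital_hom_mps_map unital_hom_mps_of_symfun)

lemma forget_adams: "forget (adams i F) = adams2 i (forget F)"
  by (simp add: adams_def adams2_def mps_map_vars_pow mps_of_symfun_simps mps_map_map
      symfun_vars_pow.rep_eq)

text \<open>In the language of lambda-rings, monomials are line elements: Adams operations act on
  them as powers. The condition says that the Adams operations of \<open>G\<close> are the power
  sums of the finite list \<open>xs\<close>, as they are when \<open>G\<close> is a sum of line
  elements.\<close>

definition line_sum :: "int mps mps \<Rightarrow> bool" where
  "line_sum G \<longleftrightarrow> (\<exists>xs. \<forall>i\<ge>1. adams2 i G = (\<Sum>x\<leftarrow>xs. x ^ i))"

lemma line_sum_zero: "line_sum 0"
  unfolding line_sum_def
  by (intro exI[of _ "[]"]) (simp add: unital_hom.hom_zero[OF unital_hom_adams2])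

lemma line_sum_add:
  assumes "line_sum G" "line_sum H"
  shows "line_sum (G + H)"
proof -
  from assms obtain xs ys where "\<forall>i\<ge>1. adams2 i G = (\<Sum>x\<leftarrow>xs. x ^ i)"
    "\<forall>i\<ge>1. adams2 i H = (\<Sum>x\<leftarrow>ys. x ^ i)"
    unfolding line_sum_def by blast
  then show ?thesis
    unfolding line_sum_def
    by (intro exI[of _ "xs @ ys"]) (simp add: unital_hom.hom_add[OF unital_hom_adams2])
qed

lemma line_sum_sum: "(\<And>x. x \<in> A \<Longrightarrow> line_sum (f x)) \<Longrightarrow> line_sum (sum f A)"
  by (induction A rule: infinite_finite_induct) (auto intro!: line_sum_zero line_sum_add)

lemma line_sum_of_nat_mult: "line_sum G \<Longrightarrow> line_sum (of_nat n * G)"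
  by (induction n) (auto simp: distrib_right intro: line_sum_zero line_sum_add)

lemma line_sum_monomial: "line_sum (mps_single b (mps_single a 1))"
proof -
  have "adams2 i (mps_single b (mps_single a 1)) = mps_single b (mps_single a 1) ^ i" if i: "i \<ge> 1" for i
  proof -
    have "mps_map (mps_vars_pow i) (mps_single b (mps_single a (1 :: int))) =
        mps_single b (mps_single (mscale i a) 1)"
      using unital_hom.hom_zero[OF unital_hom_vars_pow[OF i, where 'a = int]]
      by (intro mps_eqI) (simp add: mcoeff_mps_single mps_vars_pow_single[OF i])
    then show ?thesis
      using i by (simp add: adams2_def mps_vars_pow_single mps_single_power)
  qed
  then show ?thesis
    unfolding line_sum_def by (intro exI[of _ "[mps_single b (mps_single a 1)]"]) simp
qed

section \<open>Congruences at the divisors of a pair of monomials\<close>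

definition mono_dvd :: "monom \<Rightarrow> monom \<Rightarrow> bool" where
  "mono_dvd a b \<longleftrightarrow> (\<exists>c. b = a + c)"

lemma mono_dvd_refl [simp]: "mono_dvd a a"
  unfolding mono_dvd_def by (intro exI[of _ 0]) simp

lemma mono_dvd_trans: "mono_dvd a b \<Longrightarrow> mono_dvd b c \<Longrightarrow> mono_dvd a c"
  by (auto simp: mono_dvd_def add.assoc)

lemma mono_dvd_mscale: "i \<ge> 1 \<Longrightarrow> mono_dvd a (mscale i a)"
  unfolding mono_dvd_def
  by (intro exI[of _ "mscale (i - 1) a"] poly_mapping_eqI) (auto simp: lookup_add algebra_simps)

lemma finite_mono_dvd: "finite {a. mono_dvd a b}"
proof -
  have "{a. mono_dvd a b} \<subseteq> fst ` decomp b"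
    by (force simp: mono_dvd_def decomp_def)
  then show ?thesis
    by (rule finite_subset) (simp add: finite_decomp)
qed

text \<open>Here \<open>a\<close> is a monomial in \<open>s\<close> and \<open>b\<close> one in
  \<open>t\<close>. A coefficient of a product at divisors of these involves only coefficients of
  the factors at divisors, so the condition behaves like membership in an ideal.\<close>

definition box_dvd :: "nat \<Rightarrow> monom \<Rightarrow> monom \<Rightarrow> int mps mps \<Rightarrow> bool" where
  "box_dvd D a b G \<longleftrightarrow>
    (\<forall>a' b'. mono_dvd a' a \<longrightarrow> mono_dvd b' b \<longrightarrow> int D dvd mcoeff (mcoeff G b') a')"

lemma box_dvd_zero: "box_dvd D a b 0"
  by (simp add: box_dvd_def)

lemma box_dvd_add: "box_dvd D a b G \<Longrightarrow> box_dvd D a b H \<Longrightarrow> box_dvd D a b (G + H)"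
  by (simp add: box_dvd_def)

lemma box_dvd_diff: "box_dvd D a b G \<Longrightarrow> box_dvd D a b H \<Longrightarrow> box_dvd D a b (G - H)"
  by (simp add: box_dvd_def)

lemma box_dvd_mult:
  assumes "box_dvd D a b G"
  shows "box_dvd D a b (G * H)"
  unfolding box_dvd_def
proof (intro allI impI)
  fix a' b' assume a': "mono_dvd a' a" and b': "mono_dvd b' b"
  have "int D dvd mcoeff (mcoeff G b1) a1" if "(a1, a2) \<in> decomp a'" "(b1, b2) \<in> decomp b'" for a1 a2 b1 b2
  proof -
    have "mono_dvd a1 a'" "mono_dvd b1 b'"
      using that by (auto simp: decomp_def mono_dvd_def)
    with a' b' assms show ?thesis
      unfolding box_dvd_def by (meson mono_dvd_trans)
  qed
  then show "int D dvd mcoeff (mcoeff (G * H) b') a'"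
    unfolding mcoeff_mult mcoeff_sum case_prod_beta
    by (intro dvd_sum dvd_mult2) auto
qed

text \<open>A nonzero coefficient of \<open>adams2 i G\<close> sits at a pair of \<open>i\<close>-th
  powers and equals that of \<open>G\<close> at their roots, which divide them and so stay in the
  box.\<close>

lemma box_dvd_adams2:
  assumes G: "box_dvd D a b G" and i: "i \<ge> 1"
  shows "box_dvd D a b (adams2 i G)"
  unfolding box_dvd_def
proof (intro allI impI)
  fix a' b' assume a': "mono_dvd a' a" and b': "mono_dvd b' b"
  show "int D dvd mcoeff (mcoeff (adams2 i G) b') a'"
  proof (cases "a' \<in> range (mscale i) \<and> b' \<in> range (mscale i)")
    case True
    then obtain a'' b'' where eq: "a' = mscale i a''" "b' = mscale i b''"
      by blast
    then have "mono_dvd a'' a" "mono_dvd b'' b"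
      using a' b' mono_dvd_mscale[OF i] mono_dvd_trans by blast+
    with G have "int D dvd mcoeff (mcoeff G b'') a''"
      by (simp add: box_dvd_def)
    with i show ?thesis
      by (simp add: eq adams2_def)
  next
    case False
    then consider "b' \<notin> range (mscale i)" | b'' where "b' = mscale i b''" "a' \<notin> range (mscale i)"
      by blast
    then show ?thesis
      using i by cases (simp_all add: adams2_def mcoeff_vars_pow_outside)
  qed
qed

text \<open>The residues modulo \<open>D\<close> of the finitely many coefficients in the box are
  nonnegative, hence can serve as multiplicities in a finite sum of monomials.\<close>

lemma box_dvd_line_sum:
  assumes D: "D > 0"
  shows "\<exists>G'. line_sum G' \<and> box_dvd D a b (G - G')"
proof -
  define G' where "G' = (\<Sum>b'\<in>{b'. mono_dvd b' b}. \<Sum>a'\<in>{a'. mono_dvd a' a}.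
    of_nat (nat (mcoeff (mcoeff G b') a' mod int D)) * mps_single b' (mps_single a' (1 :: int)))"
  have "line_sum G'"
    unfolding G'_def by (intro line_sum_sum line_sum_of_nat_mult line_sum_monomial)
  moreover have "mcoeff (mcoeff G' b') a' = mcoeff (mcoeff G b') a' mod int D"
    if a': "mono_dvd a' a" and b': "mono_dvd b' b" for a' b'
  proof -
    have c: "mcoeff (mcoeff (mps_single b1 (mps_single a1 (1 :: int))) b') a' =
        (if a1 = a' then if b1 = b' then 1 else 0 else 0)" for a1 b1
      by (simp add: mcoeff_mps_single)
    have "mcoeff (mcoeff G' b') a' =
        (\<Sum>b1\<in>{b'. mono_dvd b' b}. \<Sum>a1\<in>{a'. mono_dvd a' a}.
          if a1 = a' then if b1 = b' then mcoeff (mcoeff G b') a' mod int D else 0 else 0)"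
      unfolding G'_def mcoeff_sum mcoeff_of_nat_mult c
      by (intro sum.cong refl) (use D in auto)
    also have "\<dots> = mcoeff (mcoeff G b') a' mod int D"
      using a' b' by (simp add: sum.delta finite_mono_dvd)
    finally show ?thesis .
  qed
  then have "box_dvd D a b (G - G')"
    by (simp add: box_dvd_def)
  ultimately show ?thesis by blast
qed

text \<open>For every related pair \<open>(g, K)\<close>, the series \<open>K\<close> is congruent
  in the box to the value of \<open>g\<close> at \<open>xs\<close>: this holds for the generators
  and survives differences and products. The value of \<open>D f\<close> is \<open>D\<close> times
  that of \<open>f\<close>, so it vanishes modulo \<open>D\<close>.\<close>

lemma psum_rel_dvd:
  assumes "(of_nat D * f, H) \<in> psum_rel F" "D > 0"
  shows "int D dvd mcoeff (mps_of_symfun (mcoeff H b)) a"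
proof -
  interpret fg: unital_hom forget
    by (rule unital_hom_forget)
  obtain G' where G': "line_sum G'" "box_dvd D a b (forget F - G')"
    using box_dvd_line_sum[OF assms(2)] by blast
  then obtain xs where xs: "\<And>i. i \<ge> 1 \<Longrightarrow> adams2 i G' = (\<Sum>x\<leftarrow>xs. x ^ i)"
    by (auto simp: line_sum_def)
  let ?e = "symfun_eval (length xs) (\<lambda>k. xs ! k)"
  interpret ev: unital_hom ?e
    by (rule unital_hom_symfun_eval)
  have "box_dvd D a b (forget K - ?e g)" if "(g, K) \<in> psum_rel F" for g K
    using that
  proof induction
    case one
    show ?case by (simp add: fg.hom_one ev.hom_one box_dvd_zero)
  next
    case (psum i)
    have "?e (psum i) = adams2 i G'"
      using psum by (simp add: symfun_eval_psum xs sum_list_sum_nth atLeast0LessThan)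
    then have "forget (adams i F) - ?e (psum i) = adams2 i (forget F - G')"
      using psum by (simp add: forget_adams unital_hom.hom_diff[OF unital_hom_adams2])
    then show ?case
      using box_dvd_adams2[OF G'(2) psum] by simp
  next
    case (diff f G g H)
    have "forget (G - H) - ?e (f - g) = (forget G - ?e f) - (forget H - ?e g)"
      by (simp add: fg.hom_diff ev.hom_diff)
    then show ?case
      using box_dvd_diff[OF diff.IH] by simp
  next
    case (mult f G g H)
    have "forget (G * H) - ?e (f * g) = (forget G - ?e f) * forget H + (forget H - ?e g) * ?e f"
      by (simp add: fg.hom_mult ev.hom_mult algebra_simps)
    then show ?case
      using mult.IH by (simp add: box_dvd_add box_dvd_mult)
  qed
  from this[OF assms(1)] have "int D dvd mcoeff (mcoeff (forget H - ?e (of_nat D * f)) b) a"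
    by (simp add: box_dvd_def)
  moreover have "?e (of_nat D * f) = of_nat D * ?e f"
    by (simp add: ev.hom_mult unital_hom_of_nat[OF unital_hom_symfun_eval])
  then have "int D dvd mcoeff (mcoeff (?e (of_nat D * f)) b) a"
    by (simp add: mcoeff_of_nat_mult unital_hom_of_nat)
  ultimately show ?thesis
    by (simp add: dvd_diff_left_iff)
qed

lemma symfun_of_nat_mult_cancel:
  assumes "of_nat D * f = of_nat D * (g :: int symfun)" "D > 0"
  shows "f = g"
proof -
  have "int D * mcoeff (mps_of_symfun f) m = int D * mcoeff (mps_of_symfun g) m" for m
    using arg_cong[OF assms(1), of "\<lambda>f. mcoeff (mps_of_symfun f) m"]
    by (simp add: mcoeff_symfun_of_nat_mult)
  with assms(2) show ?thesis
    by (auto intro!: mps_eqI simp flip: mps_of_symfun_inject)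
qed

lemma of_nat_mult_cancel:
  assumes "of_nat D * F = of_nat D * (G :: int symfun mps)" "D > 0"
  shows "F = G"
proof (rule mps_eqI)
  fix m
  have "of_nat D * mcoeff F m = of_nat D * mcoeff G m"
    using arg_cong[OF assms(1), of "\<lambda>f. mcoeff f m"] by (simp add: mcoeff_of_nat_mult)
  then show "mcoeff F m = mcoeff G m"
    using assms(2) by (rule symfun_of_nat_mult_cancel)
qed

lemma psum_rel_divide:
  assumes "(of_nat D * f, H) \<in> psum_rel F" "D > 0"
  shows "\<exists>G. of_nat D * G = H"
proof -
  have "\<exists>g. of_nat D * g = h" if h: "\<And>a. int D dvd mcoeff (mps_of_symfun h) a" for h :: "int symfun"
  proof -
    let ?q = "mps_map (\<lambda>x. x div int D) (mps_of_symfun h)"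
    have "?q \<in> sym_series \<and> bounded_degree ?q"
      using mps_of_symfun[of h] by (auto simp: sym_series_def bounded_degree_def) (metis div_0)
    then have q: "mps_of_symfun (Abs_symfun ?q) = ?q"
      by (intro Abs_symfun_inverse) simp
    have "mcoeff (mps_of_symfun (of_nat D * Abs_symfun ?q)) m = mcoeff (mps_of_symfun h) m" for m
      using h[of m] by (simp add: mcoeff_symfun_of_nat_mult q)
    then have "of_nat D * Abs_symfun ?q = h"
      by (auto intro!: mps_eqI simp flip: mps_of_symfun_inject)
    then show ?thesis by blast
  qed
  from this[OF psum_rel_dvd[OF assms]] obtain g where "\<And>b. of_nat D * g b = mcoeff H b"
    by metis
  then have "of_nat D * Abs_mps g = H"
    by (intro mps_eqI) (simp add: mcoeff_of_nat_mult)
  then show ?thesis by blast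
qed

text \<open>Since 0 is \<open>D\<close> times 0 for every \<open>D\<close>, each coefficient of
  \<open>H\<close> is divisible by every positive integer, in particular by one exceeding its
  absolute value. Hence the relation is single-valued.\<close>

lemma psum_rel_zero_imp:
  assumes "(0, H) \<in> psum_rel F"
  shows "H = 0"
proof -
  have "mcoeff (mps_of_symfun (mcoeff H b)) a = 0" for a b
  proof -
    let ?c = "mcoeff (mps_of_symfun (mcoeff H b)) a"
    have "int (nat \<bar>?c\<bar> + 1) dvd ?c"
      by (rule psum_rel_dvd[of _ 0 _ F]) (use assms in simp_all)
    moreover have "int (nat \<bar>?c\<bar> + 1) = \<bar>?c\<bar> + 1"
      by simp
    ultimately have "\<bar>?c\<bar> + 1 dvd ?c"
      by (simp only:)
    then show ?thesis
      using dvd_imp_le_int[of ?c "\<bar>?c\<bar> + 1"] by linarith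
  qed
  then have "mcoeff H b = 0" for b
    by (auto intro!: mps_eqI simp: mps_of_symfun_simps simp flip: mps_of_symfun_inject)
  then show ?thesis
    by (intro mps_eqI) simp
qed

lemma psum_rel_unique:
  assumes "(of_nat D * f, of_nat D * G) \<in> psum_rel F" "D > 0"
    and "(of_nat D' * f, of_nat D' * G') \<in> psum_rel F" "D' > 0"
  shows "G = G'"
proof -
  have "(of_nat D' * (of_nat D * f) - of_nat D * (of_nat D' * f),
      of_nat D' * (of_nat D * G) - of_nat D * (of_nat D' * G')) \<in> psum_rel F"
    by (intro psum_rel.diff psum_rel_of_nat_mult assms)
  then have "of_nat D' * (of_nat D * G) - of_nat D * (of_nat D' * G') = 0"
    by (intro psum_rel_zero_imp[of _ F]) (simp add: mult.left_commute)
  then have "of_nat (D * D') * G = of_nat (D * D') * G'"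
    by (simp add: mult.assoc mult.left_commute)
  then show ?thesis
    by (rule of_nat_mult_cancel) (use assms in simp)
qed

lemma psum_rel_ex:
  "\<exists>G. \<exists>D>0. (of_nat D * f, of_nat D * G) \<in> psum_rel F"
  using psum_generate[of f F] psum_rel_divide[of _ f _ F] by (metis DomainE)

subsection \<open>Existence and uniqueness of plethysm\<close>

lemma sym_series_diff:
  fixes F G :: "'a::comm_ring mps"
  shows "F \<in> sym_series \<Longrightarrow> G \<in> sym_series \<Longrightarrow> F - G \<in> sym_series"
  by (rule sym_series_map2[where g = "(-)"]) auto

lemma sym_series_adams:
  assumes F: "F \<in> sym_series" and i: "i \<ge> 1"
  shows "adams i F \<in> sym_series"
  unfolding sym_series_def
proof (intro CollectI allI impI)
  fix \<pi> :: "nat \<Rightarrow> nat" and m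
  assume \<pi>: "bij \<pi>"
  have sc: "Poly_Mapping.map_key \<rho> (mscale i n) = mscale i (Poly_Mapping.map_key \<rho> n)" if "bij \<rho>" for \<rho> and n
    by (rule poly_mapping_eqI) (use that in \<open>simp add: lookup_map_key bij_is_inj\<close>)
  show "mcoeff (adams i F) (Poly_Mapping.map_key \<pi> m) = mcoeff (adams i F) m"
  proof (cases "m \<in> range (mscale i)")
    case True
    with F i \<pi> show ?thesis
      by (auto simp: adams_def sc sym_series_def)
  next
    case False
    have "Poly_Mapping.map_key \<pi> m \<notin> range (mscale i)"
    proof
      assume "Poly_Mapping.map_key \<pi> m \<in> range (mscale i)"
      then obtain n where "Poly_Mapping.map_key \<pi> m = mscale i n"
        by blast
      then have "m = mscale i (Poly_Mapping.map_key (inv \<pi>) n)"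
        by (metis map_key_inverse(2) \<pi> bij_imp_bij_inv sc)
      with False show False by blast
    qed
    with False show ?thesis
      by (simp add: adams_def mcoeff_vars_pow_outside)
  qed
qed

lemma psum_rel_sym:
  assumes "F \<in> sym_series" "(f, H) \<in> psum_rel F"
  shows "H \<in> sym_series"
  using assms(2)
  by induction (auto intro: sym_series_one sym_series_adams assms(1) sym_series_diff sym_series_mult)

text \<open>\<open>\<phi> f\<close> is the quotient of a series related to a multiple of
  \<open>f\<close>. Its laws hold for related pairs after clearing the denominators
  \<open>d g\<close> and \<open>d h\<close>, and then for \<open>\<phi>\<close> by torsion-freeness;
  any competitor agrees with the relation on its generators.\<close>

lemma ex1_plethysm:
  assumes F: "F \<in> sym_series"
  shows "\<exists>!\<phi> :: int symfun \<Rightarrow> int symfun mps. (\<forall>g. \<phi> g \<in> sym_series) \<and>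
      \<phi> 1 = 1 \<and> (\<forall>g h. \<phi> (g + h) = \<phi> g + \<phi> h) \<and> (\<forall>g h. \<phi> (g * h) = \<phi> g * \<phi> h) \<and>
      (\<forall>i\<ge>1. \<phi> (psum i) = adams i F)"
proof -
  obtain \<phi> where "\<And>f. \<exists>D>0. (of_nat D * f, of_nat D * \<phi> f) \<in> psum_rel F"
    using choice[of "\<lambda>f G. \<exists>D>0. (of_nat D * f, of_nat D * G) \<in> psum_rel F"]
      psum_rel_ex[of _ F] by blast
  then obtain d where \<phi>: "\<And>f. d f > 0" "\<And>f. (of_nat (d f) * f, of_nat (d f) * \<phi> f) \<in> psum_rel F"
    by metis
  have eqI: "\<phi> f = G" if "(of_nat D * f, of_nat D * G) \<in> psum_rel F" "D > 0" for f G D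
    using psum_rel_unique[OF \<phi>(2,1)] that by blast
  show ?thesis
  proof (intro ex1I[of _ \<phi>] conjI allI impI)
    fix g h
    show "\<phi> g \<in> sym_series"
    proof -
      have s: "of_nat (d g) * \<phi> g \<in> sym_series"
        by (rule psum_rel_sym[OF F \<phi>(2)])
      show ?thesis
        unfolding sym_series_def
      proof (intro CollectI allI impI)
        fix \<pi> :: "nat \<Rightarrow> nat" and m assume "bij \<pi>"
        with s have "of_nat (d g) * mcoeff (\<phi> g) (Poly_Mapping.map_key \<pi> m) = of_nat (d g) * mcoeff (\<phi> g) m"
          by (simp add: sym_series_def mcoeff_of_nat_mult)
        then show "mcoeff (\<phi> g) (Poly_Mapping.map_key \<pi> m) = mcoeff (\<phi> g) m"
          by (rule symfun_of_nat_mult_cancel) (rule \<phi>(1))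
      qed
    qed
    show "\<phi> 1 = 1"
      by (rule eqI[of 1]) (simp_all add: psum_rel.one)
    have pos: "d g * d h > 0"
      using \<phi>(1) by simp
    have "(of_nat (d h) * (of_nat (d g) * g) + of_nat (d g) * (of_nat (d h) * h),
        of_nat (d h) * (of_nat (d g) * \<phi> g) + of_nat (d g) * (of_nat (d h) * \<phi> h)) \<in> psum_rel F"
      by (intro psum_rel_add psum_rel_of_nat_mult \<phi>)
    then show "\<phi> (g + h) = \<phi> g + \<phi> h"
      using pos by (intro eqI[of "d g * d h"]) (simp_all add: algebra_simps)
    have "((of_nat (d g) * g) * (of_nat (d h) * h),
        (of_nat (d g) * \<phi> g) * (of_nat (d h) * \<phi> h)) \<in> psum_rel F"
      by (intro psum_rel.mult \<phi>)
    then show "\<phi> (g * h) = \<phi> g * \<phi> h"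
      using pos by (intro eqI[of "d g * d h"]) (simp_all add: mult_ac)
  next
    fix i :: nat assume "i \<ge> 1"
    then show "\<phi> (psum i) = adams i F"
      by (intro eqI[of 1]) (simp_all add: psum_rel.psum)
  next
    fix \<psi> :: "int symfun \<Rightarrow> int symfun mps"
    assume "(\<forall>g. \<psi> g \<in> sym_series) \<and>
      \<psi> 1 = 1 \<and> (\<forall>g h. \<psi> (g + h) = \<psi> g + \<psi> h) \<and> (\<forall>g h. \<psi> (g * h) = \<psi> g * \<psi> h) \<and>
      (\<forall>i\<ge>1. \<psi> (psum i) = adams i F)"
    then have \<psi>: "unital_hom \<psi>" "\<And>i. i \<ge> 1 \<Longrightarrow> \<psi> (psum i) = adams i F"
      by (auto simp: unital_hom_def)
    interpret unital_hom \<psi> by fact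
    have rel: "\<psi> f = H" if "(f, H) \<in> psum_rel F" for f H
      using that by induction (simp_all add: hom_one hom_diff hom_mult \<psi>(2))
    show "\<psi> = \<phi>"
    proof
      fix f
      have "of_nat (d f) * \<psi> f = of_nat (d f) * \<phi> f"
        using rel[OF \<phi>(2)[of f]] by (simp add: hom_mult unital_hom_of_nat[OF \<psi>(1)])
      then show "\<psi> f = \<phi> f"
        by (rule of_nat_mult_cancel) (rule \<phi>(1))
    qed
  qed
qed

lemma
  assumes "F \<in> sym_series"
  shows plethysm_sym: "plethysm f F \<in> sym_series"
    and unital_hom_plethysm: "unital_hom (\<lambda>f. plethysm f F)"
    and plethysm_psum: "i \<ge> 1 \<Longrightarrow> plethysm (psum i) F = adams i F"
  using theI'[OF ex1_plethysm[OF assms]] unfolding plethysm_def unital_hom_def by auto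

subsection \<open>Comparing series up to a given degree\<close>

definition eqdeg :: "nat \<Rightarrow> 'a mps \<Rightarrow> 'a mps \<Rightarrow> bool" where
  "eqdeg n F G \<longleftrightarrow> (\<forall>m. mdeg m \<le> n \<longrightarrow> mcoeff F m = mcoeff G m)"

text \<open>Mind the offset: over a ring, \<open>eqdeg n F G\<close> amounts to
  \<open>ordge (Suc n) (F - G)\<close>.\<close>

definition ordge :: "nat \<Rightarrow> 'a::zero mps \<Rightarrow> bool" where
  "ordge n F \<longleftrightarrow> (\<forall>m. mdeg m < n \<longrightarrow> mcoeff F m = 0)"

lemma eqdegD: "eqdeg n F G \<Longrightarrow> mdeg m \<le> n \<Longrightarrow> mcoeff F m = mcoeff G m"
  by (simp add: eqdeg_def)

lemma ordgeD: "ordge n F \<Longrightarrow> mdeg m < n \<Longrightarrow> mcoeff F m = 0"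
  by (simp add: ordge_def)

lemma eqdeg_refl [simp]: "eqdeg n F F"
  by (simp add: eqdeg_def)

lemma eqdeg_sym: "eqdeg n F G \<Longrightarrow> eqdeg n G F"
  by (simp add: eqdeg_def)

lemma eqdeg_trans [trans]: "eqdeg n F G \<Longrightarrow> eqdeg n G H \<Longrightarrow> eqdeg n F H"
  by (simp add: eqdeg_def)

lemma eqdeg_mono: "eqdeg n F G \<Longrightarrow> k \<le> n \<Longrightarrow> eqdeg k F G"
  by (simp add: eqdeg_def)

lemma ordge_mono: "ordge n F \<Longrightarrow> k \<le> n \<Longrightarrow> ordge k F"
  by (simp add: ordge_def)

lemma eqdeg_imp_eq: "(\<And>n. eqdeg n F G) \<Longrightarrow> F = G"
  unfolding eqdeg_def by (rule mps_eqI) blast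

lemma eqdeg_add: "eqdeg n F F' \<Longrightarrow> eqdeg n G G' \<Longrightarrow> eqdeg n (F + G) (F' + G')"
  by (simp add: eqdeg_def)

lemma eqdeg_diff: "eqdeg n F F' \<Longrightarrow> eqdeg n G G' \<Longrightarrow> eqdeg n (F - G) (F' - G')"
  by (simp add: eqdeg_def)

lemma eqdeg_sum:
  fixes F :: "'b \<Rightarrow> 'a::comm_ring mps"
  shows "(\<And>x. x \<in> A \<Longrightarrow> eqdeg n (F x) (G x)) \<Longrightarrow> eqdeg n (sum F A) (sum G A)"
  by (induction A rule: infinite_finite_induct) (auto intro: eqdeg_add)

lemma mdeg_eq_0_iff: "mdeg m = 0 \<longleftrightarrow> m = 0"
proof
  assume "mdeg m = 0"
  then have "Poly_Mapping.lookup m j = 0" for j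
    using lookup_le_mdeg[of m j] by simp
  then show "m = 0"
    by (intro poly_mapping_eqI) simp
qed simp

lemma decomp_mdeg: "(a, b) \<in> decomp m \<Longrightarrow> mdeg a + mdeg b = mdeg m"
  by (auto simp: decomp_def mdeg_add)

lemma eqdeg_mult:
  fixes F G :: "'a::comm_ring mps"
  assumes "eqdeg n F F'" "eqdeg n G G'"
  shows "eqdeg n (F * G) (F' * G')"
  unfolding eqdeg_def
proof (intro allI impI)
  fix m assume m: "mdeg m \<le> n"
  show "mcoeff (F * G) m = mcoeff (F' * G') m"
    unfolding mcoeff_mult
  proof (intro sum.cong refl, clarify)
    fix a b assume "(a, b) \<in> decomp m"
    then have "mdeg a \<le> n" "mdeg b \<le> n"
      using decomp_mdeg m by fastforce+
    then show "mcoeff F a * mcoeff G b = mcoeff F' a * mcoeff G' b"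
      using assms by (simp add: eqdeg_def)
  qed
qed

text \<open>Without constant terms, both factors of a contribution in degree \<open>Suc n\<close>
  have degree at most \<open>n\<close>. This gained degree is one source of the contraction behind
  the logarithm.\<close>

lemma eqdeg_mult_Suc:
  fixes F G :: "'a::comm_ring mps"
  assumes "eqdeg n F F'" "eqdeg n G G'"
    and "mcoeff F 0 = 0" "mcoeff G 0 = 0" "mcoeff F' 0 = 0" "mcoeff G' 0 = 0"
  shows "eqdeg (Suc n) (F * G) (F' * G')"
  unfolding eqdeg_def
proof (intro allI impI)
  fix m assume m: "mdeg m \<le> Suc n"
  show "mcoeff (F * G) m = mcoeff (F' * G') m"
    unfolding mcoeff_mult
  proof (intro sum.cong refl, clarify)
    fix a b assume ab: "(a, b) \<in> decomp m"
    show "mcoeff F a * mcoeff G b = mcoeff F' a * mcoeff G' b"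
    proof (cases "a = 0 \<or> b = 0")
      case True
      with assms show ?thesis by auto
    next
      case False
      then have "mdeg a \<noteq> 0" "mdeg b \<noteq> 0"
        by (auto simp: mdeg_eq_0_iff)
      with decomp_mdeg[OF ab] m have "mdeg a \<le> n" "mdeg b \<le> n"
        by linarith+
      then show ?thesis
        using assms by (simp add: eqdeg_def)
    qed
  qed
qed

lemma ordge_mult:
  fixes F G :: "'a::comm_ring mps"
  assumes "ordge k F" "ordge l G"
  shows "ordge (k + l) (F * G)"
  unfolding ordge_def mcoeff_mult
proof (intro allI impI sum.neutral, clarify)
  fix m a b assume m: "mdeg m < k + l" and "(a, b) \<in> decomp m"
  then have "mdeg a < k \<or> mdeg b < l"
    using decomp_mdeg by fastforce
  then show "mcoeff F a * mcoeff G b = 0"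
    using assms by (auto simp: ordge_def)
qed

lemma ordge_0 [simp]: "ordge 0 F"
  by (simp add: ordge_def)

lemma ordge_zero [simp]: "ordge n (0 :: 'a::comm_ring mps)"
  by (simp add: ordge_def)

lemma ordge_1_iff: "ordge (Suc 0) F \<longleftrightarrow> mcoeff F 0 = 0"
  by (auto simp: ordge_def mdeg_eq_0_iff)

lemma ordge_psum_mps: "ordge i (psum_mps i :: 'a::{zero, one} mps)"
  by (auto simp: ordge_def psum_mps_def)

lemma ordge_power:
  fixes F :: "'a::{comm_ring, comm_monoid_mult} mps"
  assumes "ordge i F"
  shows "ordge (i * k) (F ^ k)"
  by (induction k) (use ordge_mult[OF assms] in auto)

lemma eqdeg_sum_superset:
  fixes F :: "'b \<Rightarrow> 'a::comm_ring mps"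
  assumes "finite B" "A \<subseteq> B" "\<And>x. x \<in> B - A \<Longrightarrow> ordge (Suc n) (F x)"
  shows "eqdeg n (sum F A) (sum F B)"
  unfolding eqdeg_def mcoeff_sum
  by (intro allI impI sum.mono_neutral_left) (use assms in \<open>auto simp: ordge_def\<close>)

lemma mps_lim_eqI:
  assumes "\<And>m. \<forall>\<^sub>F n in sequentially. mcoeff (X n) m = mcoeff F m"
  shows "mps_lim X = F"
proof (rule mps_eqI)
  fix m
  have "(THE c. \<forall>\<^sub>F n in sequentially. mcoeff (X n) m = c) = mcoeff F m"
  proof (rule the_equality)
    fix c assume "\<forall>\<^sub>F n in sequentially. mcoeff (X n) m = c"
    with assms[of m] have "\<forall>\<^sub>F n in sequentially. c = mcoeff F m"
      by eventually_elim simp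
    then show "c = mcoeff F m" by simp
  qed (rule assms)
  then show "mcoeff (mps_lim X) m = mcoeff F m"
    by (simp add: mps_lim_def)
qed

lemma eqdeg_mps_lim:
  assumes X: "\<And>n k. n \<le> k \<Longrightarrow> eqdeg n (X k) (X n)"
  shows "eqdeg n (mps_lim X) (X n)"
proof -
  let ?F = "Abs_mps (\<lambda>m. mcoeff (X (mdeg m)) m)"
  have "\<forall>\<^sub>F n in sequentially. mcoeff (X n) m = mcoeff ?F m" for m
    using eventually_ge_at_top[of "mdeg m"]
    by eventually_elim (use X in \<open>simp add: eqdeg_def\<close>)
  then have "mps_lim X = ?F"
    by (rule mps_lim_eqI)
  then show ?thesis
    using X by (auto simp: eqdeg_def)
qed

lemma eqdeg_suminf:
  assumes "\<And>k. ordge k (F k)"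
  shows "eqdeg n (mps_suminf F) (\<Sum>k\<le>n. F k)"
proof -
  have 1: "eqdeg n (\<Sum>k<n'. F k) (\<Sum>k<Suc n. F k)" if "Suc n \<le> n'" for n n'
    by (rule eqdeg_sym, rule eqdeg_sum_superset)
      (use that assms in \<open>auto intro: ordge_mono\<close>)
  have "\<forall>\<^sub>F n in sequentially. mcoeff (\<Sum>k<n. F k) m = mcoeff (Abs_mps (\<lambda>m. mcoeff (\<Sum>k<Suc (mdeg m). F k) m)) m" for m
    using eventually_ge_at_top[of "Suc (mdeg m)"]
    by eventually_elim (use 1 in \<open>simp add: eqdeg_def del: sum.lessThan_Suc\<close>)
  then have eq: "mps_suminf F = Abs_mps (\<lambda>m. mcoeff (\<Sum>k<Suc (mdeg m). F k) m)"
    unfolding mps_suminf_def by (rule mps_lim_eqI)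
  show ?thesis
    using 1[of _ "Suc n"] unfolding eq eqdeg_def lessThan_Suc_atMost by simp
qed

subsection \<open>The plethystic exponential and logarithm\<close>

lemma mcoeff_adams_mscale [simp]:
  "i \<ge> 1 \<Longrightarrow> mcoeff (adams i F) (mscale i m) = symfun_vars_pow i (mcoeff F m)"
  by (simp add: adams_def)

lemma mcoeff_adams_outside: "m \<notin> range (mscale i) \<Longrightarrow> mcoeff (adams i F) m = 0"
  by (simp add: adams_def mcoeff_vars_pow_outside)

lemma mcoeff_adams_0: "i \<ge> 1 \<Longrightarrow> mcoeff F 0 = 0 \<Longrightarrow> mcoeff (adams i F) 0 = 0"
  using mcoeff_adams_mscale[of i F 0] by simp

text \<open>What \<open>adams i F\<close> has in degree \<open>i * k\<close> comes from degree
  \<open>k\<close> of \<open>F\<close>. The free bound \<open>n'\<close> serves both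
  \<open>i \<ge> 1\<close>, where the precision is kept, and \<open>i \<ge> 2\<close>, where a
  degree is gained.\<close>

lemma eqdeg_adams_strong:
  assumes "eqdeg n F G" "i \<ge> 1" "\<And>k. i * k \<le> n' \<Longrightarrow> k \<le> n"
  shows "eqdeg n' (adams i F) (adams i G)"
  unfolding eqdeg_def
proof (intro allI impI)
  fix m assume m: "mdeg m \<le> n'"
  show "mcoeff (adams i F) m = mcoeff (adams i G) m"
  proof (cases "m \<in> range (mscale i)")
    case True
    then obtain m' where m': "m = mscale i m'" by blast
    with m assms have "mdeg m' \<le> n"
      by (simp add: mdeg_mscale)
    with assms show ?thesis
      by (simp add: m' eqdeg_def)
  qed (simp add: mcoeff_adams_outside)
qed

lemma eqdeg_adams:
  assumes "eqdeg n F G" "i \<ge> 1"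
  shows "eqdeg n (adams i F) (adams i G)"
proof (rule eqdeg_adams_strong[OF assms])
  fix k assume "i * k \<le> n"
  moreover have "1 * k \<le> i * k"
    using assms(2) by (rule mult_le_mono1)
  ultimately show "k \<le> n" by linarith
qed

lemma eqdeg_adams_Suc:
  assumes "eqdeg n F G" "i \<ge> 2"
  shows "eqdeg (Suc n) (adams i F) (adams i G)"
proof (rule eqdeg_adams_strong[OF assms(1)])
  fix k assume "i * k \<le> Suc n"
  moreover have "2 * k \<le> i * k"
    using assms(2) by (rule mult_le_mono1)
  ultimately show "k \<le> n" by linarith
qed (use assms in simp)

lemma ordge_adams:
  assumes "mcoeff F 0 = 0" "i \<ge> 1"
  shows "ordge i (adams i F)"
  unfolding ordge_def
proof (intro allI impI)
  fix m assume m: "mdeg m < i"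
  show "mcoeff (adams i F) m = 0"
  proof (cases "m \<in> range (mscale i)")
    case True
    then obtain m' where m': "m = mscale i m'" by blast
    with m have "mdeg m' = 0"
      by (simp add: mdeg_mscale)
    then have "m' = 0"
      by (simp add: mdeg_eq_0_iff)
    then show ?thesis
      using assms m' by (simp add: mcoeff_adams_0)
  qed (simp add: mcoeff_adams_outside)
qed

lemma hcomp_0: "(hcomp 0 :: int symfun) = 1"
  by transfer (rule mps_eqI, simp add: hcomp_mps_def mcoeff_one mdeg_eq_0_iff)

text \<open>The handle on \<open>plethysm (hcomp n) F\<close>: it computes \<open>n\<close> times
  this series from Adams operations and smaller indices, so properties follow by induction on
  \<open>n\<close> and cancellation of \<open>n\<close>.\<close>

lemma plethysm_newton:
  assumes "F \<in> sym_series"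
  shows "of_nat n * plethysm (hcomp n) F = (\<Sum>i=1..n. adams i F * plethysm (hcomp (n - i)) F)"
proof -
  interpret unital_hom "\<lambda>f. plethysm f F"
    by (rule unital_hom_plethysm[OF assms])
  show ?thesis
    using arg_cong[OF newton[of n], of "\<lambda>f. plethysm f F"]
    by (simp add: hom_mult hom_sum unital_hom_of_nat[OF unital_hom_plethysm[OF assms]]
        plethysm_psum[OF assms])
qed

lemma plethysm_hcomp_0: "F \<in> sym_series \<Longrightarrow> plethysm (hcomp 0) F = 1"
  using unital_hom.hom_one[OF unital_hom_plethysm] by (simp add: hcomp_0)

lemma plethysm_hcomp_1: "F \<in> sym_series \<Longrightarrow> plethysm (hcomp (Suc 0)) F = F"
  using plethysm_newton[of F "Suc 0"] by (simp add: plethysm_hcomp_0)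

lemma symfun_of_nat_mult_eq_0: "of_nat n * (f :: int symfun) = 0 \<Longrightarrow> n > 0 \<Longrightarrow> f = 0"
  using symfun_of_nat_mult_cancel[of n f 0] by simp

lemma ordge_plethysm_hcomp:
  assumes "F \<in> sym_series" "mcoeff F 0 = 0"
  shows "ordge n (plethysm (hcomp n) F)"
proof (induction n rule: less_induct)
  case (less n)
  show ?case
  proof (cases "n = 0")
    case False
    have "ordge n (adams i F * plethysm (hcomp (n - i)) F)" if "i \<in> {1..n}" for i
      using ordge_mult[OF ordge_adams[OF assms(2)] less[of "n - i"], of i] that by simp
    then have "ordge n (of_nat n * plethysm (hcomp n) F)"
      unfolding plethysm_newton[OF assms(1)] by (simp add: ordge_def mcoeff_sum)
    with False show ?thesis
      unfolding ordge_def mcoeff_of_nat_mult by (auto intro: symfun_of_nat_mult_eq_0)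
  qed simp
qed

lemma eqdeg_Exp:
  assumes "F \<in> sym_series" "mcoeff F 0 = 0"
  shows "eqdeg n (Exp_sigma F) (\<Sum>k\<le>n. plethysm (hcomp k) F)"
  unfolding Exp_sigma_def by (rule eqdeg_suminf) (rule ordge_plethysm_hcomp[OF assms])

lemma mcoeff_Exp_0:
  assumes "F \<in> sym_series" "mcoeff F 0 = 0"
  shows "mcoeff (Exp_sigma F) 0 = 1"
  using eqdegD[OF eqdeg_Exp[OF assms, of 0], of 0] assms
  by (simp add: plethysm_hcomp_0 mcoeff_one)

lemma sym_series_Exp:
  assumes "F \<in> sym_series" "mcoeff F 0 = 0"
  shows "Exp_sigma F \<in> sym_series"
  unfolding sym_series_def
proof (intro CollectI allI impI)
  fix \<pi> :: "nat \<Rightarrow> nat" and m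
  assume \<pi>: "bij \<pi>"
  have "mcoeff (plethysm (hcomp k) F) (Poly_Mapping.map_key \<pi> m) = mcoeff (plethysm (hcomp k) F) m" for k
    using plethysm_sym[OF assms(1)] \<pi> by (auto simp: sym_series_def)
  then show "mcoeff (Exp_sigma F) (Poly_Mapping.map_key \<pi> m) = mcoeff (Exp_sigma F) m"
    using eqdegD[OF eqdeg_Exp[OF assms, of "mdeg m"], of m]
      eqdegD[OF eqdeg_Exp[OF assms, of "mdeg m"], of "Poly_Mapping.map_key \<pi> m"] \<pi>
    by (simp add: mdeg_map_key mcoeff_sum)
qed

lemma eqdeg_of_nat_mult_cancel:
  "eqdeg d (of_nat n * F) (of_nat n * (G :: int symfun mps)) \<Longrightarrow> n > 0 \<Longrightarrow> eqdeg d F G"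
  unfolding eqdeg_def mcoeff_of_nat_mult by (meson symfun_of_nat_mult_cancel)

lemma eqdeg_plethysm_hcomp:
  assumes F: "F \<in> sym_series" "mcoeff F 0 = 0" and G: "G \<in> sym_series" "mcoeff G 0 = 0"
    and FG: "eqdeg d F G"
  shows "eqdeg d (plethysm (hcomp n) F) (plethysm (hcomp n) G)"
proof (induction n rule: less_induct)
  case (less n)
  show ?case
  proof (cases "n = 0")
    case True
    then show ?thesis
      using F G by (simp add: plethysm_hcomp_0)
  next
    case False
    have "eqdeg d (of_nat n * plethysm (hcomp n) F) (of_nat n * plethysm (hcomp n) G)"
      unfolding plethysm_newton[OF F(1)] plethysm_newton[OF G(1)]
      by (intro eqdeg_sum eqdeg_mult eqdeg_adams FG less) auto
    then show ?thesis
      by (rule eqdeg_of_nat_mult_cancel) (use False in simp)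
  qed
qed

text \<open>Every term of Newton's identity gains a degree: for \<open>i = n\<close> because
  \<open>adams n\<close> with \<open>n \<ge> 2\<close> does, for \<open>i < n\<close> because both
  factors lack a constant term.\<close>

lemma eqdeg_plethysm_hcomp_Suc:
  assumes F: "F \<in> sym_series" "mcoeff F 0 = 0" and G: "G \<in> sym_series" "mcoeff G 0 = 0"
    and FG: "eqdeg d F G" and n: "n \<ge> 2"
  shows "eqdeg (Suc d) (plethysm (hcomp n) F) (plethysm (hcomp n) G)"
proof -
  have "eqdeg (Suc d) (of_nat n * plethysm (hcomp n) F) (of_nat n * plethysm (hcomp n) G)"
    unfolding plethysm_newton[OF F(1)] plethysm_newton[OF G(1)]
  proof (rule eqdeg_sum)
    fix i assume i: "i \<in> {1..n}"
    show "eqdeg (Suc d) (adams i F * plethysm (hcomp (n - i)) F) (adams i G * plethysm (hcomp (n - i)) G)"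
    proof (cases "i = n")
      case True
      then show ?thesis
        using eqdeg_adams_Suc[OF FG n] F G by (simp add: plethysm_hcomp_0)
    next
      case False
      have "mcoeff (plethysm (hcomp (n - i)) H) 0 = 0" if "H \<in> sym_series" "mcoeff H 0 = 0" for H
        using ordgeD[OF ordge_plethysm_hcomp[OF that, of "n - i"], of 0] False i by simp
      then show ?thesis
        using F G i FG
        by (intro eqdeg_mult_Suc eqdeg_plethysm_hcomp eqdeg_adams mcoeff_adams_0) auto
    qed
  qed
  then show ?thesis
    by (rule eqdeg_of_nat_mult_cancel) (use n in simp)
qed

text \<open>
  \<open>Exp\<^sub>\<sigma>(F) - F\<close> depends on \<open>F\<close> only through lower degrees, so that
  \<open>L \<mapsto> L + F - Exp\<^sub>\<sigma>(L)\<close> is a contraction whose fixed point is the logarithm of \<open>F\<close>.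
\<close>

lemma eqdeg_Exp_minus:
  assumes F: "F \<in> sym_series" "mcoeff F 0 = 0" and G: "G \<in> sym_series" "mcoeff G 0 = 0"
    and FG: "eqdeg d F G"
  shows "eqdeg (Suc d) (F - Exp_sigma F) (G - Exp_sigma G)"
proof -
  \<comment> \<open>Large enough to determine \<open>Exp_sigma\<close> up to degree
    \<open>Suc d\<close> and to split off the terms for 0 and 1, whose sum is
    \<open>1 + H\<close>.\<close>
  obtain N where N: "Suc d \<le> N" "2 \<le> N"
    by (rule that[of "Suc (Suc d)"]) auto
  let ?S = "\<lambda>F. \<Sum>k=2..N. plethysm (hcomp k) F"
  have *: "eqdeg (Suc d) (H - Exp_sigma H) (- 1 - ?S H)" if "H \<in> sym_series" "mcoeff H 0 = 0" for H
  proof -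
    have "{..N} = insert 0 (insert 1 {2..N})"
      using N by auto
    then have "(\<Sum>k\<le>N. plethysm (hcomp k) H) = 1 + (H + ?S H)"
      using that by (simp add: plethysm_hcomp_0 plethysm_hcomp_1)
    then have "eqdeg (Suc d) (Exp_sigma H) (1 + (H + ?S H))"
      using eqdeg_mono[OF eqdeg_Exp[OF that, of N], of "Suc d"] N by simp
    then have "eqdeg (Suc d) (H - Exp_sigma H) (H - (1 + (H + ?S H)))"
      by (intro eqdeg_diff) simp_all
    then show ?thesis by simp
  qed
  have "eqdeg (Suc d) (- 1 - ?S F) (- 1 - ?S G)"
    by (intro eqdeg_diff eqdeg_refl eqdeg_sum eqdeg_plethysm_hcomp_Suc assms) auto
  with *[OF F] *[OF G] show ?thesis
    by (meson eqdeg_sym eqdeg_trans)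
qed

lemma sym_series_add:
  fixes F G :: "'a::comm_ring mps"
  shows "F \<in> sym_series \<Longrightarrow> G \<in> sym_series \<Longrightarrow> F + G \<in> sym_series"
  by (rule sym_series_map2[where g = "(+)"]) auto

lemma inj_on_Exp: "inj_on Exp_sigma {F \<in> sym_series. mcoeff F 0 = 0}"
proof (rule inj_onI, rule eqdeg_imp_eq)
  fix F G n assume "F \<in> {F \<in> sym_series. mcoeff F 0 = 0}" "G \<in> {F \<in> sym_series. mcoeff F 0 = 0}"
    and eq: "Exp_sigma F = Exp_sigma G"
  then have FG: "F \<in> sym_series" "mcoeff F 0 = 0" "G \<in> sym_series" "mcoeff G 0 = 0"
    by auto
  show "eqdeg n F G"
  proof (induction n)
    case 0
    show ?case
      using FG by (simp add: eqdeg_def mdeg_eq_0_iff)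
  next
    case (Suc n)
    from eqdeg_add[OF eqdeg_Exp_minus[OF FG Suc] eqdeg_refl[of _ "Exp_sigma F"]] show ?case
      by (simp add: eq)
  qed
qed

lemma surj_Exp:
  assumes Y: "Y \<in> sym_series" "mcoeff Y 0 = 1"
  shows "\<exists>L. L \<in> sym_series \<and> mcoeff L 0 = 0 \<and> Exp_sigma L = Y"
proof -
  define T where "T L = (L - Exp_sigma L) + Y" for L
  define X where "X k = (T ^^ k) 0" for k
  have X: "X k \<in> sym_series \<and> mcoeff (X k) 0 = 0" for k
  proof (induction k)
    case 0
    show ?case by (simp add: X_def sym_series_def)
  next
    case (Suc k)
    have "X k - Exp_sigma (X k) \<in> sym_series"
      using Suc by (intro sym_series_diff sym_series_Exp) auto
    then have "T (X k) \<in> sym_series"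
      unfolding T_def using Y(1) by (rule sym_series_add)
    then show ?case
      using Suc Y(2) by (simp add: X_def T_def mcoeff_Exp_0)
  qed
  have T: "eqdeg (Suc n) (T F) (T G)"
    if "F \<in> sym_series" "mcoeff F 0 = 0" "G \<in> sym_series" "mcoeff G 0 = 0" "eqdeg n F G" for n F G
    unfolding T_def by (intro eqdeg_add eqdeg_refl eqdeg_Exp_minus that)
  have XS: "X (Suc k) = T (X k)" for k
    by (simp add: X_def)
  have X_step: "eqdeg k (X (Suc k)) (X k)" for k
  proof (induction k)
    case 0
    show ?case
      using X by (simp add: eqdeg_def mdeg_eq_0_iff)
  next
    case (Suc k)
    show ?case
      unfolding XS[of "Suc k"] by (subst (2) XS) (use X Suc in \<open>auto intro!: T\<close>)
  qed
  have "eqdeg n (X k) (X n)" if "n \<le> k" for n k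
    using that
  proof (induction k rule: dec_induct)
    case (step k)
    then show ?case
      using eqdeg_trans[OF eqdeg_mono[OF X_step]] by blast
  qed simp
  then have L: "eqdeg n (mps_lim X) (X n)" for n
    by (rule eqdeg_mps_lim)
  have L0: "mcoeff (mps_lim X) 0 = 0"
    using eqdegD[OF L[of 0], of 0] X by simp
  have Lsym: "mps_lim X \<in> sym_series"
    unfolding sym_series_def
  proof (intro CollectI allI impI)
    fix \<pi> :: "nat \<Rightarrow> nat" and m assume \<pi>: "bij \<pi>"
    \<comment> \<open>Rearranging preserves the degree, so one and the same iterate supplies both
      coefficients of the limit.\<close>
    have "mcoeff (X (mdeg m)) (Poly_Mapping.map_key \<pi> m) = mcoeff (X (mdeg m)) m"
      using X \<pi> by (auto simp: sym_series_def)
    then show "mcoeff (mps_lim X) (Poly_Mapping.map_key \<pi> m) = mcoeff (mps_lim X) m"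
      using eqdegD[OF L[of "mdeg m"]] \<pi> by (simp add: mdeg_map_key)
  qed
  have "eqdeg n (T (mps_lim X)) (mps_lim X)" for n
  proof -
    have "eqdeg (Suc n) (T (mps_lim X)) (X (Suc n))"
      unfolding XS by (intro T L Lsym L0) (use X in auto)
    then show ?thesis
      using L[of "Suc n"] by (meson eqdeg_mono eqdeg_sym eqdeg_trans le_SucI order_refl)
  qed
  then have "T (mps_lim X) = mps_lim X"
    by (rule eqdeg_imp_eq)
  then have "Exp_sigma (mps_lim X) = Y"
    by (simp add: T_def)
  with Lsym L0 show ?thesis by blast
qed

lemma
  assumes Y: "Y \<in> sym_series" "mcoeff Y 0 = 1"
  shows sym_series_Log: "Log_sigma Y \<in> sym_series"
    and mcoeff_Log_0: "mcoeff (Log_sigma Y) 0 = 0"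
    and Exp_Log: "Exp_sigma (Log_sigma Y) = Y"
proof -
  obtain L where L: "L \<in> sym_series" "mcoeff L 0 = 0" "Exp_sigma L = Y"
    using surj_Exp[OF Y] by blast
  then have "Log_sigma Y = L"
    unfolding Log_sigma_def by (intro the_inv_into_f_eq inj_on_Exp) auto
  with L show "Log_sigma Y \<in> sym_series" "mcoeff (Log_sigma Y) 0 = 0" "Exp_sigma (Log_sigma Y) = Y"
    by auto
qed

subsection \<open>The Euler derivation\<close>

definition euler :: "'a::comm_ring_1 mps \<Rightarrow> 'a mps" where
  "euler F = Abs_mps (\<lambda>m. of_nat (mdeg m) * mcoeff F m)"

lemma mcoeff_euler: "mcoeff (euler F) m = of_nat (mdeg m) * mcoeff F m"
  by (simp add: euler_def)

lemma euler_mult: "euler (F * G) = euler F * G + F * euler G"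
proof (rule mps_eqI)
  fix m
  have "mcoeff (euler (F * G)) m =
      (\<Sum>(a, b)\<in>decomp m. of_nat (mdeg a + mdeg b) * (mcoeff F a * mcoeff G b))"
    unfolding mcoeff_euler mcoeff_mult sum_distrib_left
    by (rule sum.cong) (auto simp: decomp_mdeg simp del: of_nat_add)
  then show "mcoeff (euler (F * G)) m = mcoeff (euler F * G + F * euler G) m"
    unfolding mcoeff_simps mcoeff_mult mcoeff_euler
    by (simp add: case_prod_beta algebra_simps sum.distrib)
qed

lemma euler_one: "euler 1 = 0"
  by (rule mps_eqI) (simp add: mcoeff_euler mcoeff_one)

lemma euler_sum: "euler (sum F A) = (\<Sum>x\<in>A. euler (F x))"
  by (rule mps_eqI) (simp add: mcoeff_euler mcoeff_sum sum_distrib_left)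

lemma euler_diff: "euler (F - G) = euler F - euler G"
  by (rule mps_eqI) (simp add: mcoeff_euler algebra_simps)

lemma euler_const_mult: "euler (mps_const c * F) = mps_const c * euler F"
  by (rule mps_eqI) (simp add: mcoeff_euler mcoeff_const_mult mult.left_commute)

lemma eqdeg_euler: "eqdeg n F G \<Longrightarrow> eqdeg n (euler F) (euler G)"
  by (simp add: eqdeg_def mcoeff_euler)

lemma euler_psum_mps: "euler (psum_mps i) = of_nat i * psum_mps i"
  by (rule mps_eqI) (auto simp: mcoeff_euler mcoeff_of_nat_mult psum_mps_def)

lemma euler_power: "euler (F ^ Suc k) = of_nat (Suc k) * F ^ k * euler F"
  by (induction k) (simp_all add: euler_mult algebra_simps)

lemma euler_map:
  fixes g :: "'a::comm_ring_1 \<Rightarrow> 'b::comm_ring_1"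
  assumes "unital_hom g"
  shows "euler (mps_map g F) = mps_map g (euler F)"
  by (rule mps_eqI)
    (simp add: mcoeff_euler unital_hom.hom_mult[OF assms] unital_hom_of_nat[OF assms])

text \<open>Substituting \<open>i\<close>-th powers multiplies degrees by \<open>i\<close>. This
  factor is what cancels the denominator in \<open>p_i / i\<close>.\<close>

lemma euler_adams:
  assumes i: "i \<ge> 1"
  shows "euler (adams i F) = of_nat i * adams i (euler F)"
proof (rule mps_eqI)
  fix m
  interpret unital_hom "symfun_vars_pow i :: int symfun \<Rightarrow> int symfun"
    by (rule unital_hom_symfun_vars_pow[OF i])
  show "mcoeff (euler (adams i F)) m = mcoeff (of_nat i * adams i (euler F)) m"
  proof (cases "m \<in> range (mscale i)")
    case True
    then obtain m' where m': "m = mscale i m'" by blast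
    show ?thesis
      using i by (simp add: m' mcoeff_euler mcoeff_of_nat_mult mdeg_mscale hom_mult
          unital_hom_of_nat[OF unital_hom_symfun_vars_pow[OF i]] mult.assoc)
  next
    case False
    then show ?thesis
      by (simp add: mcoeff_euler mcoeff_of_nat_mult mcoeff_adams_outside)
  qed
qed

lemma sum_triangle_swap:
  fixes f :: "nat \<Rightarrow> nat \<Rightarrow> 'a::comm_monoid_add"
  shows "(\<Sum>i=1..n. \<Sum>j=1..n - i. f i j) = (\<Sum>j=1..n. \<Sum>i=1..n - j. f i j)"
proof -
  have "(\<Sum>i=1..n. \<Sum>j=1..n - i. f i j) = (\<Sum>i=1..n. \<Sum>j | j \<in> {1..n} \<and> i + j \<le> n. f i j)"
    by (intro sum.cong refl) auto
  also have "\<dots> = (\<Sum>j=1..n. \<Sum>i | i \<in> {1..n} \<and> i + j \<le> n. f i j)"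
    by (rule sum.swap_restrict) auto
  also have "\<dots> = (\<Sum>j=1..n. \<Sum>i=1..n - j. f i j)"
    by (intro sum.cong refl) auto
  finally show ?thesis .
qed

text \<open>Apply the derivation to Newton's identity. The terms with differentiated Adams
  operations carry the weight \<open>i\<close>; in the others the induction hypothesis and Newton's
  identity for \<open>n - j\<close> produce the weight \<open>n - j\<close>.\<close>

lemma euler_plethysm_hcomp:
  assumes F: "F \<in> sym_series" "mcoeff F 0 = 0"
  shows "euler (plethysm (hcomp n) F) =
    (\<Sum>i=1..n. adams i (euler F) * plethysm (hcomp (n - i)) F)"
proof (induction n rule: less_induct)
  case (less n)
  let ?H = "\<lambda>k. plethysm (hcomp k) F" and ?Q = "\<lambda>i. adams i (euler F)"
  show ?case
  proof (cases "n = 0")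
    case True
    then show ?thesis
      using F by (simp add: plethysm_hcomp_0 euler_one)
  next
    case False
    have e: "euler (of_nat n * G) = of_nat n * euler G" for G :: "int symfun mps" and n
      by (rule mps_eqI) (simp add: mcoeff_euler mcoeff_of_nat_mult mult.left_commute)
    have "of_nat n * euler (?H n) = euler (\<Sum>i=1..n. adams i F * ?H (n - i))"
      by (subst plethysm_newton[OF F(1), symmetric]) (rule e[symmetric])
    also have "\<dots> = (\<Sum>i=1..n. of_nat i * (?Q i * ?H (n - i))) +
        (\<Sum>i=1..n. \<Sum>j=1..n - i. ?Q j * (adams i F * ?H (n - i - j)))"
      unfolding euler_sum euler_mult sum.distrib
      by (intro arg_cong2[of _ _ _ _ "(+)"] sum.cong refl)
        (simp_all add: euler_adams less sum_distrib_left algebra_simps)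
    also have "(\<Sum>i=1..n. \<Sum>j=1..n - i. ?Q j * (adams i F * ?H (n - i - j))) =
        (\<Sum>j=1..n. ?Q j * (\<Sum>i=1..n - j. adams i F * ?H (n - j - i)))"
      by (subst sum_triangle_swap) (simp add: sum_distrib_left add.commute)
    also have "\<dots> = (\<Sum>j=1..n. of_nat (n - j) * (?Q j * ?H (n - j)))"
      by (simp only: plethysm_newton[OF F(1), symmetric] mult.left_commute)
    \<comment> \<open>The weights \<open>i\<close> and \<open>n - i\<close> of the same product add
      up to \<open>n\<close>, which is then cancelled.\<close>
    also have "(\<Sum>i=1..n. of_nat i * (?Q i * ?H (n - i))) + \<dots> =
        (\<Sum>i=1..n. of_nat n * (?Q i * ?H (n - i)))"
      unfolding sum.distrib[symmetric]
    proof (rule sum.cong[OF refl])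
      fix i assume "i \<in> {1..n}"
      then have "(of_nat i :: int symfun mps) + of_nat (n - i) = of_nat n"
        by (simp flip: of_nat_add)
      then show "of_nat i * (?Q i * ?H (n - i)) + of_nat (n - i) * (?Q i * ?H (n - i)) =
          of_nat n * (?Q i * ?H (n - i))"
        by (simp flip: distrib_right)
    qed
    finally have "of_nat n * euler (?H n) = of_nat n * (\<Sum>i=1..n. ?Q i * ?H (n - i))"
      by (simp add: sum_distrib_left)
    then show ?thesis
      by (rule of_nat_mult_cancel) (use False in simp)
  qed
qed

text \<open>Since \<open>Exp\<^sub>\<sigma>(F) = exp (\<Sum>\<^sub>i (p\<^sub>i \<circ> F) / i)\<close>, its logarithmic derivative is integral.\<close>

lemma euler_Exp:
  assumes F: "F \<in> sym_series" "mcoeff F 0 = 0"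
  shows "eqdeg n (euler (Exp_sigma F)) (Exp_sigma F * (\<Sum>i=1..n. adams i (euler F)))"
proof -
  let ?H = "\<lambda>k. plethysm (hcomp k) F" and ?Q = "\<lambda>i. adams i (euler F)"
  have Q: "ordge i (?Q i)" if "i \<ge> 1" for i
    using F(2) that by (intro ordge_adams) (simp_all add: mcoeff_euler)
  have "eqdeg n (euler (Exp_sigma F)) (\<Sum>k\<le>n. euler (?H k))"
    using eqdeg_euler[OF eqdeg_Exp[OF F]] by (simp add: euler_sum)
  also have "(\<Sum>k\<le>n. euler (?H k)) = (\<Sum>(k, i)\<in>(SIGMA k:{..n}. {1..k}). ?H (k - i) * ?Q i)"
    by (simp add: euler_plethysm_hcomp[OF F] sum.Sigma mult.commute)
  also have "\<dots> = (\<Sum>(j, i)\<in>{(j, i) \<in> {..n} \<times> {1..n}. j + i \<le> n}. ?H j * ?Q i)"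
    by (rule sum.reindex_bij_witness[where i = "\<lambda>(j, i). (j + i, i)" and j = "\<lambda>(k, i). (k - i, i)"])
      auto
  \<comment> \<open>Completing the triangle to a square adds only products of order above
    \<open>n\<close>, and the square factors.\<close>
  also have "eqdeg n \<dots> (\<Sum>(j, i)\<in>{..n} \<times> {1..n}. ?H j * ?Q i)"
  proof (rule eqdeg_sum_superset)
    fix x assume "x \<in> {..n} \<times> {1..n} - {(j, i) \<in> {..n} \<times> {1..n}. j + i \<le> n}"
    then obtain j i where x: "x = (j, i)" "i \<ge> 1" "Suc n \<le> j + i"
      by (cases x) auto
    have "ordge (j + i) (?H j * ?Q i)"
      using x by (intro ordge_mult ordge_plethysm_hcomp F Q)
    then show "ordge (Suc n) (case x of (j, i) \<Rightarrow> ?H j * ?Q i)"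
      using x by (auto elim: ordge_mono)
  qed auto
  also have "(\<Sum>(j, i)\<in>{..n} \<times> {1..n}. ?H j * ?Q i) = (\<Sum>j\<le>n. ?H j) * (\<Sum>i=1..n. ?Q i)"
    by (simp add: sum_product sum.cartesian_product)
  also have "eqdeg n \<dots> (Exp_sigma F * (\<Sum>i=1..n. ?Q i))"
    by (intro eqdeg_mult eqdeg_refl eqdeg_sym[OF eqdeg_Exp[OF F]])
  finally show ?thesis .
qed

lemma symfun_rat_cancel:
  assumes "of_nat k * (x :: rat symfun) = 0" "k > 0"
  shows "x = 0"
proof -
  have "mcoeff (mps_of_symfun (of_nat k * x)) m = 0" for m
    by (simp only: assms(1)) (simp add: mps_of_symfun_simps)
  then have "of_nat k * mcoeff (mps_of_symfun x) m = 0" for m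
    by (simp only: mcoeff_symfun_of_nat_mult)
  with assms(2) have "mcoeff (mps_of_symfun x) m = 0" for m
    by simp
  then show ?thesis
    by (simp add: mps_of_symfun_simps mps_eqI flip: mps_of_symfun_inject)
qed

text \<open>\<open>X\<close> is a truncation of the common logarithmic derivative and may depend on
  \<open>n\<close>. If \<open>F - G\<close> has order at least \<open>n + 1\<close>, then
  \<open>(F - G) * X\<close> has order at least \<open>n + 2\<close>, so \<open>n + 1\<close> times
  the part of \<open>F - G\<close> in degree \<open>n + 1\<close> vanishes.\<close>

lemma euler_unique:
  fixes F G :: "rat symfun mps"
  assumes "mcoeff F 0 = mcoeff G 0"
    and "\<And>n. \<exists>X. mcoeff X 0 = 0 \<and> eqdeg n (euler F) (F * X) \<and> eqdeg n (euler G) (G * X)"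
  shows "F = G"
proof (rule eqdeg_imp_eq)
  fix n
  show "eqdeg n F G"
  proof (induction n)
    case 0
    then show ?case
      using assms(1) by (simp add: eqdeg_def mdeg_eq_0_iff)
  next
    case (Suc n)
    obtain X where X: "mcoeff X 0 = 0" "eqdeg (Suc n) (euler F) (F * X)" "eqdeg (Suc n) (euler G) (G * X)"
      using assms(2) by blast
    have FG: "ordge (Suc n) (F - G)"
      using Suc by (simp add: ordge_def eqdeg_def)
    have "ordge (Suc n + Suc 0) ((F - G) * X)"
      by (rule ordge_mult[OF FG]) (use X(1) in \<open>simp add: ordge_1_iff\<close>)
    moreover have "eqdeg (Suc n) (euler (F - G)) ((F - G) * X)"
      using eqdeg_diff[OF X(2,3)] by (simp add: euler_diff left_diff_distrib)
    ultimately have c: "of_nat (mdeg m) * mcoeff (F - G) m = 0" if "mdeg m \<le> Suc n" for m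
      using that by (simp add: eqdeg_def ordge_def mcoeff_euler)
    have top: "mcoeff (F - G) m = 0" if m: "mdeg m = Suc n" for m
    proof (rule symfun_rat_cancel)
      show "of_nat (mdeg m) * mcoeff (F - G) m = 0"
        by (rule c) (simp add: m)
    qed (simp add: m)
    have "mcoeff F m = mcoeff G m" if "mdeg m \<le> Suc n" for m
    proof (cases "mdeg m = Suc n")
      case True
      then show ?thesis
        using top[of m] by simp
    next
      case False
      then show ?thesis
        using that Suc by (simp add: eqdeg_def)
    qed
    then show ?case
      by (simp add: eqdeg_def)
  qed
qed

subsection \<open>Infinite products of series in the power sums\<close>

lemma eqdeg_prod:
  fixes F :: "'b \<Rightarrow> 'a::{comm_ring, comm_monoid_mult} mps"
  shows "(\<And>x. x \<in> A \<Longrightarrow> eqdeg n (F x) (G x)) \<Longrightarrow> eqdeg n (prod F A) (prod G A)"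
  by (induction A rule: infinite_finite_induct) (auto intro: eqdeg_mult)

lemma eqdeg_prodinf:
  fixes F :: "nat \<Rightarrow> 'a::{comm_ring, comm_monoid_mult} mps"
  assumes "\<And>i. i \<ge> 1 \<Longrightarrow> ordge i (F i - 1)"
  shows "eqdeg n (mps_prodinf F) (\<Prod>i=1..n. F i)"
  unfolding mps_prodinf_def
proof (rule eqdeg_mps_lim)
  fix n k :: nat
  assume "n \<le> k"
  then show "eqdeg n (\<Prod>i=1..k. F i) (\<Prod>i=1..n. F i)"
  proof (induction k rule: dec_induct)
    case (step k)
    have "ordge (Suc k) (F (Suc k) - 1)"
      by (rule assms) simp
    with step have "eqdeg n (F (Suc k)) 1"
      by (auto simp: ordge_def eqdeg_def)
    then have "eqdeg n ((\<Prod>i=1..k. F i) * F (Suc k)) ((\<Prod>i=1..n. F i) * 1)"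
      by (intro eqdeg_mult step.IH)
    then show ?case
      by simp
  qed simp
qed

lemma ordge_const_mult: "ordge n F \<Longrightarrow> ordge n (mps_const c * F)" for F :: "'a::comm_ring mps"
  by (simp add: ordge_def mcoeff_const_mult)

lemma eqdeg_fps_subst:
  fixes G :: "'a::{comm_ring, comm_monoid_mult} mps"
  assumes "ordge (Suc 0) G"
  shows "eqdeg n (fps_subst_mps \<gamma> G) (\<Sum>k\<le>n. mps_const (fps_nth \<gamma> k) * G ^ k)"
  unfolding fps_subst_mps_def
  by (intro eqdeg_suminf ordge_const_mult) (use ordge_power[OF assms] in simp)

lemma ordge_fps_subst:
  fixes G :: "'a::{comm_ring, comm_monoid_mult} mps"
  assumes "ordge i G" "i \<ge> 1" "fps_nth \<gamma> 0 = 1"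
  shows "ordge i (fps_subst_mps \<gamma> G - 1)"
  unfolding ordge_def
proof (intro allI impI)
  fix m assume m: "mdeg m < i"
  have "eqdeg (mdeg m) (fps_subst_mps \<gamma> G) (\<Sum>k\<le>mdeg m. mps_const (fps_nth \<gamma> k) * G ^ k)"
    by (intro eqdeg_fps_subst ordge_mono[OF assms(1)]) (use assms in simp)
  also have "eqdeg (mdeg m) (\<Sum>k\<le>mdeg m. mps_const (fps_nth \<gamma> k) * G ^ k)
      (\<Sum>k\<in>{0}. mps_const (fps_nth \<gamma> k) * G ^ k)"
  proof (rule eqdeg_sym, rule eqdeg_sum_superset)
    fix k assume "k \<in> {..mdeg m} - {0}"
    then have "i * 1 \<le> i * k"
      by (intro mult_le_mono2) auto
    with m have "Suc (mdeg m) \<le> i * k"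
      by linarith
    then show "ordge (Suc (mdeg m)) (mps_const (fps_nth \<gamma> k) * G ^ k)"
      by (intro ordge_const_mult ordge_mono[OF ordge_power[OF assms(1)]])
  qed auto
  finally show "mcoeff (fps_subst_mps \<gamma> G - 1) m = 0"
    using assms(3) by (simp add: eqdeg_def unital_hom.hom_one[OF unital_hom_mps_const])
qed

lemma mps_const_of_nat: "mps_const (of_nat k :: 'a::comm_ring_1) = of_nat k"
  by (rule unital_hom_of_nat[OF unital_hom_mps_const])

text \<open>
  The recurrence says that \<open>\<gamma>\<close> satisfies \<open>(1 + c X) \<gamma>' = x \<gamma>\<close>:  for \<open>c = 0\<close> it is solved by
  \<open>\<gamma> = exp (x X)\<close>, for \<open>c = 1\<close> by \<open>\<gamma> = (1 + X)\<^sup>x\<close>.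
\<close>

lemma euler_fps_subst:
  fixes \<gamma> :: "'a::comm_ring_1 fps"
  assumes i: "i \<ge> 1"
    and rec: "\<And>k. of_nat (Suc k) * fps_nth \<gamma> (Suc k) + c * of_nat k * fps_nth \<gamma> k = x * fps_nth \<gamma> k"
  shows "(1 + mps_const c * psum_mps i) * euler (fps_subst_mps \<gamma> (psum_mps i)) =
    of_nat i * mps_const x * psum_mps i * fps_subst_mps \<gamma> (psum_mps i)"
proof (rule eqdeg_imp_eq)
  fix n
  let ?p = "psum_mps i :: 'a mps"
  let ?c = "\<lambda>k. mps_const (fps_nth \<gamma> k) :: 'a mps"
  interpret C: unital_hom "mps_const :: 'a \<Rightarrow> 'a mps"
    by (rule unital_hom_mps_const)
  have p: "ordge (Suc 0) ?p"
    using ordge_mono[OF ordge_psum_mps] i by fastforce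
  have rec': "of_nat (Suc k) * ?c (Suc k) + mps_const c * of_nat k * ?c k = mps_const x * ?c k" for k
    using arg_cong[OF rec[of k], of mps_const]
    by (simp add: C.hom_add C.hom_mult mps_const_of_nat C.hom_one)
  have e: "euler (?c k * ?p ^ k) = of_nat i * (of_nat k * ?c k * ?p ^ k)" for k
  proof (cases k)
    case 0
    then show ?thesis
      using euler_const_mult[of "fps_nth \<gamma> 0" 1] by (simp add: euler_one)
  next
    case (Suc l)
    show ?thesis
      unfolding Suc euler_const_mult euler_power euler_psum_mps
      by (simp only: power_Suc mult_ac)
  qed
  \<comment> \<open>The recurrence telescopes over partial sums; the remaining boundary term
    contains \<open>?p ^ Suc N\<close> and is invisible up to degree \<open>N\<close>.\<close>
  have tele: "(1 + mps_const c * ?p) * (\<Sum>k\<le>N. of_nat k * ?c k * ?p ^ k) =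
      mps_const x * ?p * (\<Sum>k\<le>N. ?c k * ?p ^ k) - of_nat (Suc N) * ?c (Suc N) * ?p ^ Suc N" for N
  proof (induction N)
    case 0
    show ?case
      using rec'[of 0] by simp
  next
    case (Suc N)
    have "mps_const c * ?p * (of_nat (Suc N) * ?c (Suc N) * ?p ^ Suc N) =
        (mps_const x * ?c (Suc N) - of_nat (Suc (Suc N)) * ?c (Suc (Suc N))) * ?p ^ Suc (Suc N)"
      unfolding rec'[of "Suc N", symmetric] by (simp add: algebra_simps del: of_nat_Suc)
    with Suc show ?case
      by (simp add: algebra_simps del: of_nat_Suc)
  qed
  have "eqdeg n ((1 + mps_const c * ?p) * euler (fps_subst_mps \<gamma> ?p))
      ((1 + mps_const c * ?p) * euler (\<Sum>k\<le>n. ?c k * ?p ^ k))"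
    by (intro eqdeg_mult eqdeg_refl eqdeg_euler eqdeg_fps_subst p)
  also have "\<dots> = of_nat i * mps_const x * ?p * (\<Sum>k\<le>n. ?c k * ?p ^ k) -
      of_nat i * (of_nat (Suc n) * ?c (Suc n) * ?p ^ Suc n)"
  proof -
    have "euler (\<Sum>k\<le>n. ?c k * ?p ^ k) = of_nat i * (\<Sum>k\<le>n. of_nat k * ?c k * ?p ^ k)"
      by (simp only: euler_sum e sum_distrib_left)
    then have "(1 + mps_const c * ?p) * euler (\<Sum>k\<le>n. ?c k * ?p ^ k) =
        of_nat i * ((1 + mps_const c * ?p) * (\<Sum>k\<le>n. of_nat k * ?c k * ?p ^ k))"
      by (simp only: mult.left_commute)
    then show ?thesis
      unfolding tele by (simp only: right_diff_distrib mult.assoc)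
  qed
  also have "eqdeg n \<dots> (of_nat i * mps_const x * ?p * fps_subst_mps \<gamma> ?p - 0)"
  proof (intro eqdeg_diff eqdeg_mult eqdeg_refl eqdeg_sym[OF eqdeg_fps_subst[OF p]])
    have "ordge (0 + (0 + Suc n)) (of_nat i * (of_nat (Suc n) * ?c (Suc n) * ?p ^ Suc n))"
      using ordge_power[OF p, of "Suc n"] by (intro ordge_mult ordge_0) simp
    then show "eqdeg n (of_nat i * (of_nat (Suc n) * ?c (Suc n) * ?p ^ Suc n)) 0"
      by (simp add: ordge_def eqdeg_def)
  qed
  finally show "eqdeg n ((1 + mps_const c * ?p) * euler (fps_subst_mps \<gamma> ?p))
      (of_nat i * mps_const x * ?p * fps_subst_mps \<gamma> ?p)"
    by simp
qed

lemma euler_prod: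
  fixes G :: "nat \<Rightarrow> 'a::comm_ring_1 mps"
  assumes "finite A" "\<And>i. i \<in> A \<Longrightarrow> euler (G i) = G i * Y i"
  shows "euler (prod G A) = prod G A * sum Y A"
  using assms
  by (induction A rule: finite_induct) (simp_all add: euler_one euler_mult algebra_simps)

lemma euler_prodinf:
  fixes G :: "nat \<Rightarrow> 'a::comm_ring_1 mps"
  assumes "\<And>i. i \<ge> 1 \<Longrightarrow> ordge i (G i - 1)" "\<And>i. i \<ge> 1 \<Longrightarrow> euler (G i) = G i * Y i"
  shows "eqdeg n (euler (mps_prodinf G)) (mps_prodinf G * (\<Sum>i=1..n. Y i))"
proof -
  have "eqdeg n (euler (mps_prodinf G)) (euler (\<Prod>i=1..n. G i))"
    by (intro eqdeg_euler eqdeg_prodinf assms(1))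
  also have "\<dots> = (\<Prod>i=1..n. G i) * (\<Sum>i=1..n. Y i)"
    by (intro euler_prod assms(2)) auto
  also have "eqdeg n \<dots> (mps_prodinf G * (\<Sum>i=1..n. Y i))"
    by (intro eqdeg_mult eqdeg_refl eqdeg_sym[OF eqdeg_prodinf] assms(1))
  finally show ?thesis .
qed

text \<open>The difference of \<open>F\<close> and \<open>G\<close> equals minus \<open>p\<close>
  times itself, so its order can be raised indefinitely.\<close>

lemma one_plus_mult_cancel:
  fixes p F G :: "'a::comm_ring_1 mps"
  assumes "(1 + p) * F = (1 + p) * G" "ordge (Suc 0) p"
  shows "F = G"
proof -
  have eq: "F - G = - (p * (F - G))"
    using assms(1) by (simp add: algebra_simps)
  have "ordge n (F - G)" for n
  proof (induction n)
    case (Suc n)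
    have "ordge (Suc 0 + n) (p * (F - G))"
      by (rule ordge_mult[OF assms(2) Suc])
    then have "ordge (Suc n) (- (p * (F - G)))"
      by (simp add: ordge_def)
    then show ?case
      by (simp only: eq[symmetric])
  qed simp
  then have "mcoeff (F - G) m = 0" for m
    unfolding ordge_def by blast
  then show ?thesis
    by (intro mps_eqI) simp
qed

subsection \<open>Moebius inversion for the cycle counting functions\<close>

lemma moebius_mu_prime_mult:
  assumes "prime p" "\<not> p dvd d" "d > 0"
  shows "moebius_mu (p * d) = - moebius_mu d"
proof -
  have cop: "coprime p d"
    using assms by (simp add: prime_imp_coprime)
  have "prime_factors (p * d) = insert p (prime_factors d)"
    using assms by (simp add: prime_factorization_mult prime_factorization_prime)
  moreover have "p \<notin> prime_factors d"
    using assms by auto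
  moreover have "squarefree (p * d) \<longleftrightarrow> squarefree d"
    using cop assms(1) squarefree_mult_coprime[of p d] squarefree_prime[of p] squarefree_multD[of p d]
    by blast
  ultimately show ?thesis
    by (simp add: moebius_mu_def)
qed

text \<open>Fix a prime \<open>p\<close> dividing \<open>n\<close>. A divisor prime to
  \<open>p\<close> cancels against its multiple by \<open>p\<close>, and the remaining divisors are
  divisible by the square of \<open>p\<close>.\<close>

lemma sum_moebius_mu:
  assumes "n > 0"
  shows "(\<Sum>d | d dvd n. moebius_mu d) = (if n = 1 then 1 else 0)"
proof (cases "n = 1")
  case True
  then show ?thesis by (simp add: moebius_mu_def)
next
  case False
  then obtain p where p: "prime p" "p dvd n"
    using prime_factor_nat[OF False] by blast
  let ?A = "{d. d dvd n \<and> \<not> p dvd d}" and ?B = "{d. d dvd n \<and> p dvd d}"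
  have fin: "finite {d. d dvd n \<and> P d}" for P
    by (rule finite_subset[of _ "{d. d dvd n}"]) (use assms in auto)
  have "(\<Sum>d | d dvd n. moebius_mu d) = sum moebius_mu (?A \<union> ?B)"
    by (rule sum.cong) auto
  also have "\<dots> = sum moebius_mu ?A + sum moebius_mu ?B"
    by (rule sum.union_disjoint) (use fin in auto)
  also have "sum moebius_mu ?B = sum moebius_mu ((*) p ` ?A)"
  proof (rule sum.mono_neutral_right[OF fin])
    show "(*) p ` ?A \<subseteq> ?B"
      using p by (auto intro!: divides_mult simp: prime_imp_coprime)
    show "\<forall>d\<in>?B - (*) p ` ?A. moebius_mu d = 0"
    proof
      fix d assume d: "d \<in> ?B - (*) p ` ?A"
      then obtain e where e: "d = p * e" by auto
      have "e dvd n"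
        using d e dvd_mult_right by blast
      with d e have "p dvd e" by blast
      with e have "p\<^sup>2 dvd d"
        by (auto simp: power2_eq_square)
      with p have "\<not> squarefree d"
        using not_squarefreeI[of p d] by (simp add: prime_nat_iff)
      then show "moebius_mu d = 0"
        by (simp add: moebius_mu_def)
    qed
  qed
  also have "\<dots> = (\<Sum>d\<in>?A. moebius_mu (p * d))"
    using p by (subst sum.reindex) (auto simp: inj_on_def)
  also have "\<dots> = (\<Sum>d\<in>?A. - moebius_mu d)"
  proof (rule sum.cong[OF refl])
    fix d assume "d \<in> ?A"
    then show "moebius_mu (p * d) = - moebius_mu d"
      using p assms by (intro moebius_mu_prime_mult) (auto intro: dvd_pos_nat)
  qed
  finally show ?thesis
    using False by (simp add: sum_negf)
qed

lemma of_nat_mult_scaleQ: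
  "of_nat n * (x :: 'a::{comm_ring_1, rat_algebra}) = of_nat n *\<^sub>Q x"
proof -
  interpret vector_space "scaleQ :: rat \<Rightarrow> 'a \<Rightarrow> 'a"
    by (rule vector_space_scaleQ)
  show ?thesis
    by (induction n) (simp_all add: distrib_right scaleQ_add_left scaleQ_one)
qed

lemma of_nat_mult_cyc_count:
  assumes "i > 0"
  shows "of_nat i * cyc_count i = (\<Sum>d | d dvd i. of_int (moebius_mu (i div d)) * psum d)"
  using assms by (simp add: cyc_count_def of_nat_mult_scaleQ scaleQ_scaleQ scaleQ_one)

text \<open>Moebius inversion. In terms of permutations, \<open>p_k\<close> counts the points fixed
  by the \<open>k\<close>-th power, and a cycle of length \<open>i\<close> contributes
  \<open>i\<close> such points exactly if \<open>i\<close> divides \<open>k\<close>.\<close>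

lemma sum_cyc_count:
  assumes "k > 0"
  shows "(\<Sum>i | i dvd k. of_nat i * cyc_count i) = psum k"
proof -
  let ?f = "\<lambda>i d. of_int (moebius_mu (i div d)) * psum d :: rat symfun"
  have fin: "finite {d. d dvd k}"
    using assms by simp
  have "(\<Sum>i | i dvd k. of_nat i * cyc_count i) = (\<Sum>i\<in>{i. i dvd k}. \<Sum>d | d \<in> {d. d dvd k} \<and> d dvd i. ?f i d)"
  proof (rule sum.cong[OF refl])
    fix i assume i: "i \<in> {i. i dvd k}"
    then have "i > 0" "{d. d \<in> {d. d dvd k} \<and> d dvd i} = {d. d dvd i}"
      using assms by (auto intro: dvd_trans)
    then show "of_nat i * cyc_count i = (\<Sum>d | d \<in> {d. d dvd k} \<and> d dvd i. ?f i d)"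
      by (simp add: of_nat_mult_cyc_count)
  qed
  also have "\<dots> = (\<Sum>d\<in>{d. d dvd k}. \<Sum>i | i \<in> {i. i dvd k} \<and> d dvd i. ?f i d)"
    by (rule sum.swap_restrict) (use fin in auto)
  also have "\<dots> = (\<Sum>d\<in>{d. d dvd k}. if d = k then psum d else 0)"
  proof (rule sum.cong[OF refl])
    fix d assume d: "d \<in> {d. d dvd k}"
    then obtain q where q: "k = d * q" by auto
    with assms have "d > 0" "q > 0" by auto
    have "(\<Sum>i | i \<in> {i. i dvd k} \<and> d dvd i. ?f i d) = (\<Sum>e | e dvd q. of_int (moebius_mu e) * psum d)"
      by (rule sum.reindex_bij_witness[where i = "\<lambda>e. d * e" and j = "\<lambda>i. i div d"])
        (use \<open>d > 0\<close> q in auto)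
    also have "\<dots> = of_int (\<Sum>e | e dvd q. moebius_mu e) * psum d"
      by (simp add: sum_distrib_right)
    also have "\<dots> = (if d = k then psum d else 0)"
      using \<open>d > 0\<close> \<open>q > 0\<close> by (simp add: sum_moebius_mu q)
    finally show "(\<Sum>i | i \<in> {i. i dvd k} \<and> d dvd i. ?f i d) = (if d = k then psum d else 0)" .
  qed
  also have "\<dots> = psum k"
    using fin by (simp add: sum.delta)
  finally show ?thesis .
qed

subsection \<open>The two generating functions over the rationals\<close>

lemma hcomp_mps_1: "(hcomp_mps (Suc 0) :: 'a::{zero, one} mps) = psum_mps (Suc 0)"
proof (rule mps_eqI)
  fix m
  have "mdeg m = Suc 0 \<longleftrightarrow> (\<exists>j. m = Poly_Mapping.single j (Suc 0))"
  proof
    assume m: "mdeg m = Suc 0"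
    then have "m \<noteq> 0" by auto
    then obtain j where "Poly_Mapping.lookup m j \<noteq> 0"
      by (metis lookup_zero poly_mapping_eqI)
    then have j: "Suc 0 \<le> Poly_Mapping.lookup m j" by simp
    then have "mdeg (m - Poly_Mapping.single j (Suc 0)) = 0"
      using mdeg_minus_single[OF j] m by simp
    then have "m = Poly_Mapping.single j (Suc 0)"
      using mono_minus_single_add[OF j] by (simp add: mdeg_eq_0_iff)
    then show "\<exists>j. m = Poly_Mapping.single j (Suc 0)" ..
  qed auto
  then show "mcoeff (hcomp_mps (Suc 0) :: 'a mps) m = mcoeff (psum_mps (Suc 0)) m"
    by (simp add: hcomp_mps_def psum_mps_def)
qed

lemma hcomp_1: "(hcomp 1 :: int symfun) = psum 1"
  by transfer (simp add: hcomp_mps_1)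

lemma sym_series_psum_mps: "(psum_mps i :: 'a::{zero, one} mps) \<in> sym_series"
  using mps_of_symfun[of "psum i :: 'a symfun"] by (simp add: psum.rep_eq)

lemma sym_series_const: "mps_const c \<in> sym_series"
proof -
  have "Poly_Mapping.map_key \<pi> m = 0 \<longleftrightarrow> m = 0" if "bij \<pi>" for \<pi> :: "nat \<Rightarrow> nat" and m :: monom
    using mdeg_map_key[OF that, of m] by (metis mdeg_eq_0_iff)
  then show ?thesis
    by (simp add: sym_series_def mcoeff_mps_const)
qed

lemma mcoeff_psum_mps_0: "i \<ge> 1 \<Longrightarrow> mcoeff (psum_mps i :: 'a::{zero, one} mps) 0 = 0"
  using ordgeD[OF ordge_psum_mps[of i], of 0] by simp

lemma adams_const_mult:
  assumes "i \<ge> 1"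
  shows "adams i (mps_const (psum 1) * F) = mps_const (psum i) * adams i F"
proof -
  interpret unital_hom "adams i"
    by (rule unital_hom_adams[OF assms])
  have "adams i (mps_const (psum 1)) = mps_const (psum i)"
    unfolding adams_def
    by (rule mps_vars_pow_eqI[OF assms])
      (use assms in \<open>auto simp: mcoeff_mps_const symfun_vars_pow_psum\<close>)
  then show ?thesis
    by (simp only: hom_mult)
qed

lemma adams_psum_mps:
  assumes "i \<ge> 1"
  shows "adams i (psum_mps k) = psum_mps (i * k)"
proof -
  interpret unital_hom "symfun_vars_pow i :: int symfun \<Rightarrow> int symfun"
    by (rule unital_hom_symfun_vars_pow[OF assms])
  have "mps_map (symfun_vars_pow i) (psum_mps k :: int symfun mps) = psum_mps k"
    by (rule mps_eqI) (simp add: psum_mps_def hom_one)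
  then show ?thesis
    using assms by (simp add: adams_def mps_vars_pow_psum_mps)
qed

lemma symfun_of_int_psum: "symfun_of_int (psum i) = psum i"
  by transfer (rule mps_eqI, simp add: psum_mps_def)

abbreviation ratify :: "int symfun mps \<Rightarrow> rat symfun mps" where
  "ratify \<equiv> mps_map symfun_of_int"

lemma unital_hom_ratify: "unital_hom ratify"
  by (intro unital_hom_mps_map unital_hom_symfun_of_int)

lemma ratify_psum_mps: "ratify (psum_mps i) = psum_mps i"
  by (rule mps_eqI)
    (simp add: psum_mps_def unital_hom.hom_one[OF unital_hom_symfun_of_int]
      unital_hom.hom_zero[OF unital_hom_symfun_of_int])

lemma ratify_const: "ratify (mps_const c) = mps_const (symfun_of_int c)"
  by (rule mps_eqI) (simp add: mcoeff_mps_const unital_hom.hom_zero[OF unital_hom_symfun_of_int])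

lemma eqdeg_map: "eqdeg n F G \<Longrightarrow> eqdeg n (mps_map g F) (mps_map g G)"
  by (simp add: eqdeg_def)

text \<open>The common frame for both generating functions. The factors enter through their
  logarithmic derivatives \<open>Y i\<close>, and \<open>euler_unique\<close> is applied with the
  partial sums of these. The passage to rational coefficients happens here because the factors have
  denominators.\<close>

lemma ratify_Exp_eq_prodinf:
  assumes F: "F \<in> sym_series" "mcoeff F 0 = 0"
    and \<gamma>: "\<And>i. i \<ge> 1 \<Longrightarrow> fps_nth (\<gamma> i) 0 = 1"
    and Y: "\<And>i. i \<ge> 1 \<Longrightarrow> euler (fps_subst_mps (\<gamma> i) (psum_mps i)) = fps_subst_mps (\<gamma> i) (psum_mps i) * Y i"
    and Y0: "\<And>i. i \<ge> 1 \<Longrightarrow> mcoeff (Y i) 0 = 0"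
    and eq: "\<And>n. eqdeg n (\<Sum>i=1..n. Y i) (ratify (\<Sum>i=1..n. adams i (euler F)))"
  shows "ratify (Exp_sigma F) = mps_prodinf (\<lambda>i. fps_subst_mps (\<gamma> i) (psum_mps i))"
proof (rule euler_unique)
  let ?G = "\<lambda>i. fps_subst_mps (\<gamma> i) (psum_mps i)"
  have ord: "ordge i (?G i - 1)" if "i \<ge> 1" for i
    by (rule ordge_fps_subst[OF ordge_psum_mps that \<gamma>[OF that]])
  show "mcoeff (ratify (Exp_sigma F)) 0 = mcoeff (mps_prodinf ?G) 0"
    using eqdegD[OF eqdeg_prodinf[OF ord, of 0], of 0]
    by (simp add: mcoeff_Exp_0[OF F] mcoeff_one unital_hom.hom_one[OF unital_hom_symfun_of_int])
  fix n
  interpret r: unital_hom ratify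
    by (rule unital_hom_ratify)
  have "eqdeg n (euler (ratify (Exp_sigma F))) (ratify (Exp_sigma F * (\<Sum>i=1..n. adams i (euler F))))"
    unfolding euler_map[OF unital_hom_symfun_of_int] by (intro eqdeg_map euler_Exp[OF F])
  also have "\<dots> = ratify (Exp_sigma F) * ratify (\<Sum>i=1..n. adams i (euler F))"
    by (rule r.hom_mult)
  also have "eqdeg n \<dots> (ratify (Exp_sigma F) * (\<Sum>i=1..n. Y i))"
    by (intro eqdeg_mult eqdeg_refl eqdeg_sym[OF eq])
  finally have "eqdeg n (euler (ratify (Exp_sigma F))) (ratify (Exp_sigma F) * (\<Sum>i=1..n. Y i))" .
  moreover have "eqdeg n (euler (mps_prodinf ?G)) (mps_prodinf ?G * (\<Sum>i=1..n. Y i))"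
    by (rule euler_prodinf[OF ord Y])
  moreover have "mcoeff (\<Sum>i=1..n. Y i) 0 = 0"
    using Y0 by (simp add: mcoeff_sum)
  ultimately show "\<exists>X. mcoeff X 0 = 0 \<and>
      eqdeg n (euler (ratify (Exp_sigma F))) (ratify (Exp_sigma F) * X) \<and>
      eqdeg n (euler (mps_prodinf ?G)) (mps_prodinf ?G * X)"
    by blast
qed

lemma mult_scaleQ_right: "x * (a *\<^sub>Q y) = a *\<^sub>Q (x * y)" for x y :: "'a::rat_algebra"
  by (simp add: mult.commute[of x] mult_scaleQ_left)

lemma scaleQ_power: "(a *\<^sub>Q x) ^ k = a ^ k *\<^sub>Q x ^ k" for x :: "'a::rat_algebra"
  by (induction k) (simp_all add: scaleQ_one mult_scaleQ_left mult_scaleQ_right scaleQ_scaleQ mult.commute)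

lemma scaleQ_0 [simp]: "a *\<^sub>Q (0 :: 'a::rat_algebra) = 0"
  using scaleQ_add_right[of a "0 :: 'a" 0] by simp

lemma divided_power_rec:
  fixes x :: "rat symfun"
  shows "of_nat (Suc k) * ((1 / fact (Suc k)) *\<^sub>Q x ^ Suc k) = x * ((1 / fact k) *\<^sub>Q x ^ k)"
proof -
  have fact: "1 / fact (Suc k) * rat_of_nat (Suc k) = 1 / fact k"
    by (simp add: divide_simps)
  show ?thesis
    by (simp only: of_nat_mult_scaleQ[where 'a = "rat symfun"] scaleQ_scaleQ fact mult_scaleQ_right power_Suc)
qed

text \<open>The exponent \<open>p_1(s) p_1(t)\<close> is homogeneous of degree 1 in
  \<open>t\<close>, so it is its own derivative, and \<open>adams i\<close> turns it into
  \<open>p_i(s) p_i(t)\<close>. This is also the logarithmic derivative of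
  \<open>exp(p_i(s) p_i(t) / i)\<close>.\<close>

lemma SMG_series:
  "ratify (Exp_sigma (mps_const (hcomp 1) * hcomp_mps 1)) =
    mps_prodinf (\<lambda>i. fps_subst_mps
      (Abs_fps (\<lambda>k. (1 / fact k) *\<^sub>Q ((1 / of_nat i) *\<^sub>Q psum i) ^ k)) (psum_mps i))"
proof (rule ratify_Exp_eq_prodinf)
  let ?F = "mps_const (hcomp 1) * hcomp_mps 1 :: int symfun mps"
  have F: "?F = mps_const (psum 1) * psum_mps 1"
    unfolding hcomp_1 by (simp only: hcomp_mps_1 One_nat_def)
  show "?F \<in> sym_series"
    unfolding F by (intro sym_series_mult sym_series_const sym_series_psum_mps)
  show "mcoeff ?F 0 = 0"
    unfolding F by (simp add: mcoeff_const_mult mcoeff_psum_mps_0)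
  interpret C: unital_hom "mps_const :: rat symfun \<Rightarrow> rat symfun mps"
    by (rule unital_hom_mps_const)
  have eF: "euler ?F = ?F"
    unfolding F euler_const_mult euler_psum_mps by simp
  interpret r: unital_hom ratify
    by (rule unital_hom_ratify)
  show "eqdeg n (\<Sum>i=1..n. mps_const (psum i) * psum_mps i) (ratify (\<Sum>i=1..n. adams i (euler ?F)))" for n
    unfolding eF unfolding F
    by (simp add: r.hom_sum adams_const_mult[unfolded One_nat_def] adams_psum_mps r.hom_mult ratify_psum_mps
        ratify_const symfun_of_int_psum)
  fix i :: nat assume i: "i \<ge> 1"
  show "mcoeff (mps_const (psum i) * psum_mps i) (0 :: monom) = (0 :: rat symfun)"
    using i by (simp add: mcoeff_const_mult mcoeff_psum_mps_0)
  let ?x = "(1 / of_nat i) *\<^sub>Q psum i :: rat symfun"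
  let ?\<gamma> = "Abs_fps (\<lambda>k. (1 / fact k) *\<^sub>Q ?x ^ k)"
  show "fps_nth ?\<gamma> 0 = 1"
    by (simp add: scaleQ_one)
  have rec: "of_nat (Suc k) * fps_nth ?\<gamma> (Suc k) + 0 * of_nat k * fps_nth ?\<gamma> k = ?x * fps_nth ?\<gamma> k" for k
    by (simp only: fps_nth_Abs_fps mult_zero_left add_0_right divided_power_rec)
  have "of_nat i * ?x = psum i"
    using i by (simp add: of_nat_mult_scaleQ scaleQ_scaleQ scaleQ_one)
  then have c: "of_nat i * mps_const ?x = mps_const (psum i)"
    by (simp only: C.hom_mult[symmetric] mps_const_of_nat[symmetric])
  have "euler (fps_subst_mps ?\<gamma> (psum_mps i)) =
      mps_const (psum i) * psum_mps i * fps_subst_mps ?\<gamma> (psum_mps i)"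
    using euler_fps_subst[OF i rec] unfolding c C.hom_zero mult_zero_left add_0_right mult_1_left .
  then show "euler (fps_subst_mps ?\<gamma> (psum_mps i)) =
      fps_subst_mps ?\<gamma> (psum_mps i) * (mps_const (psum i) * psum_mps i)"
    by (simp only: mult_ac)
qed

lemma symfun_binomial_0 [simp]: "symfun_binomial x 0 = 1"
  by (simp add: symfun_binomial_def scaleQ_one)

text \<open>Arranged to match the recurrence of \<open>euler_fps_subst\<close>; the explicit factor
  \<open>1\<close> is the parameter \<open>c\<close>.\<close>

lemma symfun_binomial_rec:
  "of_nat (Suc k) * symfun_binomial x (Suc k) + 1 * of_nat k * symfun_binomial x k = x * symfun_binomial x k"
proof -
  have "rat_of_nat (Suc k) * (1 / fact (Suc k)) = 1 / fact k"
    by (simp add: divide_simps)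
  then have "of_nat (Suc k) * symfun_binomial x (Suc k) = (x - of_nat k) * symfun_binomial x k"
    by (simp add: symfun_binomial_def of_nat_mult_scaleQ scaleQ_scaleQ mult_scaleQ_right mult.commute
        del: of_nat_Suc fact_Suc)
  then show ?thesis
    by (simp add: algebra_simps)
qed

text \<open>Let \<open>M\<close> be the derivative of \<open>Log_sigma (1 + p_1)\<close> and
  \<open>S\<close> the sum of all \<open>adams k M\<close>, so \<open>S = p_1 / (1 + p_1)\<close>.
  The logarithmic derivative of the power is the sum of \<open>p_k(s) * adams k M\<close>. Writing
  \<open>p_k\<close> as the sum of \<open>i p'_i\<close> over \<open>i\<close> dividing
  \<open>k\<close> and collecting by \<open>i\<close> gives the sum of
  \<open>i p'_i(s) * adams i S\<close>, and \<open>i p'_i(s) p_i(t) / (1 + p_i(t))\<close> is the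
  logarithmic derivative of \<open>(1 + p_i(t))\<close> to the power \<open>p'_i(s)\<close>.\<close>

lemma FSMG_series:
  "ratify (pre_lambda_power (1 + hcomp_mps 1) (mps_const (hcomp 1))) =
    mps_prodinf (\<lambda>i. fps_subst_mps (Abs_fps (symfun_binomial (cyc_count i))) (psum_mps i))"
proof -
  define L where "L = Log_sigma (1 + hcomp_mps 1)"
  have y: "1 + hcomp_mps 1 \<in> (sym_series :: int symfun mps set)" "mcoeff (1 + hcomp_mps 1 :: int symfun mps) 0 = 1"
    using sym_series_psum_mps[of 1]
    by (auto simp: hcomp_mps_1 mcoeff_one mcoeff_psum_mps_0 intro: sym_series_add sym_series_one)
  have L: "L \<in> sym_series" "mcoeff L 0 = 0" "Exp_sigma L = 1 + psum_mps 1"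
    using sym_series_Log[OF y] mcoeff_Log_0[OF y] Exp_Log[OF y] by (simp_all add: L_def hcomp_mps_1)
  define M where "M = euler L"
  have M0: "mcoeff M 0 = 0"
    by (simp add: M_def mcoeff_euler)
  \<comment> \<open>The sum starts at index 0, where there is no Adams operation; the value 0 fills
    this place. Convergence holds since \<open>adams k M\<close> has order at least
    \<open>k\<close>.\<close>
  define S where "S = mps_suminf (\<lambda>k. if k = 0 then 0 else adams k M)"
  have S: "eqdeg n S (\<Sum>i=1..n. adams i M)" for n
  proof -
    have "eqdeg n S (\<Sum>k\<le>n. if k = 0 then 0 else adams k M)"
      unfolding S_def by (rule eqdeg_suminf) (auto intro: ordge_adams M0)
    also have "(\<Sum>k\<le>n. if k = 0 then 0 else adams k M) = (\<Sum>i=1..n. adams i M)"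
      by (rule sum.mono_neutral_cong_right) auto
    finally show ?thesis .
  qed
  have eS: "(1 + psum_mps 1) * S = psum_mps 1"
  proof (rule eqdeg_imp_eq, rule eqdeg_sym)
    fix n
    have "Poly_Mapping.single j (Suc 0) \<noteq> (0 :: monom)" for j
      by (metis mdeg_single mdeg_zero nat.distinct(1))
    then have "psum_mps 1 = euler (1 + psum_mps 1 :: int symfun mps)"
      by (intro mps_eqI) (auto simp: mcoeff_euler mcoeff_one psum_mps_def)
    also have "eqdeg n \<dots> ((1 + psum_mps 1) * (\<Sum>i=1..n. adams i M))"
      using euler_Exp[OF L(1,2), of n] by (simp only: L(3) M_def)
    also have "eqdeg n \<dots> ((1 + psum_mps 1) * S)"
      by (intro eqdeg_mult eqdeg_refl eqdeg_sym[OF S])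
    finally show "eqdeg n (psum_mps 1) ((1 + psum_mps 1) * S)" .
  qed
  have aS: "(1 + psum_mps i) * adams i S = psum_mps i" if "i \<ge> 1" for i
    using arg_cong[OF eS, of "adams i"] that
    by (simp add: adams_psum_mps unital_hom.hom_mult[OF unital_hom_adams]
        unital_hom.hom_add[OF unital_hom_adams] unital_hom.hom_one[OF unital_hom_adams])
  have aS': "eqdeg n (adams i S) (\<Sum>j=1..n. adams (i * j) M)" if i: "i \<ge> 1" for i n
  proof -
    interpret unital_hom "adams i"
      by (rule unital_hom_adams[OF i])
    have "eqdeg n (adams i S) (adams i (\<Sum>j=1..n. adams j M))"
      by (intro eqdeg_adams S i)
    also have "\<dots> = (\<Sum>j=1..n. adams (i * j) M)"
      unfolding hom_sum by (rule sum.cong) (use i in \<open>auto simp: adams_adams\<close>)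
    finally show ?thesis .
  qed
  interpret r: unital_hom ratify
    by (rule unital_hom_ratify)
  interpret C: unital_hom "mps_const :: rat symfun \<Rightarrow> rat symfun mps"
    by (rule unital_hom_mps_const)
  let ?c = "\<lambda>i. mps_const (of_nat i * cyc_count i) :: rat symfun mps"
  let ?F = "mps_const (psum 1) * L"
  have "ratify (Exp_sigma ?F) =
    mps_prodinf (\<lambda>i. fps_subst_mps (Abs_fps (symfun_binomial (cyc_count i))) (psum_mps i))"
  proof (rule ratify_Exp_eq_prodinf)
    show "?F \<in> sym_series"
      by (intro sym_series_mult sym_series_const L)
    show "mcoeff ?F 0 = 0"
      by (simp add: mcoeff_const_mult L)
    show "eqdeg n (\<Sum>i=1..n. ?c i * ratify (adams i S)) (ratify (\<Sum>k=1..n. adams k (euler ?F)))" for n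
    proof -
      have "eqdeg n (\<Sum>i=1..n. ?c i * ratify (adams i S))
          (\<Sum>i=1..n. ?c i * ratify (\<Sum>j=1..n. adams (i * j) M))"
        by (intro eqdeg_sum eqdeg_mult eqdeg_refl eqdeg_map aS') auto
      also have "\<dots> = (\<Sum>(i, j)\<in>{1..n} \<times> {1..n}. ?c i * ratify (adams (i * j) M))"
        by (simp add: r.hom_sum sum_distrib_left sum.cartesian_product)
      \<comment> \<open>Pairs with \<open>i * j\<close> above \<open>n\<close> contribute series of
        order above \<open>n\<close>.\<close>
      also have "eqdeg n \<dots> (\<Sum>(i, j)\<in>{(i, j) \<in> {1..n} \<times> {1..n}. i * j \<le> n}. ?c i * ratify (adams (i * j) M))"
      proof (rule eqdeg_sym, rule eqdeg_sum_superset)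
        fix x assume "x \<in> {1..n} \<times> {1..n} - {(i, j) \<in> {1..n} \<times> {1..n}. i * j \<le> n}"
        then obtain i j where x: "x = (i, j)" "i \<ge> 1" "j \<ge> 1" "Suc n \<le> i * j"
          by (cases x) auto
        have "ordge (i * j) (adams (i * j) M)"
          by (rule ordge_adams[OF M0]) (use x in simp)
        then have "ordge (i * j) (ratify (adams (i * j) M))"
          by (simp add: ordge_def unital_hom.hom_zero[OF unital_hom_symfun_of_int])
        then show "ordge (Suc n) (case x of (i, j) \<Rightarrow> ?c i * ratify (adams (i * j) M))"
          using x by (auto intro: ordge_const_mult ordge_mono)
      qed auto
      \<comment> \<open>Regroup by \<open>k = i * j\<close>, so that the inner sum over the divisors
        of \<open>k\<close> becomes \<open>psum k\<close>.\<close>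
      also have "(\<Sum>(i, j)\<in>{(i, j) \<in> {1..n} \<times> {1..n}. i * j \<le> n}. ?c i * ratify (adams (i * j) M)) =
          (\<Sum>(k, i)\<in>(SIGMA k:{1..n}. {i. i dvd k}). ?c i * ratify (adams k M))"
      proof (rule sum.reindex_bij_witness[where i = "\<lambda>(k, i). (i, k div i)" and j = "\<lambda>(i, j). (i * j, i)"])
        fix z assume "z \<in> (SIGMA k:{1..n}. {i. i dvd k})"
        then obtain i j where z: "z = (i * j, i)" "1 \<le> i * j" "i * j \<le> n"
          by (cases z) auto
        then have "i \<noteq> 0" "j \<noteq> 0" by auto
        then have "i * 1 \<le> i * j" "1 * j \<le> i * j"
          by (intro mult_le_mono; simp)+
        with z(3) have "i \<le> n" "j \<le> n"
          by linarith+
        with z \<open>i \<noteq> 0\<close> \<open>j \<noteq> 0\<close>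
        show "(case z of (k, i) \<Rightarrow> (i, k div i)) \<in> {(i, j) \<in> {1..n} \<times> {1..n}. i * j \<le> n}"
          by auto
      qed auto
      also have "\<dots> = (\<Sum>k=1..n. mps_const (psum k) * ratify (adams k M))"
      proof -
        have "(\<Sum>(k, i)\<in>(SIGMA k:{1..n}. {i. i dvd k}). ?c i * ratify (adams k M)) =
            (\<Sum>k=1..n. \<Sum>i | i dvd k. ?c i * ratify (adams k M))"
          by (subst sum.Sigma) auto
        also have "\<dots> = (\<Sum>k=1..n. mps_const (psum k) * ratify (adams k M))"
          by (intro sum.cong refl) (simp add: C.hom_sum[symmetric] sum_cyc_count flip: sum_distrib_right)
        finally show ?thesis .
      qed
      also have "\<dots> = ratify (\<Sum>k=1..n. adams k (euler ?F))"
        unfolding r.hom_sum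
        by (intro sum.cong refl)
          (simp add: euler_const_mult M_def adams_const_mult[unfolded One_nat_def] r.hom_mult ratify_const symfun_of_int_psum)
      finally show ?thesis .
    qed
    fix i :: nat assume i: "i \<ge> 1"
    let ?G = "fps_subst_mps (Abs_fps (symfun_binomial (cyc_count i))) (psum_mps i)"
    show "fps_nth (Abs_fps (symfun_binomial (cyc_count i))) 0 = 1"
      by simp
    have S0: "mcoeff S 0 = 0"
      using eqdegD[OF S[of 0], of 0] by simp
    show "mcoeff (?c i * ratify (adams i S)) 0 = 0"
      by (simp add: mcoeff_const_mult mcoeff_adams_0[OF i S0] unital_hom.hom_zero[OF unital_hom_symfun_of_int])
    have q: "(1 + psum_mps i) * ratify (adams i S) = psum_mps i"
      using arg_cong[OF aS[OF i], of ratify] by (simp add: r.hom_mult r.hom_add r.hom_one ratify_psum_mps)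
    have "(1 + psum_mps i) * euler ?G = of_nat i * mps_const (cyc_count i) * psum_mps i * ?G"
      using euler_fps_subst[of i "Abs_fps (symfun_binomial (cyc_count i))" 1 "cyc_count i"] i
        symfun_binomial_rec[of _ "cyc_count i"]
      by (simp add: C.hom_one del: of_nat_Suc)
    \<comment> \<open>Replacing \<open>psum_mps i\<close> by
      \<open>(1 + psum_mps i) * ratify (adams i S)\<close> exposes the factor
      \<open>1 + psum_mps i\<close>, which is then cancelled instead of inverted.\<close>
    also have "\<dots> = (1 + psum_mps i) * (?G * (?c i * ratify (adams i S)))"
    proof -
      have "of_nat i * mps_const (cyc_count i) * psum_mps i * ?G =
          of_nat i * mps_const (cyc_count i) * ((1 + psum_mps i) * ratify (adams i S)) * ?G"
        by (simp only: q)
      then show ?thesis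
        by (simp only: C.hom_mult mps_const_of_nat mult_ac)
    qed
    finally show "euler ?G = ?G * (?c i * ratify (adams i S))"
      by (rule one_plus_mult_cancel) (rule ordge_mono[OF ordge_psum_mps[of i]], use i in simp)
  qed
  then show ?thesis
    by (simp add: pre_lambda_power_def L_def hcomp_1[unfolded One_nat_def])
qed

subsection \<open>Expansions in products of power sums\<close>

text \<open>Takes the place of \<open>of_int\<close>, whose sort demands
  \<open>0 \<noteq> 1\<close>.\<close>

definition rat_emb :: "int \<Rightarrow> 'a::rat_algebra" where
  "rat_emb n = of_int n *\<^sub>Q 1"

lemma scaleQ_zero_left [simp]: "0 *\<^sub>Q x = (0 :: 'a::rat_algebra)"
  using scaleQ_add_left[of 0 0 x] by simp

lemma scaleQ_minus_right: "a *\<^sub>Q (- x) = - (a *\<^sub>Q x)" for x :: "'a::rat_algebra"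
  using scaleQ_add_right[of a x "- x"] by (simp add: eq_neg_iff_add_eq_0 add.commute)

lemma scaleQ_diff_right: "a *\<^sub>Q (x - y) = a *\<^sub>Q x - a *\<^sub>Q y" for x y :: "'a::rat_algebra"
  using scaleQ_add_right[of a x "- y"] by (simp add: scaleQ_minus_right)

lemma scaleQ_sum_right: "a *\<^sub>Q sum f A = (\<Sum>x\<in>A. a *\<^sub>Q f x)" for f :: "_ \<Rightarrow> 'a::rat_algebra"
  by (induction A rule: infinite_finite_induct) (simp_all add: scaleQ_add_right)

lemma scaleQ_cancel:
  assumes "a *\<^sub>Q x = a *\<^sub>Q y" "a \<noteq> 0"
  shows "x = (y :: 'a::rat_algebra)"
proof -
  have "(1 / a) *\<^sub>Q a *\<^sub>Q x = (1 / a) *\<^sub>Q a *\<^sub>Q y"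
    by (simp only: assms)
  then show ?thesis
    using assms(2) by (simp add: scaleQ_scaleQ scaleQ_one)
qed

lemma unital_hom_rat_emb: "unital_hom (rat_emb :: int \<Rightarrow> 'a::rat_algebra)"
  by standard (simp_all add: rat_emb_def scaleQ_add_left mult_scaleQ_left scaleQ_scaleQ scaleQ_one)

lemma mult_rat_emb: "x * rat_emb n = of_int n *\<^sub>Q x"
  by (simp add: rat_emb_def mult_scaleQ_right)

lemma mps_map_rat_emb_pmon: "mps_map rat_emb (pmon e) = (pmon e :: 'a::rat_algebra mps)"
proof -
  interpret e: unital_hom "rat_emb :: int \<Rightarrow> 'a"
    by (rule unital_hom_rat_emb)
  interpret unital_hom "mps_map (rat_emb :: int \<Rightarrow> 'a)"
    by (intro unital_hom_mps_map unital_hom_rat_emb)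
  have "mps_map rat_emb (psum_mps i) = (psum_mps i :: 'a mps)" for i
    by (rule mps_eqI) (simp add: psum_mps_def e.hom_one e.hom_zero)
  then show ?thesis
    by (simp add: pmon_def mprod_def hom_prod hom_power)
qed

text \<open>\<open>psum_series A\<close> is the infinite sum \<open>\<Sum>\<^sub>e A(e) \<Prod>\<^sub>i p\<^sub>i ^ e\<^sub>i\<close>.\<close>

definition psum_series :: "(monom \<Rightarrow> 'a::rat_algebra) \<Rightarrow> 'a mps" where
  "psum_series A = Abs_mps (\<lambda>m. \<Sum>e\<in>partitions_of (mdeg m). of_int (mcoeff (pmon e) m) *\<^sub>Q A e)"

lemma psum_series_cong:
  assumes "\<And>e. Poly_Mapping.lookup e 0 = 0 \<Longrightarrow> A e = B e"
  shows "psum_series A = psum_series B"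
  unfolding psum_series_def by (rule arg_cong[of _ _ Abs_mps], rule ext, rule sum.cong)
    (use assms in \<open>auto simp: partitions_of_def\<close>)

text \<open>Among the partitions of the size of \<open>e\<close> at which \<open>A\<close> and
  \<open>B\<close> differ, take one with the most parts. At a monomial of this type every other such
  partition contributes zero by triangularity, and the diagonal entry is invertible.\<close>

lemma psum_series_inject:
  assumes AB: "psum_series A = psum_series B" and e: "Poly_Mapping.lookup e 0 = 0"
  shows "A e = B e"
proof (rule ccontr)
  assume ne: "A e \<noteq> B e"
  define S where "S = {x \<in> partitions_of (wdeg e). A x \<noteq> B x}"
  have S: "finite S" "S \<noteq> {}"
    using ne e by (auto simp: S_def finite_partitions_of) (auto simp: partitions_of_def)
  then have "Max (mdeg ` S) \<in> mdeg ` S"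
    by (intro Max_in) auto
  then obtain x where x: "x \<in> S" "mdeg x = Max (mdeg ` S)"
    by auto
  have max: "mdeg y \<le> mdeg x" if "y \<in> S" for y
    unfolding x(2) using S that by (intro Max_ge) auto
  have x0: "Poly_Mapping.lookup x 0 = 0" "wdeg x = wdeg e"
    using x by (auto simp: S_def partitions_of_def)
  obtain m where m: "mtype m = x"
    using ex_mtype[OF x0(1)] by blast
  have card: "card (Poly_Mapping.keys m) = mdeg x" and deg: "mdeg m = wdeg e"
    using mdeg_mtype[of m] wdeg_mtype[of m] m x0 by auto
  have "0 = mcoeff (psum_series A) m - mcoeff (psum_series B) m"
    using AB by simp
  also have "\<dots> = (\<Sum>y\<in>partitions_of (wdeg e). of_int (mcoeff (pmon y) m) *\<^sub>Q (A y - B y))"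
    by (simp add: psum_series_def deg sum_subtractf scaleQ_diff_right)
  also have "\<dots> = (\<Sum>y\<in>{x}. of_int (mcoeff (pmon y) m) *\<^sub>Q (A y - B y))"
  proof (rule sum.mono_neutral_right[OF finite_partitions_of])
    show "{x} \<subseteq> partitions_of (wdeg e)"
      using x0 by (simp add: partitions_of_def)
    show "\<forall>y\<in>partitions_of (wdeg e) - {x}. of_int (mcoeff (pmon y) m) *\<^sub>Q (A y - B y) = 0"
    proof
      fix y assume y: "y \<in> partitions_of (wdeg e) - {x}"
      then have y0: "Poly_Mapping.lookup y 0 = 0"
        by (simp add: partitions_of_def)
      show "of_int (mcoeff (pmon y) m) *\<^sub>Q (A y - B y) = 0"
      proof (cases "y \<in> S")
        case True
        have "mcoeff (pmon y :: int mps) m = 0"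
        proof (cases "mdeg y = mdeg x")
          case True
          then show ?thesis
            using mcoeff_pmon_top[OF y0, of m] y m card by auto
        next
          case False
          then have "mdeg y < card (Poly_Mapping.keys m)"
            using max[OF True] card by simp
          then show ?thesis
            using mcoeff_pmon_card[OF y0, of m] by blast
        qed
        then show ?thesis by simp
      next
        case False
        with y have "A y = B y"
          by (simp add: S_def)
        then show ?thesis by simp
      qed
    qed
  qed
  also have "\<dots> = of_nat (fmon x) *\<^sub>Q (A x - B x)"
    using mcoeff_pmon_top[OF x0(1), of m] card m by simp
  finally have "of_nat (fmon x) *\<^sub>Q (A x - B x) = of_nat (fmon x) *\<^sub>Q 0"
    by simp
  then have "A x - B x = 0"
    by (rule scaleQ_cancel) (use fmon_pos[of x] in simp)
  with x show False
    by (simp add: S_def)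
qed

lemma prod_sum_bounded_monoms:
  fixes g :: "nat \<Rightarrow> nat \<Rightarrow> 'a::{comm_ring, comm_monoid_mult}"
  assumes "finite I"
  shows "(\<Prod>i\<in>I. \<Sum>k\<le>n. g i k) = (\<Sum>e\<in>bounded_monoms I n. \<Prod>i\<in>I. g i (Poly_Mapping.lookup e i))"
  using assms
proof (induction I rule: finite_induct)
  case empty
  have "bounded_monoms {} n = {0}"
    by (auto simp: bounded_monoms_def)
  then show ?case by simp
next
  case (insert j I)
  have lk: "Poly_Mapping.lookup e j = 0" if "e \<in> bounded_monoms I n" for e
    using that insert.hyps by (auto simp: bounded_monoms_def in_keys_iff)
  have "(\<Prod>i\<in>insert j I. \<Sum>k\<le>n. g i k) =
      (\<Sum>(k, e)\<in>{..n} \<times> bounded_monoms I n. g j k * (\<Prod>i\<in>I. g i (Poly_Mapping.lookup e i)))"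
    using insert by (simp add: sum_product sum.cartesian_product)
  also have "\<dots> = (\<Sum>e\<in>bounded_monoms (insert j I) n.
      g j (Poly_Mapping.lookup e j) * (\<Prod>i\<in>I. g i (Poly_Mapping.lookup e i)))"
  proof (rule sum.reindex_bij_witness[where
        i = "\<lambda>e. (Poly_Mapping.lookup e j, e - Poly_Mapping.single j (Poly_Mapping.lookup e j))" and
        j = "\<lambda>(k, e). e + Poly_Mapping.single j k"])
    fix z assume "z \<in> {..n} \<times> bounded_monoms I n"
    then obtain k e where z: "z = (k, e)" "k \<le> n" "e \<in> bounded_monoms I n"
      by auto
    have lj: "Poly_Mapping.lookup (e + Poly_Mapping.single j k) i = (if i = j then k else Poly_Mapping.lookup e i)" for i
      using lk[OF z(3)] by (simp add: lookup_add lookup_single when_def)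
    show "(Poly_Mapping.lookup (case z of (k, e) \<Rightarrow> e + Poly_Mapping.single j k) j,
        (case z of (k, e) \<Rightarrow> e + Poly_Mapping.single j k) -
        Poly_Mapping.single j (Poly_Mapping.lookup (case z of (k, e) \<Rightarrow> e + Poly_Mapping.single j k) j)) = z"
      by (simp add: z(1) lj mono_add_single_minus)
    show "(case z of (k, e) \<Rightarrow> e + Poly_Mapping.single j k) \<in> bounded_monoms (insert j I) n"
      using z(2,3) by (auto simp: z(1) bounded_monoms_def in_keys_iff lj subset_iff)
    have "(\<Prod>i\<in>I. g i (Poly_Mapping.lookup (e + Poly_Mapping.single j k) i)) =
        (\<Prod>i\<in>I. g i (Poly_Mapping.lookup e i))"
      using insert.hyps by (intro prod.cong) (auto simp: lj)
    then show "g j (Poly_Mapping.lookup (case z of (k, e) \<Rightarrow> e + Poly_Mapping.single j k) j) *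
        (\<Prod>i\<in>I. g i (Poly_Mapping.lookup (case z of (k, e) \<Rightarrow> e + Poly_Mapping.single j k) i)) =
        (case z of (k, e) \<Rightarrow> g j k * (\<Prod>i\<in>I. g i (Poly_Mapping.lookup e i)))"
      by (simp add: z(1) lj)
  next
    fix e assume e: "e \<in> bounded_monoms (insert j I) n"
    show "(case (Poly_Mapping.lookup e j, e - Poly_Mapping.single j (Poly_Mapping.lookup e j)) of
        (k, e) \<Rightarrow> e + Poly_Mapping.single j k) = e"
      by (simp add: mono_minus_single_add)
    show "(Poly_Mapping.lookup e j, e - Poly_Mapping.single j (Poly_Mapping.lookup e j))
        \<in> {..n} \<times> bounded_monoms I n"
      using e by (auto simp: bounded_monoms_def in_keys_iff lookup_minus lookup_single when_def subset_iff
          intro: le_trans[OF diff_le_self])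
  qed
  also have "\<dots> = (\<Sum>e\<in>bounded_monoms (insert j I) n. \<Prod>i\<in>insert j I. g i (Poly_Mapping.lookup e i))"
    using insert.hyps by simp
  finally show ?case .
qed

lemma prod_scaleQ:
  fixes x :: "'b \<Rightarrow> 'a::rat_algebra"
  shows "(\<Prod>i\<in>A. a i *\<^sub>Q x i) = prod a A *\<^sub>Q prod x A"
  by (induction A rule: infinite_finite_induct)
    (simp_all add: scaleQ_one mult_scaleQ_left mult_scaleQ_right scaleQ_scaleQ mult.commute)

text \<open>For the coefficient at \<open>m\<close>, the first \<open>mdeg m\<close> factors, each
  cut off after the power \<open>mdeg m\<close>, suffice. Multiplied out they give a sum over a box,
  in which homogeneity retains only the partitions of \<open>mdeg m\<close>.\<close>

lemma prodinf_eq_psum_series: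
  fixes \<gamma> :: "nat \<Rightarrow> 'a::rat_algebra fps"
  assumes \<gamma>: "\<And>i. i \<ge> 1 \<Longrightarrow> fps_nth (\<gamma> i) 0 = 1"
  shows "mps_prodinf (\<lambda>i. fps_subst_mps (\<gamma> i) (b i *\<^sub>Q psum_mps i)) =
    psum_series (mprod (\<lambda>i k. b i ^ k *\<^sub>Q fps_nth (\<gamma> i) k))"
proof (rule mps_eqI)
  fix m
  define n where "n = mdeg m"
  let ?p = "\<lambda>i. b i *\<^sub>Q psum_mps i :: 'a mps"
  let ?a = "\<lambda>i k. b i ^ k *\<^sub>Q fps_nth (\<gamma> i) k"
  interpret C: unital_hom "mps_const :: 'a \<Rightarrow> 'a mps"
    by (rule unital_hom_mps_const)
  have p: "ordge i (?p i)" for i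
    using ordge_psum_mps[of i, where 'a = 'a] by (simp add: ordge_def)
  have "eqdeg n (mps_prodinf (\<lambda>i. fps_subst_mps (\<gamma> i) (?p i))) (\<Prod>i=1..n. fps_subst_mps (\<gamma> i) (?p i))"
    by (intro eqdeg_prodinf ordge_fps_subst p \<gamma>)
  also have "eqdeg n \<dots> (\<Prod>i=1..n. \<Sum>k\<le>n. mps_const (fps_nth (\<gamma> i) k) * ?p i ^ k)"
    by (intro eqdeg_prod eqdeg_fps_subst ordge_mono[OF p]) auto
  also have "(\<Prod>i=1..n. \<Sum>k\<le>n. mps_const (fps_nth (\<gamma> i) k) * ?p i ^ k) =
      (\<Sum>e\<in>bounded_monoms {1..n} n. mps_const (mprod ?a e) * pmon e)"
    unfolding prod_sum_bounded_monoms[OF finite_atLeastAtMost]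
  proof (rule sum.cong[OF refl])
    fix e assume e: "e \<in> bounded_monoms {1..n} n"
    have c: "mps_const (fps_nth (\<gamma> i) k) * ?p i ^ k = mps_const (?a i k) * psum_mps i ^ k" for i k
      by (rule mps_eqI) (simp add: mcoeff_const_mult scaleQ_power mult_scaleQ_left mult_scaleQ_right)
    have "pmon e = (\<Prod>i=1..n. psum_mps i ^ Poly_Mapping.lookup e i :: 'a mps)"
      "mprod ?a e = (\<Prod>i=1..n. ?a i (Poly_Mapping.lookup e i))"
      unfolding pmon_def by (intro mprod_superset; use e \<gamma> in \<open>auto simp: bounded_monoms_def scaleQ_one\<close>)+
    then show "(\<Prod>i=1..n. mps_const (fps_nth (\<gamma> i) (Poly_Mapping.lookup e i)) * ?p i ^ Poly_Mapping.lookup e i) =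
        mps_const (mprod ?a e) * pmon e"
      by (simp only: c prod.distrib C.hom_prod)
  qed
  finally have "mcoeff (mps_prodinf (\<lambda>i. fps_subst_mps (\<gamma> i) (?p i))) m =
      (\<Sum>e\<in>bounded_monoms {1..n} n. mcoeff (mps_const (mprod ?a e) * pmon e) m)"
    using eqdegD[of n _ _ m] by (fastforce simp: n_def mcoeff_sum)
  also have "\<dots> = (\<Sum>e\<in>bounded_monoms {1..n} n. of_int (mcoeff (pmon e) m) *\<^sub>Q mprod ?a e)"
    by (simp add: mcoeff_const_mult mult_rat_emb flip: mps_map_rat_emb_pmon)
  also have "\<dots> = (\<Sum>e\<in>partitions_of n. of_int (mcoeff (pmon e) m) *\<^sub>Q mprod ?a e)"
  proof (rule sum.mono_neutral_right)
    show "\<forall>e\<in>bounded_monoms {1..n} n - partitions_of n. of_int (mcoeff (pmon e) m) *\<^sub>Q mprod ?a e = 0"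
    proof
      fix e assume e: "e \<in> bounded_monoms {1..n} n - partitions_of n"
      then have "0 \<notin> Poly_Mapping.keys e"
        by (auto simp: bounded_monoms_def)
      then have e0: "Poly_Mapping.lookup e 0 = 0"
        by (simp add: in_keys_iff)
      with e have "mcoeff (pmon e :: int mps) m = 0"
        using mcoeff_pmon_wdeg[OF e0, of m] by (auto simp: partitions_of_def n_def)
      then show "of_int (mcoeff (pmon e) m) *\<^sub>Q mprod ?a e = 0"
        by simp
    qed
  qed (use partitions_of_bounded in \<open>auto simp: finite_bounded_monoms\<close>)
  finally show "mcoeff (mps_prodinf (\<lambda>i. fps_subst_mps (\<gamma> i) (?p i))) m = mcoeff (psum_series (mprod ?a)) m"
    by (simp add: psum_series_def n_def)
qed

subsection \<open>The extension to rational symmetric functions\<close>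

lemma common_denominator:
  fixes V :: "rat set"
  assumes "finite V"
  shows "\<exists>N::nat. N > 0 \<and> (\<forall>x\<in>V. of_nat N * x \<in> \<int>)"
  using assms
proof (induction V rule: finite_induct)
  case (insert x V)
  then obtain N where N: "N > 0" "\<forall>x\<in>V. of_nat N * x \<in> \<int>"
    by blast
  obtain p q where q: "quotient_of x = (p, q)" "q > 0"
    using quotient_of_denom_pos' by (metis prod.exhaust_sel)
  have "of_nat (N * nat q) * y \<in> \<int>" if "y \<in> V" for y
  proof -
    have "of_nat (N * nat q) * y = of_int q * (of_nat N * y)"
      using q by simp
    with N that show ?thesis
      by (metis Ints_mult Ints_of_int)
  qed
  moreover have "of_nat (N * nat q) * x = of_int (int N * p)"
    using quotient_of_div[OF q(1)] q by (simp add: divide_simps mult.commute)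
  ultimately have "\<forall>y\<in>insert x V. of_nat (N * nat q) * y \<in> \<int>"
    by (metis Ints_of_int insert_iff)
  then show ?case
    using N q by (intro exI[of _ "N * nat q"]) simp
qed (auto intro: exI[of _ 1])

text \<open>A symmetric function has only finitely many different coefficients: they depend on the
  type alone, and bounded degree leaves finitely many types.\<close>

lemma symfun_denominator: "\<exists>N>0. \<exists>f. of_nat N *\<^sub>Q g = symfun_of_int f"
proof -
  let ?c = "mcoeff (mps_of_symfun g)"
  have "finite (range ?c)"
  proof -
    define rep where "rep e = (SOME m. mtype m = e)" for e
    have "mtype (rep (mtype m)) = mtype m" for m
      unfolding rep_def by (rule someI_ex) blast
    then have "?c m = ?c (rep (mtype m))" for m
      by (intro symfun_mtype) simp
    then have "range ?c \<subseteq> insert 0 ((\<lambda>e. ?c (rep e)) ` mtype ` {m. ?c m \<noteq> 0})"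
      by auto
    then show ?thesis
      by (rule finite_subset) (simp add: finite_mtype_support)
  qed
  from common_denominator[OF this] obtain N :: nat
    where "N > 0" "\<forall>x\<in>range ?c. of_nat N * x \<in> \<int>"
    by blast
  then have N: "N > 0" "\<And>m. of_nat N * ?c m \<in> \<int>"
    by simp_all
  \<comment> \<open>Nothing is rounded: the floor merely converts rationals already known to be
    integral.\<close>
  let ?F = "mps_map (\<lambda>x. \<lfloor>of_nat N * x\<rfloor>) (mps_of_symfun g)"
  have "?F \<in> sym_series \<and> bounded_degree ?F"
    using mps_of_symfun[of g] by (auto simp: sym_series_def bounded_degree_def) (metis floor_zero mult_zero_right)
  then have F: "mps_of_symfun (Abs_symfun ?F) = ?F"
    by (intro Abs_symfun_inverse) simp
  have "mcoeff (mps_of_symfun (of_nat N *\<^sub>Q g)) m = mcoeff (mps_of_symfun (symfun_of_int (Abs_symfun ?F))) m" for m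
    using N(2)[of m] by (simp add: scaleQ_symfun.rep_eq symfun_of_int.rep_eq F scaleQ_rat_def)
  then have "of_nat N *\<^sub>Q g = symfun_of_int (Abs_symfun ?F)"
    by (auto intro!: mps_eqI simp flip: mps_of_symfun_inject)
  with N show ?thesis by blast
qed

lemma symfun_of_int_inject: "symfun_of_int f = symfun_of_int g \<longleftrightarrow> f = g"
proof
  assume "symfun_of_int f = symfun_of_int g"
  then have "mcoeff (mps_of_symfun (symfun_of_int f)) m = mcoeff (mps_of_symfun (symfun_of_int g)) m" for m
    by simp
  then have "mcoeff (mps_of_symfun f) m = mcoeff (mps_of_symfun g) m" for m
    by (simp add: symfun_of_int.rep_eq)
  then show "f = g"
    by (auto intro!: mps_eqI simp flip: mps_of_symfun_inject)
qed simp

lemma additive_of_nat_mult: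
  fixes \<mu> :: "int symfun \<Rightarrow> 'c::rat_algebra"
  assumes "additive \<mu>"
  shows "\<mu> (of_nat n * f) = of_nat n *\<^sub>Q \<mu> f"
proof -
  interpret additive \<mu> by fact
  show ?thesis
    by (induction n) (simp_all add: zero add distrib_right scaleQ_add_left scaleQ_one)
qed

lemma additive_of_int_mult:
  fixes \<mu> :: "int symfun \<Rightarrow> 'c::rat_algebra"
  assumes "additive \<mu>"
  shows "\<mu> (of_int k * f) = of_int k *\<^sub>Q \<mu> f"
proof (cases k)
  case (nonneg n)
  then show ?thesis by (simp add: additive_of_nat_mult[OF assms])
next
  case (neg n)
  interpret additive \<mu> by fact
  have "of_int k *\<^sub>Q \<mu> f = - (of_nat (Suc n) *\<^sub>Q \<mu> f)"
    using scaleQ_add_left[of "of_nat (Suc n)" "- of_nat (Suc n)" "\<mu> f"]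
    by (simp add: neg eq_neg_iff_add_eq_0 add.commute del: of_nat_Suc)
  then show ?thesis
    using additive_of_nat_mult[OF assms, of "Suc n" f] minus by (simp add: neg del: of_nat_Suc)
qed

text \<open>If \<open>N g\<close> is integral, the value at \<open>g\<close> must be
  \<open>\<mu>(N g) / N\<close>. \<open>P\<close> is the graph of this rule; comparing two
  denominators through their product shows it to be single-valued.\<close>

lemma ex1_rat_extension:
  fixes \<mu> :: "int symfun \<Rightarrow> 'c::rat_algebra"
  assumes \<mu>: "additive \<mu>"
  shows "\<exists>!\<nu>. Vector_Spaces.linear scaleQ scaleQ \<nu> \<and> (\<forall>f. \<nu> (symfun_of_int f) = \<mu> f)"
proof -
  interpret S: unital_hom symfun_of_int
    by (rule unital_hom_symfun_of_int)
  interpret additive \<mu> by fact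
  define P where "P g y \<longleftrightarrow> (\<exists>N>0. \<exists>f. of_nat N *\<^sub>Q g = symfun_of_int f \<and> of_nat N *\<^sub>Q y = \<mu> f)" for g y
  have of_nat_hom: "symfun_of_int (of_nat n * f) = of_nat n *\<^sub>Q symfun_of_int f" for n f
    by (simp add: S.hom_mult unital_hom_of_nat[OF unital_hom_symfun_of_int] of_nat_mult_scaleQ)
  have ex: "\<exists>y. P g y" for g
  proof -
    obtain N f where Nf: "N > 0" "of_nat N *\<^sub>Q g = symfun_of_int f"
      using symfun_denominator by blast
    then have "of_nat N *\<^sub>Q (1 / of_nat N) *\<^sub>Q \<mu> f = \<mu> f"
      by (simp add: scaleQ_scaleQ scaleQ_one)
    with Nf show ?thesis
      unfolding P_def by blast
  qed
  have PE: "\<exists>N f. N > 0 \<and> of_nat N *\<^sub>Q g = symfun_of_int f \<and> of_nat N *\<^sub>Q y = \<mu> f" if "P g y" for g y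
    using that unfolding P_def by blast
  have unique: "y = y'" if y: "P g y" and y': "P g y'" for g y y'
  proof -
    obtain N f where 1: "N > 0" "of_nat N *\<^sub>Q g = symfun_of_int f" "of_nat N *\<^sub>Q y = \<mu> f"
      using PE[OF y] by blast
    obtain N' f' where 2: "N' > 0" "of_nat N' *\<^sub>Q g = symfun_of_int f'" "of_nat N' *\<^sub>Q y' = \<mu> f'"
      using PE[OF y'] by blast
    note Nf = 1 2
    have "symfun_of_int (of_nat N' * f) = symfun_of_int (of_nat N * f')"
      by (simp add: of_nat_hom scaleQ_scaleQ mult.commute[of "rat_of_nat N'"] flip: Nf(2,5))
    then have "\<mu> (of_nat N' * f) = \<mu> (of_nat N * f')"
      by (simp add: symfun_of_int_inject)
    then have "(of_nat N * of_nat N') *\<^sub>Q y = (of_nat N * of_nat N') *\<^sub>Q y'"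
      by (simp add: additive_of_nat_mult[OF \<mu>] scaleQ_scaleQ mult.commute[of "rat_of_nat N'"] flip: Nf(3,6))
    then show ?thesis
      by (rule scaleQ_cancel) (use Nf in simp)
  qed
  define \<nu> where "\<nu> g = (THE y. P g y)" for g
  have \<nu>: "P g (\<nu> g)" for g
    unfolding \<nu>_def by (rule theI') (use ex unique in blast)
  have eqI: "\<nu> g = y" if "P g y" for g y
    using unique[OF \<nu> that] .
  have \<nu>_add: "\<nu> (g + h) = \<nu> g + \<nu> h" for g h
  proof (rule eqI)
    obtain N f where 1: "N > 0" "of_nat N *\<^sub>Q g = symfun_of_int f" "of_nat N *\<^sub>Q \<nu> g = \<mu> f"
      using PE[OF \<nu>] by blast
    obtain N' f' where 2: "N' > 0" "of_nat N' *\<^sub>Q h = symfun_of_int f'" "of_nat N' *\<^sub>Q \<nu> h = \<mu> f'"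
      using PE[OF \<nu>] by blast
    note Nf = 1 2
    have "of_nat (N * N') *\<^sub>Q (g + h) = symfun_of_int (of_nat N' * f + of_nat N * f')"
      by (simp add: S.hom_add of_nat_hom scaleQ_add_right scaleQ_scaleQ mult.commute[of "rat_of_nat N'"] flip: Nf(2,5))
    moreover have "of_nat (N * N') *\<^sub>Q (\<nu> g + \<nu> h) = \<mu> (of_nat N' * f + of_nat N * f')"
      by (simp add: add additive_of_nat_mult[OF \<mu>] scaleQ_add_right scaleQ_scaleQ mult.commute[of "rat_of_nat N'"] flip: Nf(3,6))
    ultimately show "P (g + h) (\<nu> g + \<nu> h)"
      unfolding P_def using Nf by (intro exI[of _ "N * N'"]) auto
  qed
  have \<nu>_scale: "\<nu> (c *\<^sub>Q g) = c *\<^sub>Q \<nu> g" for c g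
  proof (rule eqI)
    obtain N f where Nf: "N > 0" "of_nat N *\<^sub>Q g = symfun_of_int f" "of_nat N *\<^sub>Q \<nu> g = \<mu> f"
      using PE[OF \<nu>] by blast
    obtain p q where q: "quotient_of c = (p, q)" "q > 0"
      using quotient_of_denom_pos' by (metis prod.exhaust_sel)
    have c: "of_nat (N * nat q) * c = of_int p * of_nat N"
      using quotient_of_div[OF q(1)] q by (simp add: divide_simps mult.commute)
    have "additive symfun_of_int"
      by (simp add: additive_def S.hom_add)
    then have "of_nat (N * nat q) *\<^sub>Q c *\<^sub>Q g = symfun_of_int (of_int p * f)"
      by (simp add: additive_of_int_mult scaleQ_scaleQ c del: of_nat_mult flip: Nf(2))
    moreover have "of_nat (N * nat q) *\<^sub>Q c *\<^sub>Q \<nu> g = \<mu> (of_int p * f)"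
      by (simp add: additive_of_int_mult[OF \<mu>] scaleQ_scaleQ c del: of_nat_mult flip: Nf(3))
    ultimately show "P (c *\<^sub>Q g) (c *\<^sub>Q \<nu> g)"
      unfolding P_def using Nf q by (intro exI[of _ "N * nat q"]) auto
  qed
  have \<nu>_int: "\<nu> (symfun_of_int f) = \<mu> f" for f
  proof (rule eqI)
    have "of_nat 1 *\<^sub>Q symfun_of_int f = symfun_of_int f" "of_nat 1 *\<^sub>Q \<mu> f = \<mu> f"
      by (simp_all add: scaleQ_one)
    then show "P (symfun_of_int f) (\<mu> f)"
      unfolding P_def by blast
  qed
  show ?thesis
  proof (rule ex1I[of _ \<nu>])
    show "Vector_Spaces.linear scaleQ scaleQ \<nu> \<and> (\<forall>f. \<nu> (symfun_of_int f) = \<mu> f)"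
      by (simp add: Vector_Spaces.linear_iff vector_space_scaleQ \<nu>_add \<nu>_scale \<nu>_int)
    fix \<nu>' assume *: "Vector_Spaces.linear scaleQ scaleQ \<nu>' \<and> (\<forall>f. \<nu>' (symfun_of_int f) = \<mu> f)"
    show "\<nu>' = \<nu>"
    proof
      fix g
      obtain N f where Nf: "N > 0" "of_nat N *\<^sub>Q g = symfun_of_int f" "of_nat N *\<^sub>Q \<nu> g = \<mu> f"
        using PE[OF \<nu>] by blast
      have "of_nat N *\<^sub>Q \<nu>' g = \<nu>' (of_nat N *\<^sub>Q g)"
        using * by (simp add: Vector_Spaces.linear_iff)
      also have "\<dots> = of_nat N *\<^sub>Q \<nu> g"
        using * Nf by simp
      finally show "\<nu>' g = \<nu> g"
        by (rule scaleQ_cancel) (use Nf in simp)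
    qed
  qed
qed

lemma
  fixes \<mu> :: "int symfun \<Rightarrow> 'c::rat_algebra"
  assumes "Lambda_distribution \<mu>"
  shows rat_extension_add: "rat_extension \<mu> (x + y) = rat_extension \<mu> x + rat_extension \<mu> y"
    and rat_extension_scaleQ: "rat_extension \<mu> (c *\<^sub>Q x) = c *\<^sub>Q rat_extension \<mu> x"
    and rat_extension_of_int: "rat_extension \<mu> (symfun_of_int f) = \<mu> f"
    and rat_extension_one: "rat_extension \<mu> 1 = 1"
proof -
  have \<mu>: "additive \<mu>" "\<mu> 1 = 1"
    using assms by (auto simp: Lambda_distribution_def)
  have *: "Vector_Spaces.linear scaleQ scaleQ (rat_extension \<mu>) \<and> (\<forall>f. rat_extension \<mu> (symfun_of_int f) = \<mu> f)"
    unfolding rat_extension_def by (rule theI'[OF ex1_rat_extension[OF \<mu>(1)]])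
  show "rat_extension \<mu> (x + y) = rat_extension \<mu> x + rat_extension \<mu> y"
    "rat_extension \<mu> (c *\<^sub>Q x) = c *\<^sub>Q rat_extension \<mu> x"
    "rat_extension \<mu> (symfun_of_int f) = \<mu> f"
    using * by (auto simp: Vector_Spaces.linear_iff)
  show "rat_extension \<mu> 1 = 1"
    using * \<mu>(2) unital_hom.hom_one[OF unital_hom_symfun_of_int] by metis
qed

lemma rat_extension_sum:
  assumes "Lambda_distribution \<mu>"
  shows "rat_extension \<mu> (sum f A) = (\<Sum>x\<in>A. rat_extension \<mu> (f x))"
proof -
  have "rat_extension \<mu> 0 = 0"
    using rat_extension_add[OF assms, of 0 0] by simp
  then show ?thesis
    by (induction A rule: infinite_finite_induct) (simp_all add: rat_extension_add[OF assms])
qed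

lemma mps_map_ratify:
  assumes "Lambda_distribution \<mu>"
  shows "mps_map \<mu> F = mps_map (rat_extension \<mu>) (ratify F)"
  by (rule mps_eqI) (simp add: rat_extension_of_int[OF assms])

lemma mps_map_psum_series:
  assumes "Lambda_distribution \<mu>"
  shows "mps_map (rat_extension \<mu>) (psum_series A) = psum_series (\<lambda>e. rat_extension \<mu> (A e))"
  by (rule mps_eqI)
    (simp add: psum_series_def rat_extension_sum[OF assms] rat_extension_scaleQ[OF assms])

subsection \<open>Independence\<close>

text \<open>\<open>h\<close> serves merely as a finitely supported sequence of coefficients, taken
  with respect to a family \<open>q\<close> in place of the powers.\<close>

definition lincomb :: "(nat \<Rightarrow> 'a::rat_algebra) \<Rightarrow> rat poly \<Rightarrow> 'a" where
  "lincomb q h = (\<Sum>k\<le>degree h. coeff h k *\<^sub>Q q k)"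

lemma qpoly_eval_eq_lincomb: "qpoly_eval g x = lincomb (\<lambda>k. x ^ k) g"
  by (simp add: qpoly_eval_def lincomb_def)

lemma lincomb_superset: "degree h \<le> n \<Longrightarrow> lincomb q h = (\<Sum>k\<le>n. coeff h k *\<^sub>Q q k)"
  unfolding lincomb_def
  by (rule sum.mono_neutral_left) (auto simp: coeff_eq_0)

lemma lincomb_zero [simp]: "lincomb q 0 = 0"
  by (simp add: lincomb_def)

lemma lincomb_add: "lincomb q (g + h) = lincomb q g + lincomb q h"
  using lincomb_superset[of g "max (degree g) (degree h)" q]
    lincomb_superset[of h "max (degree g) (degree h)" q]
    lincomb_superset[of "g + h" "max (degree g) (degree h)" q] degree_add_le_max[of g h]
  by (simp add: scaleQ_add_left sum.distrib)

lemma lincomb_smult: "lincomb q (Polynomial.smult a h) = a *\<^sub>Q lincomb q h"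
  using lincomb_superset[of "Polynomial.smult a h" "degree h" q]
  by (simp add: lincomb_def scaleQ_sum_right scaleQ_scaleQ)

lemma lincomb_monom: "lincomb q (Polynomial.monom a k) = a *\<^sub>Q q k"
  by (simp add: lincomb_superset[of _ k] degree_monom_le if_distrib[of "\<lambda>c. c *\<^sub>Q _"] cong: if_cong)

lemma qpoly_eval_pCons: "qpoly_eval (pCons a g) x = a *\<^sub>Q 1 + x * qpoly_eval g x"
proof -
  have "qpoly_eval (pCons a g) x = (\<Sum>k\<le>Suc (degree g). coeff (pCons a g) k *\<^sub>Q x ^ k)"
    unfolding qpoly_eval_eq_lincomb by (rule lincomb_superset) (rule degree_pCons_le)
  also have "\<dots> = a *\<^sub>Q 1 + (\<Sum>k\<le>degree g. coeff g k *\<^sub>Q x ^ Suc k)"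
    unfolding sum.atMost_Suc_shift by simp
  also have "\<dots> = a *\<^sub>Q 1 + x * qpoly_eval g x"
    by (simp add: qpoly_eval_def sum_distrib_left mult_scaleQ_right)
  finally show ?thesis .
qed

text \<open>The recurrence holds for \<open>x^k / k!\<close> with \<open>c = 0\<close> and for the
  binomials of \<open>x\<close> with \<open>c = 1\<close>. As \<open>Suc k\<close> is invertible, it
  expresses each \<open>q k\<close> as a polynomial in \<open>x\<close>; read as multiplication by
  \<open>x\<close>, it keeps the span of the \<open>q k\<close> stable and so yields the
  converse.\<close>

context
  fixes x :: "'a::rat_algebra" and q :: "nat \<Rightarrow> 'a" and c :: rat
  assumes q0: "q 0 = 1"
    and rec: "\<And>k. x * q k = of_nat (Suc k) *\<^sub>Q q (Suc k) + (c * of_nat k) *\<^sub>Q q k"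
begin

lemma basis_eq_qpoly_eval: "\<exists>g. qpoly_eval g x = q k"
proof (induction k)
  case 0
  have "qpoly_eval (pCons 1 0) x = q 0"
    by (simp only: qpoly_eval_pCons) (simp add: qpoly_eval_eq_lincomb q0 scaleQ_one)
  then show ?case ..
next
  case (Suc k)
  then obtain g where g: "qpoly_eval g x = q k" ..
  let ?g = "Polynomial.smult (1 / of_nat (Suc k)) (pCons 0 g + Polynomial.smult (- (c * of_nat k)) g)"
  have "qpoly_eval ?g x = (1 / of_nat (Suc k)) *\<^sub>Q (x * q k + (- (c * of_nat k)) *\<^sub>Q q k)"
    using qpoly_eval_pCons[of 0 g x] g
    unfolding qpoly_eval_eq_lincomb lincomb_smult lincomb_add by simp
  also have "x * q k + (- (c * of_nat k)) *\<^sub>Q q k = of_nat (Suc k) *\<^sub>Q q (Suc k)"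
    unfolding rec using scaleQ_add_left[of "c * of_nat k" "- (c * of_nat k)" "q k"]
    by (simp add: add.assoc)
  finally have "qpoly_eval ?g x = q (Suc k)"
    by (simp add: scaleQ_scaleQ scaleQ_one del: of_nat_Suc)
  then show ?case ..
qed

lemma qpoly_eval_eq_basis: "\<exists>h. qpoly_eval g x = lincomb q h"
proof (induction g)
  case 0
  show ?case
    by (rule exI[of _ 0]) (simp add: qpoly_eval_eq_lincomb)
next
  case (pCons a g)
  then obtain h where h: "qpoly_eval g x = lincomb q h" by blast
  let ?h = "\<Sum>k\<le>degree h. Polynomial.monom (coeff h k * of_nat (Suc k)) (Suc k) + Polynomial.monom (coeff h k * (c * of_nat k)) k"
  have sum: "lincomb q (sum f A) = (\<Sum>k\<in>A. lincomb q (f k))" for f and A :: "nat set"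
    by (induction A rule: infinite_finite_induct) (simp_all add: lincomb_add)
  have "x * lincomb q h = (\<Sum>k\<le>degree h. coeff h k *\<^sub>Q (x * q k))"
    by (simp add: lincomb_def sum_distrib_left mult_scaleQ_right)
  also have "\<dots> = lincomb q ?h"
    unfolding sum rec by (simp only: lincomb_add lincomb_monom scaleQ_add_right scaleQ_scaleQ)
  finally have "qpoly_eval (pCons a g) x = lincomb q (Polynomial.monom a 0 + ?h)"
    by (simp add: qpoly_eval_pCons h lincomb_add lincomb_monom q0)
  then show ?case ..
qed

end

text \<open>Independence is linear in each test polynomial, so it need only be tested on a spanning
  family. A choice of one basis element for each of finitely many indices is an exponent vector
  \<open>e\<close>.\<close>

lemma independent_family_basis:
  fixes \<mu> :: "int symfun \<Rightarrow> 'c::rat_algebra" and f :: "nat \<Rightarrow> rat symfun"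
  assumes \<mu>: "Lambda_distribution \<mu>"
    and q0: "\<And>i. q i 0 = 1"
    and rec: "\<And>i k. f i * q i k = of_nat (Suc k) *\<^sub>Q q i (Suc k) + (c * of_nat k) *\<^sub>Q q i k"
  shows "independent_family \<mu> {1..} f \<longleftrightarrow>
    (\<forall>e. Poly_Mapping.lookup e 0 = 0 \<longrightarrow>
      rat_extension \<mu> (mprod q e) = mprod (\<lambda>i k. rat_extension \<mu> (q i k)) e)"
proof
  assume ind: "independent_family \<mu> {1..} f"
  show "\<forall>e. Poly_Mapping.lookup e 0 = 0 \<longrightarrow>
      rat_extension \<mu> (mprod q e) = mprod (\<lambda>i k. rat_extension \<mu> (q i k)) e"
  proof (intro allI impI)
    fix e :: monom assume e: "Poly_Mapping.lookup e 0 = 0"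
    have "\<exists>g. qpoly_eval g (f i) = q i k" for i k
      by (rule basis_eq_qpoly_eval[where c = c]) (use q0 rec in auto)
    then obtain g where g: "\<And>i k. qpoly_eval (g i k) (f i) = q i k"
      by metis
    have "Poly_Mapping.keys e \<subseteq> {1..}"
      using e by (metis atLeast_iff in_keys_iff less_one not_le subsetI)
    then have "rat_extension \<mu> (\<Prod>j\<in>Poly_Mapping.keys e. qpoly_eval (g j (Poly_Mapping.lookup e j)) (f j)) =
        (\<Prod>j\<in>Poly_Mapping.keys e. rat_extension \<mu> (qpoly_eval (g j (Poly_Mapping.lookup e j)) (f j)))"
      using ind[unfolded independent_family_def, rule_format,
          of "Poly_Mapping.keys e" "\<lambda>j. g j (Poly_Mapping.lookup e j)"] by simp
    then show "rat_extension \<mu> (mprod q e) = mprod (\<lambda>i k. rat_extension \<mu> (q i k)) e"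
      by (simp add: g mprod_def)
  qed
next
  let ?\<nu> = "rat_extension \<mu>"
  assume mult: "\<forall>e. Poly_Mapping.lookup e 0 = 0 \<longrightarrow> ?\<nu> (mprod q e) = mprod (\<lambda>i k. ?\<nu> (q i k)) e"
  show "independent_family \<mu> {1..} f"
    unfolding independent_family_def
  proof (intro allI impI, elim conjE)
    fix J :: "nat set" and g assume J: "finite J" "J \<subseteq> {1..}"
    have "\<exists>h. qpoly_eval (g i) (f i) = lincomb (q i) h" for i
      by (rule qpoly_eval_eq_basis[where c = c]) (use q0 rec in auto)
    then obtain h where h: "\<And>i. qpoly_eval (g i) (f i) = lincomb (q i) (h i)"
      by metis
    \<comment> \<open>A common bound for all degrees, so that the product is multiplied out over a
      single box.\<close>
    define n where "n = (\<Sum>j\<in>J. degree (h j))"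
    have n: "degree (h j) \<le> n" if "j \<in> J" for j
      unfolding n_def using J that by (intro member_le_sum) auto
    have ev: "qpoly_eval (g j) (f j) = (\<Sum>k\<le>n. coeff (h j) k *\<^sub>Q q j k)" if "j \<in> J" for j
      using lincomb_superset[OF n[OF that]] by (simp add: h)
    let ?c = "\<lambda>e. \<Prod>j\<in>J. coeff (h j) (Poly_Mapping.lookup e j)"
    have "(\<Prod>j\<in>J. qpoly_eval (g j) (f j)) = (\<Prod>j\<in>J. \<Sum>k\<le>n. coeff (h j) k *\<^sub>Q q j k)"
      by (rule prod.cong) (auto simp: ev)
    also have "\<dots> = (\<Sum>e\<in>bounded_monoms J n. ?c e *\<^sub>Q mprod q e)"
      unfolding prod_sum_bounded_monoms[OF J(1)] prod_scaleQ
      by (rule sum.cong) (use J q0 in \<open>auto simp: bounded_monoms_def mprod_superset[of J]\<close>)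
    finally have "?\<nu> (\<Prod>j\<in>J. qpoly_eval (g j) (f j)) = (\<Sum>e\<in>bounded_monoms J n. ?c e *\<^sub>Q ?\<nu> (mprod q e))"
      by (simp add: rat_extension_sum[OF \<mu>] rat_extension_scaleQ[OF \<mu>])
    also have "\<dots> = (\<Sum>e\<in>bounded_monoms J n. ?c e *\<^sub>Q mprod (\<lambda>i k. ?\<nu> (q i k)) e)"
    proof (rule sum.cong[OF refl])
      fix e assume "e \<in> bounded_monoms J n"
      then have "0 \<notin> Poly_Mapping.keys e"
        using J by (auto simp: bounded_monoms_def)
      then have "Poly_Mapping.lookup e 0 = 0"
        by (simp add: in_keys_iff)
      with mult show "?c e *\<^sub>Q ?\<nu> (mprod q e) = ?c e *\<^sub>Q mprod (\<lambda>i k. ?\<nu> (q i k)) e"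
        by simp
    qed
    also have "\<dots> = (\<Prod>j\<in>J. \<Sum>k\<le>n. coeff (h j) k *\<^sub>Q ?\<nu> (q j k))"
      unfolding prod_sum_bounded_monoms[OF J(1)] prod_scaleQ
      by (rule sum.cong)
        (use J in \<open>auto simp: bounded_monoms_def mprod_superset[of J] q0 rat_extension_one[OF \<mu>]\<close>)
    also have "\<dots> = (\<Prod>j\<in>J. ?\<nu> (qpoly_eval (g j) (f j)))"
      by (rule prod.cong) (simp_all add: ev rat_extension_sum[OF \<mu>] rat_extension_scaleQ[OF \<mu>])
    finally show "?\<nu> (\<Prod>j\<in>J. qpoly_eval (g j) (f j)) = (\<Prod>j\<in>J. ?\<nu> (qpoly_eval (g j) (f j)))" .
  qed
qed

lemma mprod_scaleQ: "mprod (\<lambda>i k. a i k *\<^sub>Q x i k) e = mprod a e *\<^sub>Q mprod x e"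
  for x :: "nat \<Rightarrow> nat \<Rightarrow> 'a::rat_algebra"
  by (simp add: mprod_def prod_scaleQ)

text \<open>Both \<open>G\<close> and the product expand in the power sum monomials, with the joint
  moments of the \<open>q i\<close> on one side and products of coefficients of the
  \<open>\<gamma> i\<close> on the other. Linear independence turns equality into multiplicativity
  of joint moments. The scalars \<open>b i\<close> account for the argument \<open>p_i / i\<close>
  in the first generating function.\<close>

lemma independent_iff_product:
  fixes \<mu> :: "int symfun \<Rightarrow> 'c::rat_algebra" and f :: "nat \<Rightarrow> rat symfun"
  assumes \<mu>: "Lambda_distribution \<mu>"
    and q0: "\<And>i. q i 0 = 1"
    and rec: "\<And>i k. f i * q i k = of_nat (Suc k) *\<^sub>Q q i (Suc k) + (c * of_nat k) *\<^sub>Q q i k"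
    and b: "\<And>i. i \<ge> 1 \<Longrightarrow> b i \<noteq> 0"
    and G: "G = mps_map \<mu> E" "ratify E = mps_prodinf (\<lambda>i. fps_subst_mps (Abs_fps (\<lambda>k. b i ^ k *\<^sub>Q q i k)) (psum_mps i))"
  defines "prod_form \<equiv> \<lambda>\<gamma>. (\<forall>i\<ge>1. fps_nth (\<gamma> i) 0 = 1) \<and>
      G = mps_prodinf (\<lambda>i. fps_subst_mps (\<gamma> i) (b i *\<^sub>Q psum_mps i))"
  shows "independent_family \<mu> {1..} f \<longleftrightarrow> (\<exists>\<gamma>. prod_form \<gamma>)"
    and "prod_form \<gamma> \<Longrightarrow> i \<ge> 1 \<Longrightarrow> \<gamma> i = Abs_fps (\<lambda>k. rat_extension \<mu> (q i k))"
proof -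
  let ?\<nu> = "rat_extension \<mu>"
  let ?b = "\<lambda>e. mprod (\<lambda>i k. b i ^ k) e"
  have b0: "?b e \<noteq> 0" if "Poly_Mapping.lookup e 0 = 0" for e
  proof -
    have "i \<ge> 1" if "i \<in> Poly_Mapping.keys e" for i
      using that \<open>Poly_Mapping.lookup e 0 = 0\<close> by (metis in_keys_iff less_one not_le)
    then show ?thesis
      using b by (auto simp: mprod_def)
  qed
  have "ratify E = psum_series (mprod (\<lambda>i k. 1 ^ k *\<^sub>Q (b i ^ k *\<^sub>Q q i k)))"
    unfolding G(2) using prodinf_eq_psum_series[of "\<lambda>i. Abs_fps (\<lambda>k. b i ^ k *\<^sub>Q q i k)" "\<lambda>_. 1"]
    by (simp add: q0 scaleQ_one)
  then have series: "G = psum_series (\<lambda>e. ?b e *\<^sub>Q ?\<nu> (mprod q e))"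
    by (simp add: G(1) mps_map_ratify[OF \<mu>] mps_map_psum_series[OF \<mu>] mprod_scaleQ rat_extension_scaleQ[OF \<mu>] scaleQ_one)
  have form: "prod_form \<gamma> \<longleftrightarrow> (\<forall>i\<ge>1. fps_nth (\<gamma> i) 0 = 1) \<and>
      (\<forall>e. Poly_Mapping.lookup e 0 = 0 \<longrightarrow> ?\<nu> (mprod q e) = mprod (\<lambda>i k. fps_nth (\<gamma> i) k) e)" for \<gamma>
  proof (cases "\<forall>i\<ge>1. fps_nth (\<gamma> i) 0 = 1")
    case True
    have "mprod (\<lambda>i k. b i ^ k *\<^sub>Q fps_nth (\<gamma> i) k) =
        (\<lambda>e. ?b e *\<^sub>Q mprod (\<lambda>i k. fps_nth (\<gamma> i) k) e)"
      by (rule ext) (rule mprod_scaleQ)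
    with True have "prod_form \<gamma> \<longleftrightarrow> psum_series (\<lambda>e. ?b e *\<^sub>Q ?\<nu> (mprod q e)) =
        psum_series (\<lambda>e. ?b e *\<^sub>Q mprod (\<lambda>i k. fps_nth (\<gamma> i) k) e)"
      using series prodinf_eq_psum_series[of \<gamma> b] by (simp add: prod_form_def)
    also have "\<dots> \<longleftrightarrow> (\<forall>e. Poly_Mapping.lookup e 0 = 0 \<longrightarrow>
        ?b e *\<^sub>Q ?\<nu> (mprod q e) = ?b e *\<^sub>Q mprod (\<lambda>i k. fps_nth (\<gamma> i) k) e)"
      by (intro iffI allI impI psum_series_cong) (auto dest: psum_series_inject)
    also have "\<dots> \<longleftrightarrow> (\<forall>e. Poly_Mapping.lookup e 0 = 0 \<longrightarrow> ?\<nu> (mprod q e) = mprod (\<lambda>i k. fps_nth (\<gamma> i) k) e)"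
      using b0 scaleQ_cancel by metis
    finally show ?thesis
      using True by simp
  qed (auto simp: prod_form_def)
  show coeffs: "\<gamma> i = Abs_fps (\<lambda>k. ?\<nu> (q i k))" if \<gamma>: "prod_form \<gamma>" and i: "i \<ge> 1" for \<gamma> i
  proof (rule fps_ext)
    fix k
    \<comment> \<open>A vector concentrated at one index isolates a single coefficient of
      \<open>\<gamma> i\<close>, all other factors being empty; this is the uniqueness
      statement.\<close>
    have "?\<nu> (mprod q (Poly_Mapping.single i k)) = mprod (\<lambda>i k. fps_nth (\<gamma> i) k) (Poly_Mapping.single i k)"
      using \<gamma> i unfolding form by (simp add: lookup_single when_def)
    then show "fps_nth (\<gamma> i) k = fps_nth (Abs_fps (\<lambda>k. ?\<nu> (q i k))) k"
      using \<gamma> i unfolding form by (simp add: mprod_single q0)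
  qed
  note ind = independent_family_basis[OF \<mu> q0 rec]
  show "independent_family \<mu> {1..} f \<longleftrightarrow> (\<exists>\<gamma>. prod_form \<gamma>)"
  proof
    assume "independent_family \<mu> {1..} f"
    then have "prod_form (\<lambda>i. Abs_fps (\<lambda>k. ?\<nu> (q i k)))"
      unfolding ind form by (simp add: q0 rat_extension_one[OF \<mu>] Abs_fps_inverse)
    then show "\<exists>\<gamma>. prod_form \<gamma>"
      by (rule exI[where P = prod_form])
  next
    assume "\<exists>\<gamma>. prod_form \<gamma>"
    then obtain \<gamma> where \<gamma>: "prod_form \<gamma>" ..
    show "independent_family \<mu> {1..} f"
      unfolding ind
    proof (intro allI impI)
      fix e :: monom assume e: "Poly_Mapping.lookup e 0 = 0"
      have "fps_nth (\<gamma> i) k = ?\<nu> (q i k)" if "i \<in> Poly_Mapping.keys e" for i k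
      proof -
        have "i \<ge> 1"
          using that e by (metis in_keys_iff less_one not_le)
        then show ?thesis
          by (simp add: coeffs[OF \<gamma>])
      qed
      then have "mprod (\<lambda>i k. fps_nth (\<gamma> i) k) e = mprod (\<lambda>i k. ?\<nu> (q i k)) e"
        by (intro mprod_cong)
      with \<gamma> e show "?\<nu> (mprod q e) = mprod (\<lambda>i k. ?\<nu> (q i k)) e"
        unfolding form by simp
    qed
  qed
qed

theorem theorem3:
  fixes \<mu> :: "int symfun \<Rightarrow> 'c::rat_algebra"
  assumes "Lambda_distribution \<mu>"
  shows
    "(independent_family \<mu> {1..} psum \<longleftrightarrow>
        (\<exists>\<gamma> :: nat \<Rightarrow> 'c fps. (\<forall>i\<ge>1. fps_nth (\<gamma> i) 0 = 1) \<and>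
          SMG \<mu> = mps_prodinf (\<lambda>i. fps_subst_mps (\<gamma> i) ((1 / of_nat i) *\<^sub>Q psum_mps i)))) \<and>
     (\<forall>\<gamma> :: nat \<Rightarrow> 'c fps. (\<forall>i\<ge>1. fps_nth (\<gamma> i) 0 = 1) \<and>
          SMG \<mu> = mps_prodinf (\<lambda>i. fps_subst_mps (\<gamma> i) ((1 / of_nat i) *\<^sub>Q psum_mps i)) \<longrightarrow>
        (\<forall>i\<ge>1. \<gamma> i = moment_gf \<mu> (psum i))) \<and>
     (independent_family \<mu> {1..} cyc_count \<longleftrightarrow>
        (\<exists>\<gamma> :: nat \<Rightarrow> 'c fps. (\<forall>i\<ge>1. fps_nth (\<gamma> i) 0 = 1) \<and>
          FSMG \<mu> = mps_prodinf (\<lambda>i. fps_subst_mps (\<gamma> i) (psum_mps i)))) \<and>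
     (\<forall>\<gamma> :: nat \<Rightarrow> 'c fps. (\<forall>i\<ge>1. fps_nth (\<gamma> i) 0 = 1) \<and>
          FSMG \<mu> = mps_prodinf (\<lambda>i. fps_subst_mps (\<gamma> i) (psum_mps i)) \<longrightarrow>
        (\<forall>i\<ge>1. \<gamma> i = falling_moment_gf \<mu> (cyc_count i)))"
proof -
  note \<mu> = assms
  define q :: "nat \<Rightarrow> nat \<Rightarrow> rat symfun" where "q i k = (1 / fact k) *\<^sub>Q psum i ^ k" for i k
  have q0: "q i 0 = 1" for i
    by (simp add: q_def scaleQ_one)
  \<comment> \<open>The vanishing term represents \<open>c = 0\<close>; for the binomials below the
    parameter is 1.\<close>
  have q_rec: "psum i * q i k = of_nat (Suc k) *\<^sub>Q q i (Suc k) + (0 * of_nat k) *\<^sub>Q q i k" for i k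
    using divided_power_rec[of k "psum i"]
    by (simp only: q_def of_nat_mult_scaleQ[where 'a = "rat symfun"] mult_zero_left scaleQ_zero_left add_0_right)
  have q_series: "ratify (Exp_sigma (mps_const (hcomp 1) * hcomp_mps 1)) =
      mps_prodinf (\<lambda>i. fps_subst_mps (Abs_fps (\<lambda>k. (1 / of_nat i) ^ k *\<^sub>Q q i k)) (psum_mps i))"
    unfolding SMG_series by (simp only: q_def scaleQ_power scaleQ_scaleQ mult.commute)
  have b_rec: "cyc_count i * symfun_binomial (cyc_count i) k =
      of_nat (Suc k) *\<^sub>Q symfun_binomial (cyc_count i) (Suc k) + (1 * of_nat k) *\<^sub>Q symfun_binomial (cyc_count i) k" for i k
    using symfun_binomial_rec[of k "cyc_count i"]
    by (simp only: of_nat_mult_scaleQ[where 'a = "rat symfun"] mult_1_left)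
  have b_series: "ratify (pre_lambda_power (1 + hcomp_mps 1) (mps_const (hcomp 1))) =
      mps_prodinf (\<lambda>i. fps_subst_mps (Abs_fps (\<lambda>k. 1 ^ k *\<^sub>Q symfun_binomial (cyc_count i) k)) (psum_mps i))"
    unfolding FSMG_series by (simp add: scaleQ_one)
  \<comment> \<open>The premise left open is that \<open>1 / of_nat i\<close> is nonzero for
    \<open>i \<ge> 1\<close>.\<close>
  note smg = independent_iff_product[where b = "\<lambda>i. 1 / of_nat i", OF \<mu> q0 q_rec _ SMG_def q_series]
  note fsmg = independent_iff_product[where b = "\<lambda>i. 1" and q = "\<lambda>i. symfun_binomial (cyc_count i)",
      OF \<mu> symfun_binomial_0 b_rec _ FSMG_def b_series, simplified scaleQ_one]
  have "moment_gf \<mu> (psum i) = Abs_fps (\<lambda>k. rat_extension \<mu> (q i k))" for i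
    by (simp add: moment_gf_def q_def rat_extension_scaleQ[OF \<mu>])
  moreover have "falling_moment_gf \<mu> (cyc_count i) =
      Abs_fps (\<lambda>k. rat_extension \<mu> (symfun_binomial (cyc_count i) k))" for i
    by (simp add: falling_moment_gf_def)
  ultimately show ?thesis
    using smg fsmg by simp
qed

end
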